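(* Let $M = \mathrm{Inv}\langle X \mid r_i(u_1, u_2, \ldots, u_k) = 1\ (i \in I)\rangle$ be a finitely presented E-unitary special inverse monoid, where $u_1,\dots,u_k$ are words over $X\cup X^{-1}$, let $G = \mathrm{Gp}\langle X \mid r_i(u_1, u_2, \ldots, u_k) = 1\ (i \in I)\rangle$ be its maximal group image and let $U_M$ be its group of units. If $u_1, u_2, \ldots, u_k$ are the minimal invertible pieces of $M$ and are uniquely marked, then the following are equivalent: (1) the word problem of $G$ is decidable; (2) the word problem of $M$ is decidable; (3) the word problem of $U_M$ is decidable.
   Context: $\mathrm{Inv}\langle X \mid R\rangle$ and $\mathrm{Gp}\langle X \mid R\rangle$ denote the inverse monoid, respectively group, with generators $X$ and defining relations $R$ between words over $X \cup X^{-1}$. Words are not assumed reduced. The notation $r_i(u_1,\ldots,u_k)$ means that the word $r_i$ is given as a concatenation (in the free monoid, without cancellation) of the words $u_j$ and their formal inverses; by convention each $u_j$ occurs as $u_j$ or $u_j^{-1}$ in at least one $r_i$. The words $u_1,\dots,u_k$ are the minimal invertible pieces of $M$ if each $u_j$ represents a unit of $M$ and no $u_j$ has a non-trivial proper prefix (non-empty, not the whole word) representing a unit of $M$. The words are uniquely marked if for each $j$ there is a letter $x_j \in X$ appearing precisely once in $u_j$ (counting both $x_j$ and $x_j^{-1}$) and not appearing (as $x_j$ or $x_j^{-1}$) in any $u_{j'}$, $j'\neq j$. $M$ is E-unitary if only idempotents of $M$ map to $1$ in its maximal group image $G$. The word problem asks, given two words over the (finite) generating set and its inverses, whether they represent the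 same element. ($U_M$ is finitely generated: it is generated by the minimal invertible pieces.) *)

theory Defs
  imports "HOL-Algebra.Group" "HOL-Library.Sublist" "HOL-Library.Nat_Bijection"
begin

section \<open>Words and presentations\<close>

text \<open>The letter \<open>(x, True)\<close> stands for \<open>x\<close> and \<open>(x, False)\<close> for its formal inverse.
  Words are not assumed to be reduced.\<close>

type_synonym 'a word = "('a \<times> bool) list"

definition words :: "'a set \<Rightarrow> 'a word set" where
  "words X = lists (X \<times> UNIV)"

definition inv_word :: "'a word \<Rightarrow> 'a word" where
  "inv_word w = rev (map (\<lambda>(x, b). (x, \<not> b)) w)"

text \<open>\<open>subst_word u r\<close> is \<open>r(u\<^sub>1, \<dots>, u\<^sub>k)\<close>, a concatenation without cancellation.\<close>

definition subst_word :: "('b \<Rightarrow> 'a word) \<Rightarrow> 'b word \<Rightarrow> 'a word" where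
  "subst_word u r = concat (map (\<lambda>(j, b). if b then u j else inv_word (u j)) r)"

text \<open>The least congruence on the free monoid \<open>words X\<close> that contains the pairs of \<open>S\<close> between
  words over \<open>X\<close>.\<close>

inductive_set congr :: "'a set \<Rightarrow> ('a word \<times> 'a word) set \<Rightarrow> ('a word \<times> 'a word) set"
  for X :: "'a set" and S :: "('a word \<times> 'a word) set" where
  step: "(v, w) \<in> S \<Longrightarrow> v \<in> words X \<Longrightarrow> w \<in> words X \<Longrightarrow> p \<in> words X \<Longrightarrow> q \<in> words X
           \<Longrightarrow> (p @ v @ q, p @ w @ q) \<in> congr X S"
| refl: "w \<in> words X \<Longrightarrow> (w, w) \<in> congr X S"
| sym: "(v, w) \<in> congr X S \<Longrightarrow> (w, v) \<in> congr X S"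
| trans: "(u, v) \<in> congr X S \<Longrightarrow> (v, w) \<in> congr X S \<Longrightarrow> (u, w) \<in> congr X S"

definition quotient_monoid :: "'a set \<Rightarrow> ('a word \<times> 'a word) set \<Rightarrow> 'a word set monoid" where
  "quotient_monoid X E =
     \<lparr>carrier = words X // E,
      mult = (\<lambda>P Q. \<Union>v\<in>P. \<Union>w\<in>Q. E `` {v @ w}),
      one = E `` {[]}\<rparr>"

text \<open>The relations of the Vagner congruence define the free inverse monoid on \<open>X\<close>.\<close>

definition vagner_rels :: "'a set \<Rightarrow> ('a word \<times> 'a word) set" where
  "vagner_rels X =
     {(w @ inv_word w @ w, w) | w. w \<in> words X} \<union>
     {(w @ inv_word w @ z @ inv_word z, z @ inv_word z @ w @ inv_word w) | w z.
        w \<in> words X \<and> z \<in> words X}"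

definition free_group_rels :: "'a set \<Rightarrow> ('a word \<times> 'a word) set" where
  "free_group_rels X = {([(x, b), (x, \<not> b)], []) | x b. x \<in> X}"

definition inv_congr :: "'a set \<Rightarrow> ('a word \<times> 'a word) set \<Rightarrow> ('a word \<times> 'a word) set" where
  "inv_congr X R = congr X (vagner_rels X \<union> R)"

definition gp_congr :: "'a set \<Rightarrow> ('a word \<times> 'a word) set \<Rightarrow> ('a word \<times> 'a word) set" where
  "gp_congr X R = congr X (free_group_rels X \<union> R)"

definition Inv :: "'a set \<Rightarrow> ('a word \<times> 'a word) set \<Rightarrow> 'a word set monoid" where
  "Inv X R = quotient_monoid X (inv_congr X R)"

definition Gp :: "'a set \<Rightarrow> ('a word \<times> 'a word) set \<Rightarrow> 'a word set monoid" where
  "Gp X R = quotient_monoid X (gp_congr X R)"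

definition inv_class :: "'a set \<Rightarrow> ('a word \<times> 'a word) set \<Rightarrow> 'a word \<Rightarrow> 'a word set" where
  "inv_class X R w = inv_congr X R `` {w}"

definition gp_class :: "'a set \<Rightarrow> ('a word \<times> 'a word) set \<Rightarrow> 'a word \<Rightarrow> 'a word set" where
  "gp_class X R w = gp_congr X R `` {w}"

text \<open>The natural homomorphism from \<open>Inv X R\<close> onto its maximal group image \<open>Gp X R\<close>; it sends
  \<open>inv_class X R w\<close> to \<open>gp_class X R w\<close> (lemma \<open>max_group_map_class\<close> below).\<close>

definition max_group_map ::
    "'a set \<Rightarrow> ('a word \<times> 'a word) set \<Rightarrow> 'a word set \<Rightarrow> 'a word set" where
  "max_group_map X R m = gp_congr X R `` m"

definition E_unitary :: "'a set \<Rightarrow> ('a word \<times> 'a word) set \<Rightarrow> bool" where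
  "E_unitary X R \<longleftrightarrow>
     (\<forall>m \<in> carrier (Inv X R). max_group_map X R m = \<one>\<^bsub>Gp X R\<^esub> \<longrightarrow> m \<otimes>\<^bsub>Inv X R\<^esub> m = m)"


section \<open>Inverse monoids and evaluation of words\<close>

definition inverse_monoid :: "('m, 'c) monoid_scheme \<Rightarrow> bool" where
  "inverse_monoid S \<longleftrightarrow> monoid S \<and>
     (\<forall>s \<in> carrier S. \<exists>!t. t \<in> carrier S \<and> s \<otimes>\<^bsub>S\<^esub> t \<otimes>\<^bsub>S\<^esub> s = s \<and> t \<otimes>\<^bsub>S\<^esub> s \<otimes>\<^bsub>S\<^esub> t = t)"

text \<open>The inverse in the sense of inverse monoids. It agrees with \<open>inv\<close> in a group, but it is
  defined for all elements of an inverse monoid and not only for its units.\<close>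

definition im_inv :: "('m, 'c) monoid_scheme \<Rightarrow> 'm \<Rightarrow> 'm" where
  "im_inv S s =
     (THE t. t \<in> carrier S \<and> s \<otimes>\<^bsub>S\<^esub> t \<otimes>\<^bsub>S\<^esub> s = s \<and> t \<otimes>\<^bsub>S\<^esub> s \<otimes>\<^bsub>S\<^esub> t = t)"

text \<open>The element of \<open>S\<close> represented by a word over the index set of a family of generators.\<close>

fun word_value :: "('m, 'c) monoid_scheme \<Rightarrow> ('b \<Rightarrow> 'm) \<Rightarrow> 'b word \<Rightarrow> 'm" where
  "word_value S g [] = \<one>\<^bsub>S\<^esub>"
| "word_value S g ((x, b) # w) = (if b then g x else im_inv S (g x)) \<otimes>\<^bsub>S\<^esub> word_value S g w"

definition finite_generating_family ::
    "('m, 'c) monoid_scheme \<Rightarrow> 'b set \<Rightarrow> ('b \<Rightarrow> 'm) \<Rightarrow> bool" where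
  "finite_generating_family S A g \<longleftrightarrow>
     finite A \<and> g ` A \<subseteq> carrier S \<and> carrier S = word_value S g ` words A"


section \<open>Decidability\<close>

text \<open>Total recursive functions of a given arity, with minimisation restricted to regular
  functions. Functions of arity \<open>n\<close> are given as functions on lists, whose values matter only on
  lists of length \<open>n\<close>.\<close>

inductive recursive_fun :: "nat \<Rightarrow> (nat list \<Rightarrow> nat) \<Rightarrow> bool" where
  rec_zero: "recursive_fun n (\<lambda>xs. 0)"
| rec_suc: "recursive_fun 1 (\<lambda>xs. Suc (xs ! 0))"
| rec_proj: "i < n \<Longrightarrow> recursive_fun n (\<lambda>xs. xs ! i)"
| rec_comp: "recursive_fun m f \<Longrightarrow> length gs = m \<Longrightarrow> \<forall>g \<in> set gs. recursive_fun n g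
    \<Longrightarrow> recursive_fun n (\<lambda>xs. f (map (\<lambda>g. g xs) gs))"
| rec_prim: "recursive_fun n f \<Longrightarrow> recursive_fun (Suc (Suc n)) g
    \<Longrightarrow> recursive_fun (Suc n)
          (\<lambda>xs. rec_nat (f (tl xs)) (\<lambda>y v. g (y # v # tl xs)) (hd xs))"
| rec_mu: "recursive_fun (Suc n) f \<Longrightarrow> \<forall>xs. length xs = n \<longrightarrow> (\<exists>y. f (y # xs) = 0)
    \<Longrightarrow> recursive_fun n (\<lambda>xs. LEAST y. f (y # xs) = 0)"
| rec_ext: "recursive_fun n f \<Longrightarrow> \<forall>xs. length xs = n \<longrightarrow> f xs = g xs \<Longrightarrow> recursive_fun n g"

definition encode_word :: "('b \<Rightarrow> nat) \<Rightarrow> 'b word \<Rightarrow> nat" where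
  "encode_word c w = list_encode (map (\<lambda>(x, b). 2 * c x + of_bool b) w)"

text \<open>Decidability of a binary relation between words over a finite alphabet \<open>A\<close>. Two numberings
  \<open>c\<close> of \<open>A\<close> differ by a permutation of a finite set, so the choice of \<open>c\<close> is immaterial.\<close>

definition decidable_word_rel :: "'b set \<Rightarrow> ('b word \<Rightarrow> 'b word \<Rightarrow> bool) \<Rightarrow> bool" where
  "decidable_word_rel A P \<longleftrightarrow>
     (\<exists>c f. bij_betw c A {..<card A} \<and> recursive_fun 2 f \<and>
        (\<forall>v \<in> words A. \<forall>w \<in> words A.
           f [encode_word c v, encode_word c w] = (if P v w then 1 else 0)))"

text \<open>The word problem of \<open>S\<close> with respect to a finite generating family.\<close>

definition decidable_word_problem ::
    "('m, 'c) monoid_scheme \<Rightarrow> 'b set \<Rightarrow> ('b \<Rightarrow> 'm) \<Rightarrow> bool" where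
  "decidable_word_problem S A g \<longleftrightarrow>
     finite_generating_family S A g \<and>
     decidable_word_rel A (\<lambda>v w. word_value S g v = word_value S g w)"


section \<open>Conditions on the pieces\<close>

definition represents_unit :: "'a set \<Rightarrow> ('a word \<times> 'a word) set \<Rightarrow> 'a word \<Rightarrow> bool" where
  "represents_unit X R w \<longleftrightarrow> inv_class X R w \<in> Units (Inv X R)"

definition minimal_invertible_pieces ::
    "'a set \<Rightarrow> ('a word \<times> 'a word) set \<Rightarrow> 'j set \<Rightarrow> ('j \<Rightarrow> 'a word) \<Rightarrow> bool" where
  "minimal_invertible_pieces X R J u \<longleftrightarrow>
     (\<forall>j \<in> J. represents_unit X R (u j) \<and>
        (\<forall>p. strict_prefix p (u j) \<and> p \<noteq> [] \<longrightarrow> \<not> represents_unit X R p))"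

definition uniquely_marked :: "'a set \<Rightarrow> 'j set \<Rightarrow> ('j \<Rightarrow> 'a word) \<Rightarrow> bool" where
  "uniquely_marked X J u \<longleftrightarrow>
     (\<forall>j \<in> J. \<exists>x \<in> X. count_list (map fst (u j)) x = 1 \<and>
        (\<forall>j' \<in> J. j' \<noteq> j \<longrightarrow> x \<notin> fst ` set (u j')))"


section \<open>Basic properties\<close>

lemma words_simps [simp]:
  "[] \<in> words X"
  "v @ w \<in> words X \<longleftrightarrow> v \<in> words X \<and> w \<in> words X"
  "a # w \<in> words X \<longleftrightarrow> fst a \<in> X \<and> w \<in> words X"
  by (cases a; auto simp: words_def)+

lemma inv_word_in [simp]: "inv_word w \<in> words X \<longleftrightarrow> w \<in> words X"
  by (auto simp: words_def inv_word_def in_lists_conv_set)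

lemma inv_word_inv_word [simp]: "inv_word (inv_word w) = w"
  by (induction w) (auto simp: inv_word_def)

lemma inv_word_append [simp]: "inv_word (v @ w) = inv_word w @ inv_word v"
  by (simp add: inv_word_def)

lemma inv_word_Nil [simp]: "inv_word [] = []"
  by (simp add: inv_word_def)

lemma congr_words: "(v, w) \<in> congr X S \<Longrightarrow> v \<in> words X \<and> w \<in> words X"
  by (induction rule: congr.induct) auto

lemma congr_context:
  "(v, w) \<in> congr X S \<Longrightarrow> p \<in> words X \<Longrightarrow> q \<in> words X \<Longrightarrow> (p @ v @ q, p @ w @ q) \<in> congr X S"
proof (induction rule: congr.induct)
  case (step v w p' q')
  then show ?case using congr.step[of v w S X "p @ p'" "q' @ q"] by simp
qed (auto intro: congr.intros)

lemma equiv_congr: "equiv (words X) (congr X S)"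
  by (intro equivI refl_onI symI transI)
     (auto intro: congr.intros dest: congr_words)

lemma congr_append:
  "(v, v') \<in> congr X S \<Longrightarrow> (w, w') \<in> congr X S \<Longrightarrow> (v @ w, v' @ w') \<in> congr X S"
  using congr_context[of v v' X S "[]" w] congr_context[of w w' X S v' "[]"]
  by (auto intro: congr.trans dest: congr_words)

lemma congr_rel: "(v, w) \<in> S \<Longrightarrow> v \<in> words X \<Longrightarrow> w \<in> words X \<Longrightarrow> (v, w) \<in> congr X S"
  using congr.step[of v w S X "[]" "[]"] by simp

lemma congr_class_eq:
  "v \<in> words X \<Longrightarrow> w \<in> words X \<Longrightarrow> congr X S `` {v} = congr X S `` {w} \<longleftrightarrow> (v, w) \<in> congr X S"
  by (simp add: eq_equiv_class_iff[OF equiv_congr])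

lemma quotient_monoid_mult:
  assumes "v \<in> words X" "w \<in> words X"
  shows "congr X S `` {v} \<otimes>\<^bsub>quotient_monoid X (congr X S)\<^esub> congr X S `` {w}
           = congr X S `` {v @ w}"
proof -
  let ?E = "congr X S"
  have "?E `` {v' @ w'} = ?E `` {v @ w}" if "v' \<in> ?E `` {v}" "w' \<in> ?E `` {w}" for v' w'
    using equiv_class_eq[OF equiv_congr congr_append[of v v' X S w w']] that by blast
  moreover have "v \<in> ?E `` {v}" "w \<in> ?E `` {w}"
    using assms by (auto intro: congr.refl)
  ultimately have "(\<Union>v'\<in>?E `` {v}. \<Union>w'\<in>?E `` {w}. ?E `` {v' @ w'}) = ?E `` {v @ w}"
    by blast
  then show ?thesis by (simp add: quotient_monoid_def)
qed

lemma quotient_monoid_carrier: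
  "carrier (quotient_monoid X (congr X S)) = (\<lambda>w. congr X S `` {w}) ` words X"
  by (auto simp: quotient_monoid_def quotient_def)

lemma quotient_monoid_one: "\<one>\<^bsub>quotient_monoid X (congr X S)\<^esub> = congr X S `` {[]}"
  by (simp add: quotient_monoid_def)

lemma monoid_quotient_monoid: "monoid (quotient_monoid X (congr X S))"
  by (rule monoidI)
     (auto simp: quotient_monoid_carrier quotient_monoid_mult quotient_monoid_one)

lemma gp_cancel:
  "w \<in> words X \<Longrightarrow> (w @ inv_word w, []) \<in> gp_congr X R"
proof (induction w)
  case Nil
  then show ?case by (auto simp: gp_congr_def intro: congr.refl)
next
  case (Cons a w)
  obtain x b where a: "a = (x, b)" by (cases a)
  have x: "x \<in> X" using Cons.prems a by simp
  have "([(x, b)] @ (w @ inv_word w) @ [(x, \<not> b)], [(x, b)] @ [] @ [(x, \<not> b)]) \<in> gp_congr X R"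
    using Cons x unfolding gp_congr_def by (intro congr_context) auto
  moreover have "([(x, b), (x, \<not> b)], []) \<in> gp_congr X R"
    using x unfolding gp_congr_def by (intro congr_rel) (auto simp: free_group_rels_def)
  ultimately show ?case
    unfolding gp_congr_def by (auto simp: a inv_word_def intro: congr.trans)
qed

lemma group_Gp: "group (Gp X R)"
proof -
  have "congr X (free_group_rels X \<union> R) `` {inv_word w @ w}
          = congr X (free_group_rels X \<union> R) `` {[]}" if "w \<in> words X" for w
    using gp_cancel[of "inv_word w" X R] that by (subst congr_class_eq) (simp_all add: gp_congr_def)
  then have "\<exists>y\<in>carrier (Gp X R). y \<otimes>\<^bsub>Gp X R\<^esub> x = \<one>\<^bsub>Gp X R\<^esub>" if "x \<in> carrier (Gp X R)" for x
    using that unfolding Gp_def gp_congr_def quotient_monoid_carrier quotient_monoid_one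
    by (auto simp: quotient_monoid_mult intro!: bexI[of _ "inv_word _"])
  then show ?thesis
    using monoid.group_l_invI monoid_quotient_monoid unfolding Gp_def gp_congr_def by blast
qed

lemma inv_class_carrier: "carrier (Inv X R) = inv_class X R ` words X"
  by (simp add: Inv_def inv_class_def inv_congr_def quotient_monoid_carrier)

lemma gp_class_carrier: "carrier (Gp X R) = gp_class X R ` words X"
  by (simp add: Gp_def gp_class_def gp_congr_def quotient_monoid_carrier)

lemma inv_class_mult:
  "v \<in> words X \<Longrightarrow> w \<in> words X \<Longrightarrow>
     inv_class X R v \<otimes>\<^bsub>Inv X R\<^esub> inv_class X R w = inv_class X R (v @ w)"
  by (simp add: Inv_def inv_class_def inv_congr_def quotient_monoid_mult)

lemma gp_class_mult:
  "v \<in> words X \<Longrightarrow> w \<in> words X \<Longrightarrow>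
     gp_class X R v \<otimes>\<^bsub>Gp X R\<^esub> gp_class X R w = gp_class X R (v @ w)"
  by (simp add: Gp_def gp_class_def gp_congr_def quotient_monoid_mult)

lemma inv_class_one: "\<one>\<^bsub>Inv X R\<^esub> = inv_class X R []"
  by (simp add: Inv_def inv_class_def inv_congr_def quotient_monoid_one)

lemma gp_class_one: "\<one>\<^bsub>Gp X R\<^esub> = gp_class X R []"
  by (simp add: Gp_def gp_class_def gp_congr_def quotient_monoid_one)

lemma inv_class_eq:
  "v \<in> words X \<Longrightarrow> w \<in> words X \<Longrightarrow>
     inv_class X R v = inv_class X R w \<longleftrightarrow> (v, w) \<in> inv_congr X R"
  by (simp add: inv_class_def inv_congr_def congr_class_eq)

lemma gp_class_eq:
  "v \<in> words X \<Longrightarrow> w \<in> words X \<Longrightarrow>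
     gp_class X R v = gp_class X R w \<longleftrightarrow> (v, w) \<in> gp_congr X R"
  by (simp add: gp_class_def gp_congr_def congr_class_eq)

lemma monoid_Inv: "monoid (Inv X R)"
  by (simp add: Inv_def inv_congr_def monoid_quotient_monoid)

lemma inv_class_regular:
  "w \<in> words X \<Longrightarrow> inv_class X R (w @ inv_word w @ w) = inv_class X R w"
  by (subst inv_class_eq) (auto simp: inv_congr_def vagner_rels_def intro!: congr_rel)

lemma inv_class_commute:
  "w \<in> words X \<Longrightarrow> z \<in> words X \<Longrightarrow>
     inv_class X R (w @ inv_word w @ z @ inv_word z)
       = inv_class X R (z @ inv_word z @ w @ inv_word w)"
  by (subst inv_class_eq) (auto simp: inv_congr_def vagner_rels_def intro!: congr_rel)

lemma inverse_monoidI: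
  fixes S (structure)
  assumes "monoid S" and F: "F \<subseteq> carrier S"
    and comm: "\<And>e f. e \<in> F \<Longrightarrow> f \<in> F \<Longrightarrow> e \<otimes> f = f \<otimes> e"
    and ex: "\<And>x. x \<in> carrier S \<Longrightarrow>
      \<exists>y\<in>carrier S. x \<otimes> y \<otimes> x = x \<and> y \<otimes> x \<otimes> y = y \<and> x \<otimes> y \<in> F \<and> y \<otimes> x \<in> F"
  shows "inverse_monoid S"
proof -
  interpret monoid S by fact
  have idem_F: "e \<in> F" if e: "e \<in> carrier S" "e \<otimes> e = e" for e
  proof -
    obtain y where y: "y \<in> carrier S" "e \<otimes> y \<otimes> e = e" "y \<otimes> e \<otimes> y = y" "e \<otimes> y \<in> F" "y \<otimes> e \<in> F"
      using ex[OF e(1)] by blast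
    have c: "(y \<otimes> e) \<otimes> (e \<otimes> y) = (e \<otimes> y) \<otimes> (y \<otimes> e)" using comm y by blast
    have "(y \<otimes> e) \<otimes> (e \<otimes> y) = y \<otimes> (e \<otimes> e) \<otimes> y" using e(1) y(1) by (simp add: m_assoc)
    then have 1: "(y \<otimes> e) \<otimes> (e \<otimes> y) = y" using e y by simp
    have y_eq: "y = (e \<otimes> y) \<otimes> (y \<otimes> e)" using 1 c by simp
    have "e \<otimes> ((e \<otimes> y) \<otimes> (y \<otimes> e)) = (e \<otimes> e) \<otimes> y \<otimes> (y \<otimes> e)" using e(1) y(1) by (simp add: m_assoc)
    then have "e \<otimes> y = y" using y_eq e(2) by simp
    moreover have "((e \<otimes> y) \<otimes> (y \<otimes> e)) \<otimes> e = (e \<otimes> y) \<otimes> (y \<otimes> (e \<otimes> e))"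
      using e(1) y(1) by (simp add: m_assoc)
    then have "y \<otimes> e = y" using y_eq e(2) by simp
    ultimately have "e = y" using y(2) by simp
    then show ?thesis using y(4) e(2) by simp
  qed
  have uniq: "y = z" if x: "x \<in> carrier S"
    and y: "y \<in> carrier S" "x \<otimes> y \<otimes> x = x" "y \<otimes> x \<otimes> y = y"
    and z: "z \<in> carrier S" "x \<otimes> z \<otimes> x = x" "z \<otimes> x \<otimes> z = z" for x y z
  proof -
    have F: "a \<otimes> b \<in> F" "b \<otimes> a \<in> F"
      if "a \<in> carrier S" "b \<in> carrier S" "a \<otimes> b \<otimes> a = a" for a b
    proof -
      have "(a \<otimes> b) \<otimes> (a \<otimes> b) = (a \<otimes> b \<otimes> a) \<otimes> b" "(b \<otimes> a) \<otimes> (b \<otimes> a) = b \<otimes> (a \<otimes> b \<otimes> a)"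
        using that(1,2) by (simp_all add: m_assoc)
      then show "a \<otimes> b \<in> F" "b \<otimes> a \<in> F" using idem_F that by simp_all
    qed
    note F1 = F[OF x y(1,2)] F[OF x z(1,2)]
    have "y \<otimes> x \<otimes> (z \<otimes> x) \<otimes> y = y \<otimes> (x \<otimes> z \<otimes> x) \<otimes> y" using x y(1) z(1) by (simp add: m_assoc)
    then have "y = (y \<otimes> x) \<otimes> (z \<otimes> x) \<otimes> y" using y z by simp
    also have "\<dots> = (z \<otimes> x) \<otimes> (y \<otimes> x) \<otimes> y" using comm[of "y \<otimes> x" "z \<otimes> x"] F1 by simp
    also have "\<dots> = z \<otimes> x \<otimes> (y \<otimes> x \<otimes> y)" using x y(1) z(1) by (simp add: m_assoc)
    also have "\<dots> = z \<otimes> x \<otimes> y" using y by simp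
    finally have 1: "y = z \<otimes> x \<otimes> y" .
    have "z \<otimes> ((x \<otimes> y) \<otimes> (x \<otimes> z)) = z \<otimes> (x \<otimes> y \<otimes> x) \<otimes> z" using x y(1) z(1) by (simp add: m_assoc)
    then have "z = z \<otimes> ((x \<otimes> y) \<otimes> (x \<otimes> z))" using y z by simp
    also have "\<dots> = z \<otimes> ((x \<otimes> z) \<otimes> (x \<otimes> y))" using comm[of "x \<otimes> y" "x \<otimes> z"] F1 by simp
    also have "\<dots> = (z \<otimes> x \<otimes> z) \<otimes> (x \<otimes> y)" using x y(1) z(1) by (simp add: m_assoc)
    also have "\<dots> = z \<otimes> x \<otimes> y" using z x y(1) by (simp add: m_assoc)
    finally show ?thesis using 1 by simp
  qed
  have "\<exists>!t. t \<in> carrier S \<and> s \<otimes> t \<otimes> s = s \<and> t \<otimes> s \<otimes> t = t" if s: "s \<in> carrier S" for s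
  proof -
    obtain t where "t \<in> carrier S" "s \<otimes> t \<otimes> s = s" "t \<otimes> s \<otimes> t = t" using ex[OF s] by blast
    then show ?thesis using uniq[OF s] by blast
  qed
  then show ?thesis unfolding inverse_monoid_def using \<open>monoid S\<close> by blast
qed

lemma inverse_monoid_Inv: "inverse_monoid (Inv X R)"
proof (rule inverse_monoidI)
  let ?F = "(\<lambda>w. inv_class X R (w @ inv_word w)) ` words X"
  show "?F \<subseteq> carrier (Inv X R)" by (auto simp: inv_class_carrier)
  show "e \<otimes>\<^bsub>Inv X R\<^esub> f = f \<otimes>\<^bsub>Inv X R\<^esub> e" if "e \<in> ?F" "f \<in> ?F" for e f
    using that by (auto simp: inv_class_mult inv_class_commute)
  fix x assume "x \<in> carrier (Inv X R)"
  then obtain w where w: "w \<in> words X" "x = inv_class X R w" by (auto simp: inv_class_carrier)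
  have "inv_class X R (inv_word w @ w) \<in> ?F"
    using w(1) by (intro image_eqI[of _ _ "inv_word w"]) auto
  then show "\<exists>y\<in>carrier (Inv X R). x \<otimes>\<^bsub>Inv X R\<^esub> y \<otimes>\<^bsub>Inv X R\<^esub> x = x \<and> y \<otimes>\<^bsub>Inv X R\<^esub> x \<otimes>\<^bsub>Inv X R\<^esub> y = y
      \<and> x \<otimes>\<^bsub>Inv X R\<^esub> y \<in> ?F \<and> y \<otimes>\<^bsub>Inv X R\<^esub> x \<in> ?F"
    using w inv_class_regular[of w X R] inv_class_regular[of "inv_word w" X R]
    by (intro bexI[of _ "inv_class X R (inv_word w)"]) (auto simp: inv_class_mult inv_class_carrier)
qed (rule monoid_Inv)

lemma im_inv_eqI:
  assumes "inverse_monoid S" "s \<in> carrier S" "t \<in> carrier S"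
    "s \<otimes>\<^bsub>S\<^esub> t \<otimes>\<^bsub>S\<^esub> s = s" "t \<otimes>\<^bsub>S\<^esub> s \<otimes>\<^bsub>S\<^esub> t = t"
  shows "im_inv S s = t"
  unfolding im_inv_def using assms unfolding inverse_monoid_def by (intro the1_equality) auto

lemma group_im_inv:
  assumes "group S"
  shows "inverse_monoid S" and "s \<in> carrier S \<Longrightarrow> im_inv S s = inv\<^bsub>S\<^esub> s"
proof -
  interpret group S by fact
  have "t = inv\<^bsub>S\<^esub> s" if "s \<in> carrier S" "t \<in> carrier S" "s \<otimes>\<^bsub>S\<^esub> t \<otimes>\<^bsub>S\<^esub> s = s" for s t
  proof -
    have "s \<otimes>\<^bsub>S\<^esub> t = \<one>\<^bsub>S\<^esub>"
      using that right_cancel[of s "s \<otimes>\<^bsub>S\<^esub> t" "\<one>\<^bsub>S\<^esub>"] by simp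
    then have "inv\<^bsub>S\<^esub> t = s" using that inv_equality by blast
    then show ?thesis using that by auto
  qed
  then have *: "\<exists>!t. t \<in> carrier S \<and> s \<otimes>\<^bsub>S\<^esub> t \<otimes>\<^bsub>S\<^esub> s = s \<and> t \<otimes>\<^bsub>S\<^esub> s \<otimes>\<^bsub>S\<^esub> t = t"
    if "s \<in> carrier S" for s
    using that by (intro ex1I[of _ "inv\<^bsub>S\<^esub> s"]) auto
  then show im: "inverse_monoid S"
    unfolding inverse_monoid_def using monoid_axioms by blast
  show "im_inv S s = inv\<^bsub>S\<^esub> s" if "s \<in> carrier S"
    by (rule im_inv_eqI[OF im that]) (use that in auto)
qed

lemma im_inv_inv_class:
  "w \<in> words X \<Longrightarrow> im_inv (Inv X R) (inv_class X R w) = inv_class X R (inv_word w)"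
  using inv_class_regular[of w X R] inv_class_regular[of "inv_word w" X R]
  by (intro im_inv_eqI[OF inverse_monoid_Inv]) (auto simp: inv_class_mult inv_class_carrier)

lemma im_inv_gp_class:
  assumes "w \<in> words X"
  shows "im_inv (Gp X R) (gp_class X R w) = gp_class X R (inv_word w)"
proof -
  have "gp_class X R (w @ inv_word w) = \<one>\<^bsub>Gp X R\<^esub>"
    using gp_cancel[OF assms, of R] assms by (simp add: gp_class_one gp_class_eq)
  moreover have "gp_class X R (inv_word w @ w) = \<one>\<^bsub>Gp X R\<^esub>"
    using gp_cancel[of "inv_word w" X R] assms by (simp add: gp_class_one gp_class_eq)
  ultimately have "inv\<^bsub>Gp X R\<^esub> (gp_class X R w) = gp_class X R (inv_word w)"
    using assms
    by (intro group.inv_equality[OF group_Gp]) (auto simp: gp_class_mult gp_class_carrier)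
  then show ?thesis
    using group_im_inv(2)[OF group_Gp, of "gp_class X R w" X R] assms
    by (simp add: gp_class_carrier)
qed

lemma word_value_inv_class:
  "w \<in> words X \<Longrightarrow> word_value (Inv X R) (\<lambda>x. inv_class X R [(x, True)]) w = inv_class X R w"
proof (induction w)
  case (Cons a w)
  obtain x b where a: "a = (x, b)" by (cases a)
  have x: "x \<in> X" and w: "w \<in> words X" using Cons.prems a by auto
  have "im_inv (Inv X R) (inv_class X R [(x, True)]) = inv_class X R [(x, False)]"
    using im_inv_inv_class[of "[(x, True)]" X R] x by (simp add: inv_word_def)
  then have "(if b then inv_class X R [(x, True)] else im_inv (Inv X R) (inv_class X R [(x, True)]))
      = inv_class X R [a]"
    by (simp add: a)
  then show ?case
    using inv_class_mult[of "[a]" X w R] x w Cons.IH a by simp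
qed (simp add: inv_class_one)

lemma word_value_gp_class:
  "w \<in> words X \<Longrightarrow> word_value (Gp X R) (\<lambda>x. gp_class X R [(x, True)]) w = gp_class X R w"
proof (induction w)
  case (Cons a w)
  obtain x b where a: "a = (x, b)" by (cases a)
  have x: "x \<in> X" and w: "w \<in> words X" using Cons.prems a by auto
  have "im_inv (Gp X R) (gp_class X R [(x, True)]) = gp_class X R [(x, False)]"
    using im_inv_gp_class[of "[(x, True)]" X R] x by (simp add: inv_word_def)
  then have "(if b then gp_class X R [(x, True)] else im_inv (Gp X R) (gp_class X R [(x, True)]))
      = gp_class X R [a]"
    by (simp add: a)
  then show ?case
    using gp_class_mult[of "[a]" X w R] x w Cons.IH a by simp
qed (simp add: gp_class_one)

lemma finite_generating_family_X:
  assumes "finite X"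
  shows "finite_generating_family (Inv X R) X (\<lambda>x. inv_class X R [(x, True)])"
    and "finite_generating_family (Gp X R) X (\<lambda>x. gp_class X R [(x, True)])"
  using assms word_value_inv_class[of _ X R] word_value_gp_class[of _ X R]
  by (auto simp: finite_generating_family_def inv_class_carrier gp_class_carrier image_iff)

lemma word_value_units:
  assumes u: "\<And>j. j \<in> J \<Longrightarrow> u j \<in> words X" "\<And>j. j \<in> J \<Longrightarrow> represents_unit X R (u j)"
    and w: "w \<in> words J"
  shows "word_value (units_of (Inv X R)) (\<lambda>j. inv_class X R (u j)) w
           = inv_class X R (subst_word u w)"
proof -
  interpret monoid "Inv X R" by (rule monoid_Inv)
  have g: "group (units_of (Inv X R))" by (rule units_group)
  have i: "im_inv (units_of (Inv X R)) (inv_class X R (u j)) = inv_class X R (inv_word (u j))"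
    if "j \<in> J" for j
  proof -
    have U: "inv_class X R (u j) \<in> Units (Inv X R)"
      using u(2)[OF that] by (simp add: represents_unit_def)
    have "im_inv (units_of (Inv X R)) (inv_class X R (u j))
            = inv\<^bsub>Inv X R\<^esub> (inv_class X R (u j))"
      using group_im_inv(2)[OF g] U by (simp add: units_of_carrier units_of_inv)
    also have "\<dots> = im_inv (Inv X R) (inv_class X R (u j))"
      using U by (intro im_inv_eqI[OF inverse_monoid_Inv, symmetric]) auto
    finally show ?thesis using im_inv_inv_class u(1)[OF that] by metis
  qed
  have "subst_word u w \<in> words X \<and> word_value (units_of (Inv X R)) (\<lambda>j. inv_class X R (u j)) w
           = inv_class X R (subst_word u w)"
    using w
  proof (induction w)
    case Nil
    then show ?case by (simp add: units_of_one inv_class_one subst_word_def)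
  next
    case (Cons a w)
    then show ?case
      using u(1) i by (cases a) (auto simp: units_of_mult inv_class_mult subst_word_def)
  qed
  then show ?thesis by blast
qed

lemma inv_congr_subset_gp_congr: "inv_congr X R \<subseteq> gp_congr X R"
proof -
  have c: "(w @ inv_word w, []) \<in> gp_congr X R" if "w \<in> words X" for w
    using gp_cancel[OF that] .
  have app: "(v @ w, v' @ w') \<in> gp_congr X R"
    if "(v, v') \<in> gp_congr X R" "(w, w') \<in> gp_congr X R" for v v' w w'
    using congr_append that unfolding gp_congr_def by blast
  have vag: "(v, w) \<in> gp_congr X R" if "(v, w) \<in> vagner_rels X" for v w
    using that unfolding vagner_rels_def
  proof (elim UnE CollectE exE conjE)
    fix z assume z: "(v, w) = (z @ inv_word z @ z, z)" "z \<in> words X"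
    then show ?thesis using app[OF c[OF z(2)], of z z] by (auto simp: gp_congr_def congr.refl)
  next
    fix y z assume yz: "(v, w) = (y @ inv_word y @ z @ inv_word z, z @ inv_word z @ y @ inv_word y)"
      "y \<in> words X" "z \<in> words X"
    then have "(v, []) \<in> gp_congr X R" "(w, []) \<in> gp_congr X R"
      using app[OF c[OF yz(2)] c[OF yz(3)]] app[OF c[OF yz(3)] c[OF yz(2)]] by auto
    then show ?thesis unfolding gp_congr_def by (blast intro: congr.sym congr.trans)
  qed
  have rel: "(v, w) \<in> gp_congr X R"
    if "(v, w) \<in> vagner_rels X \<union> R" "v \<in> words X" "w \<in> words X" for v w
    using that vag congr_rel[of v w "free_group_rels X \<union> R" X] by (auto simp: gp_congr_def)
  have "(v, w) \<in> gp_congr X R" if "(v, w) \<in> congr X (vagner_rels X \<union> R)" for v w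
    using that
  proof (induction rule: congr.induct)
    case (step v w p q)
    then show ?case using rel[of v w] congr_context unfolding gp_congr_def by blast
  qed (auto simp: gp_congr_def intro: congr.intros)
  then show ?thesis by (auto simp: inv_congr_def)
qed

lemma max_group_map_class:
  assumes "w \<in> words X"
  shows "max_group_map X R (inv_class X R w) = gp_class X R w"
proof -
  have "(w, w) \<in> inv_congr X R" using assms by (simp add: inv_congr_def congr.refl)
  then show ?thesis
    using inv_congr_subset_gp_congr[of X R]
    unfolding max_group_map_def inv_class_def gp_class_def gp_congr_def
    by (auto intro: congr.trans)
qed

end

theory Submission
  imports Defs
begin

text \<open>
  Let \<open>P\<close> be the submonoid of \<open>G\<close> generated by the prefixes of the pieces and of their inverses.
  \<open>M\<close> acts by partial injections on the subgraph of the Cayley graph of \<open>G\<close> with vertices \<open>q P\<close>,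
  \<open>q\<close> a prefix of a word \<open>v\<close>, whose edges are those of the path \<open>v\<close> and of the paths labelled by
  pieces that start at points of \<open>q P\<close>. Since \<open>M\<close> is E-unitary, it follows that \<open>v = w\<close> in \<open>M\<close> iff
  \<open>v = w\<close> in \<open>G\<close> and each of the two words can be read from \<open>1\<close> in the graph of the other. For
  empty \<open>v\<close> the same action shows that right units are products of prefixes of pieces, and
  minimality then leaves only whole pieces as factors of units. Hence \<open>U\<close> is isomorphic to the
  subgroup \<open>H\<close> of \<open>G\<close> generated by the pieces, and its word problem reduces to those of \<open>G\<close> and \<open>M\<close>.

  Conversely, write \<open>u\<^sub>j = a\<^sub>j x\<^sub>j b\<^sub>j\<close> with the marker \<open>x\<^sub>j\<close>. Replacing the generators \<open>x\<^sub>j\<close> by \<open>u\<^sub>j\<close>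
  shows that \<open>G\<close> is the free product of \<open>H\<close> and the free group on the unmarked letters, so normal
  forms are computable once the word problem of \<open>H\<close> is decidable. An element lies in \<open>P\<close> iff the
  free syllables of its normal form are products of prefixes of words \<open>a\<^sub>j\<close> and \<open>b\<^sub>j\<inverse>\<close>, which a finite
  automaton recognises by Benois' theorem. This decides equality in \<open>G\<close> and the edges of the graphs
  above, hence equality in \<open>M\<close>.
\<close>

section \<open>Unary recursive functions\<close>

lemma recursive_fun_comp1:
  assumes "recursive_fun 1 f" "recursive_fun n g"
  shows "recursive_fun n (\<lambda>xs. f [g xs])"
  using rec_comp[OF assms(1), of "[g]" n] assms(2) by simp

lemma recursive_fun_comp2:
  assumes "recursive_fun 2 f" "recursive_fun n g" "recursive_fun n h"
  shows "recursive_fun n (\<lambda>xs. f [g xs, h xs])"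
  using rec_comp[OF assms(1), of "[g, h]" n] assms(2,3) by simp

lemma recursive_fun_eqI:
  "recursive_fun n f \<Longrightarrow> (\<And>xs. length xs = n \<Longrightarrow> f xs = g xs) \<Longrightarrow> recursive_fun n g"
  by (rule rec_ext) auto

lemma recursive_fun_2_swap:
  assumes "recursive_fun 2 f"
  shows "recursive_fun 2 (\<lambda>xs. f [xs ! 1, xs ! 0])"
  using recursive_fun_comp2[OF assms] rec_proj by simp

lemma recursive_fun_add: "recursive_fun 2 (\<lambda>xs. xs ! 0 + xs ! 1)"
proof -
  have *: "recursive_fun (Suc 1) (\<lambda>xs. rec_nat ((\<lambda>ys. ys ! 0) (tl xs))
          (\<lambda>y v. (\<lambda>ys. Suc ([ys ! 1] ! 0)) (y # v # tl xs)) (hd xs))"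
    by (intro rec_prim recursive_fun_comp1[OF rec_suc] rec_proj) auto
  have **: "rec_nat a (\<lambda>y v. Suc v) b = b + a" for a b :: nat
    by (induction b) auto
  show ?thesis
    unfolding numeral_2_eq_2 One_nat_def
    by (rule recursive_fun_eqI[OF *[unfolded One_nat_def]])
       (auto simp: length_Suc_conv **[unfolded One_nat_def])
qed

lemma recursive_fun_pred: "recursive_fun 1 (\<lambda>xs. xs ! 0 - 1)"
proof -
  have *: "recursive_fun (Suc 0) (\<lambda>xs. rec_nat ((\<lambda>ys. 0) (tl xs))
          (\<lambda>y v. (\<lambda>ys. ys ! 0) (y # v # tl xs)) (hd xs))"
    by (intro rec_prim rec_zero rec_proj) auto
  have **: "rec_nat 0 (\<lambda>y v. y) b = b - 1" for b :: nat
    by (cases b) auto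
  show ?thesis
    unfolding numeral_2_eq_2 One_nat_def
    by (rule recursive_fun_eqI[OF *[unfolded One_nat_def]])
       (auto simp: length_Suc_conv **[unfolded One_nat_def])
qed

lemma recursive_fun_diff: "recursive_fun 2 (\<lambda>xs. xs ! 0 - xs ! 1)"
proof -
  have *: "recursive_fun (Suc 1) (\<lambda>xs. rec_nat ((\<lambda>ys. ys ! 0) (tl xs))
          (\<lambda>y v. (\<lambda>ys. [ys ! 1] ! 0 - 1) (y # v # tl xs)) (hd xs))"
    by (intro rec_prim recursive_fun_comp1[OF recursive_fun_pred] rec_proj) auto
  have **: "rec_nat a (\<lambda>y v. v - 1) b = a - b" for a b :: nat
    by (induction b) auto
  \<comment> \<open>\<open>rec_prim\<close> recurses on the first argument, which here has to be the
    subtrahend, so the arguments come out exchanged at first.\<close>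
  have "recursive_fun 2 (\<lambda>xs. xs ! 1 - xs ! 0)"
    unfolding numeral_2_eq_2
    by (rule recursive_fun_eqI[OF *[unfolded One_nat_def]]) (auto simp: length_Suc_conv **[unfolded One_nat_def])
  from recursive_fun_2_swap[OF this] show ?thesis by simp
qed

lemma recursive_fun_triangle: "recursive_fun 1 (\<lambda>xs. triangle (xs ! 0))"
proof -
  have *: "recursive_fun (Suc 0) (\<lambda>xs. rec_nat ((\<lambda>ys. 0) (tl xs))
          (\<lambda>y v. (\<lambda>ys. [ys ! 1, Suc ([ys ! 0] ! 0)] ! 0 + [ys ! 1, Suc ([ys ! 0] ! 0)] ! 1)
             (y # v # tl xs)) (hd xs))"
    by (intro rec_prim rec_zero recursive_fun_comp2[OF recursive_fun_add]
          recursive_fun_comp1[OF rec_suc] rec_proj) auto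
  have **: "rec_nat 0 (\<lambda>y v. Suc (v + y)) b = triangle b" for b :: nat
    by (induction b) auto
  show ?thesis
    unfolding numeral_2_eq_2 One_nat_def
    by (rule recursive_fun_eqI[OF *[unfolded One_nat_def]])
       (auto simp: length_Suc_conv **[unfolded One_nat_def])
qed

text \<open>Further arguments are packed with \<open>prod_encode\<close>, so that the later closure
  properties can be stated for functions of a single number.\<close>

definition recursive1 :: "(nat \<Rightarrow> nat) \<Rightarrow> bool" where
  "recursive1 f \<longleftrightarrow> recursive_fun 1 (\<lambda>xs. f (xs ! 0))"

lemma recursive1_id: "recursive1 (\<lambda>n. n)"
  unfolding recursive1_def by (rule rec_proj) simp

lemma recursive1_comp: "recursive1 f \<Longrightarrow> recursive1 g \<Longrightarrow> recursive1 (\<lambda>n. f (g n))"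
  unfolding recursive1_def using recursive_fun_comp1[of "\<lambda>xs. f (xs ! 0)" 1] by simp

lemma recursive1_comp2:
  "recursive_fun 2 f \<Longrightarrow> recursive1 g \<Longrightarrow> recursive1 h \<Longrightarrow> recursive1 (\<lambda>n. f [g n, h n])"
  unfolding recursive1_def by (rule recursive_fun_comp2)

lemma recursive1_Suc: "recursive1 Suc"
  unfolding recursive1_def by (rule rec_suc)

lemma recursive1_const: "recursive1 (\<lambda>_. m)"
proof (induction m)
  case 0
  show ?case unfolding recursive1_def by (rule rec_zero)
next
  case (Suc m)
  then show ?case using recursive1_comp[OF recursive1_Suc] by simp
qed

lemma recursive1_pred: "recursive1 f \<Longrightarrow> recursive1 (\<lambda>n. f n - 1)"
  using recursive1_comp[of "\<lambda>n. n - 1" f] recursive_fun_pred by (simp add: recursive1_def)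

lemma recursive1_diff: "recursive1 f \<Longrightarrow> recursive1 g \<Longrightarrow> recursive1 (\<lambda>n. f n - g n)"
  using recursive1_comp2[OF recursive_fun_diff] by simp

lemma recursive1_triangle: "recursive1 f \<Longrightarrow> recursive1 (\<lambda>n. triangle (f n))"
  using recursive1_comp[of triangle f] recursive_fun_triangle by (simp add: recursive1_def)

lemma recursive_fun_prod_encode: "recursive_fun 2 (\<lambda>xs. prod_encode (xs ! 0, xs ! 1))"
proof -
  have "recursive_fun 2 (\<lambda>xs. triangle ([xs ! 0 + xs ! 1] ! 0))"
    by (rule recursive_fun_comp1[OF recursive_fun_triangle recursive_fun_add])
  from recursive_fun_comp2[OF recursive_fun_add this rec_proj[of 0 2]]
  show ?thesis by (simp add: prod_encode_def)
qed

lemma recursive1_prod_encode: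
  "recursive1 f \<Longrightarrow> recursive1 g \<Longrightarrow> recursive1 (\<lambda>n. prod_encode (f n, g n))"
  using recursive1_comp2[OF recursive_fun_prod_encode] by simp

text \<open>The antidiagonal on which the pair coded by \<open>n\<close> lies.\<close>

definition diagonal :: "nat \<Rightarrow> nat" where
  "diagonal n = (LEAST y. Suc n - triangle (Suc y) = 0)"

lemma triangle_mono: "m \<le> n \<Longrightarrow> triangle m \<le> triangle n"
  by (induction n) (auto simp: le_Suc_eq)

text \<open>The codes of the pairs with sum \<open>s\<close> fill the interval from
  \<open>triangle s\<close> up to, but not including, \<open>triangle (Suc s)\<close>.\<close>

lemma diagonal_prod_encode: "diagonal (prod_encode (a, b)) = a + b"
proof -
  have "a + b \<le> y" if "prod_encode (a, b) < triangle (Suc y)" for y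
  proof (rule ccontr)
    assume "\<not> a + b \<le> y"
    then have "triangle (Suc y) \<le> triangle (a + b)" by (intro triangle_mono) simp
    then show False using that by (simp add: prod_encode_def)
  qed
  then show ?thesis unfolding diagonal_def
    by (intro Least_equality) (auto simp: prod_encode_def)
qed

lemma recursive1_diagonal: "recursive1 diagonal"
proof -
  have 1: "recursive_fun 2 (\<lambda>xs. Suc ([xs ! 1] ! 0))"
    by (rule recursive_fun_comp1[OF rec_suc rec_proj]) simp
  have "recursive_fun 2 (\<lambda>xs. Suc ([xs ! 0] ! 0))"
    by (rule recursive_fun_comp1[OF rec_suc rec_proj]) simp
  from recursive_fun_comp1[OF recursive_fun_triangle this]
  have "recursive_fun 2 (\<lambda>xs. triangle (Suc (xs ! 0)))" by (simp del: triangle_Suc)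
  from recursive_fun_comp2[OF recursive_fun_diff 1 this]
  have *: "recursive_fun (Suc 1) (\<lambda>xs. Suc (xs ! 1) - triangle (Suc (xs ! 0)))"
    by (simp add: numeral_2_eq_2 del: triangle_Suc)
  \<comment> \<open>The minimisation is regular: \<open>y = n\<close> is always a zero, because
    \<open>triangle (Suc n)\<close> is at least \<open>Suc n\<close>.\<close>
  have "\<exists>y. Suc n - triangle (Suc y) = 0" for n
    by (rule exI[of _ n]) simp
  with rec_mu[OF *] show ?thesis unfolding recursive1_def diagonal_def by auto
qed

lemma recursive1_fst: "recursive1 f \<Longrightarrow> recursive1 (\<lambda>n. fst (prod_decode (f n)))"
  and recursive1_snd: "recursive1 f \<Longrightarrow> recursive1 (\<lambda>n. snd (prod_decode (f n)))"
proof -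
  \<comment> \<open>The code of \<open>(a, b)\<close> is \<open>triangle (a + b) + a\<close>, so
    both components can be recovered from the diagonal.\<close>
  have "fst (prod_decode n) = n - triangle (diagonal n)"
    "snd (prod_decode n) = diagonal n - (n - triangle (diagonal n))" for n
    using diagonal_prod_encode[of "fst (prod_decode n)" "snd (prod_decode n)"]
      prod_decode_inverse[of n] by (auto simp: prod_encode_def split_beta)
  then show "recursive1 f \<Longrightarrow> recursive1 (\<lambda>n. fst (prod_decode (f n)))"
    and "recursive1 f \<Longrightarrow> recursive1 (\<lambda>n. snd (prod_decode (f n)))"
    by (auto intro!: recursive1_diff recursive1_triangle recursive1_comp[OF recursive1_diagonal])
qed

text \<open>A primitive recursion that discards its accumulator is a case distinction on the
  recursion argument. The parameter sits at index 2, behind the counter and the accumulator.\<close>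

lemma recursive1_if_zero:
  assumes "recursive1 f" "recursive1 g" "recursive1 h"
  shows "recursive1 (\<lambda>n. if f n = 0 then g n else h n)"
proof -
  let ?F = "\<lambda>xs. rec_nat ((\<lambda>ys. g (ys ! 0)) (tl xs))
          (\<lambda>y v. (\<lambda>ys. h ([ys ! 2] ! 0)) (y # v # tl xs)) (hd xs)"
  have "recursive_fun (Suc 1) ?F"
    using assms(2,3) recursive_fun_comp1[of "\<lambda>xs. h (xs ! 0)" "Suc (Suc 1)" "\<lambda>xs. xs ! 2"]
    unfolding recursive1_def by (intro rec_prim) (auto simp: rec_proj)
  then have "recursive1 (\<lambda>n. ?F [f n, n])"
    using assms(1) recursive1_id by (intro recursive1_comp2) (auto simp: numeral_2_eq_2)
  moreover have "?F [f n, n] = (if f n = 0 then g n else h n)" for n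
    by (cases "f n") auto
  ultimately show ?thesis by simp
qed

lemma recursive1_funpow:
  assumes "recursive1 s" "recursive1 f" "recursive1 g"
  shows "recursive1 (\<lambda>n. (s ^^ f n) (g n))"
proof -
  let ?F = "\<lambda>xs. rec_nat ((\<lambda>ys. ys ! 0) (tl xs))
          (\<lambda>y v. (\<lambda>ys. s ([ys ! 1] ! 0)) (y # v # tl xs)) (hd xs)"
  have "recursive_fun (Suc 1) ?F"
    using assms(1) recursive_fun_comp1[of "\<lambda>xs. s (xs ! 0)" "Suc (Suc 1)" "\<lambda>xs. xs ! 1"]
    unfolding recursive1_def by (intro rec_prim) (auto simp: rec_proj)
  then have "recursive1 (\<lambda>n. ?F [f n, g n])"
    using assms(2,3) by (intro recursive1_comp2) (auto simp: numeral_2_eq_2)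
  moreover have "rec_nat a (\<lambda>y. s) k = (s ^^ k) a" for a k
    by (induction k) auto
  ultimately show ?thesis by simp
qed

text \<open>A finite table is recursive whether or not its entries can be found effectively. Finite
  data such as the transitions of the saturated automaton enter the algorithms in this way.\<close>

lemma recursive1_finite:
  "\<exists>g. recursive1 g \<and> (\<forall>n<m. g n = f n)"
proof (induction m arbitrary: f)
  case 0
  show ?case using recursive1_id by auto
next
  case (Suc m)
  obtain g where g: "recursive1 g" "\<forall>n<m. g n = f (Suc n)"
    using Suc[of "\<lambda>n. f (Suc n)"] by auto
  let ?g = "\<lambda>n. if n = 0 then f 0 else g (n - 1)"
  have "recursive1 ?g"
    by (intro recursive1_if_zero recursive1_id recursive1_const
        recursive1_comp[OF g(1)] recursive1_pred)
  moreover have "?g n = f n" if "n < Suc m" for n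
    using g(2) that by (cases n) auto
  ultimately show ?case by blast
qed


section \<open>Represented sets\<close>

text \<open>\<open>A n x\<close> says that the number \<open>n\<close> represents \<open>x\<close>. An element may have many representations
  and equality of elements need not be decidable, as for the elements of a group.\<close>

type_synonym 'a rep = "nat \<Rightarrow> 'a \<Rightarrow> bool"

definition computable :: "'a rep \<Rightarrow> 'b rep \<Rightarrow> ('a \<Rightarrow> 'b) \<Rightarrow> bool" where
  "computable A B f \<longleftrightarrow> (\<exists>g. recursive1 g \<and> (\<forall>n x. A n x \<longrightarrow> B (g n) (f x)))"

definition pair_rep :: "'a rep \<Rightarrow> 'b rep \<Rightarrow> ('a \<times> 'b) rep" where
  "pair_rep A B n p \<longleftrightarrow> A (fst (prod_decode n)) (fst p) \<and> B (snd (prod_decode n)) (snd p)"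

definition list_rep :: "'a rep \<Rightarrow> 'a list rep" where
  "list_rep A n xs \<longleftrightarrow> list_all2 A (list_decode n) xs"

definition sum_rep :: "'a rep \<Rightarrow> 'b rep \<Rightarrow> ('a + 'b) rep" where
  "sum_rep A B n s \<longleftrightarrow> (case s of
     Inl x \<Rightarrow> fst (prod_decode n) = 0 \<and> A (snd (prod_decode n)) x
   | Inr y \<Rightarrow> fst (prod_decode n) \<noteq> 0 \<and> B (snd (prod_decode n)) y)"

definition bool_rep :: "bool rep" where
  "bool_rep n b \<longleftrightarrow> n = of_bool b"

definition finite_rep :: "'a rep \<Rightarrow> bool" where
  "finite_rep A \<longleftrightarrow> finite {n. \<exists>x. A n x} \<and> (\<forall>n x y. A n x \<longrightarrow> A n y \<longrightarrow> x = y)"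

section \<open>Closure properties of computable functions\<close>

lemma computable_cong:
  "computable A B f \<Longrightarrow> (\<And>n x. A n x \<Longrightarrow> f x = g x) \<Longrightarrow> computable A B g"
  unfolding computable_def by metis

lemma computable_id: "computable A A (\<lambda>x. x)"
  unfolding computable_def using recursive1_id by blast

lemma computable_comp:
  assumes "computable B C g" "computable A B f"
  shows "computable A C (\<lambda>x. g (f x))"
  using assms recursive1_comp unfolding computable_def by metis

lemma computable_const: "B m b \<Longrightarrow> computable A B (\<lambda>_. b)"
  unfolding computable_def using recursive1_const by blast

lemma computable_pair:
  assumes "computable A B f" "computable A C g"
  shows "computable A (pair_rep B C) (\<lambda>x. (f x, g x))"
proof -
  obtain f' g' where "recursive1 f'" "\<And>n x. A n x \<Longrightarrow> B (f' n) (f x)"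
    "recursive1 g'" "\<And>n x. A n x \<Longrightarrow> C (g' n) (g x)"
    using assms unfolding computable_def by blast
  then show ?thesis
    unfolding computable_def pair_rep_def
    by (intro exI[of _ "\<lambda>n. prod_encode (f' n, g' n)"]) (auto intro: recursive1_prod_encode)
qed

lemma computable_comp_pair:
  assumes "computable (pair_rep B C) D (\<lambda>p. h (fst p) (snd p))"
    "computable A B f" "computable A C g"
  shows "computable A D (\<lambda>x. h (f x) (g x))"
  using computable_comp[OF assms(1) computable_pair[OF assms(2,3)]] by simp

lemma computable_fst: "computable A (pair_rep B C) f \<Longrightarrow> computable A B (\<lambda>x. fst (f x))"
  and computable_snd: "computable A (pair_rep B C) f \<Longrightarrow> computable A C (\<lambda>x. snd (f x))"
  unfolding computable_def pair_rep_def using recursive1_fst recursive1_snd by metis+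

lemma computable_Inr:
  assumes "computable A C g"
  shows "computable A (sum_rep B C) (\<lambda>x. Inr (g x))"
proof -
  obtain h where "recursive1 h" "\<And>n x. A n x \<Longrightarrow> C (h n) (g x)"
    using assms unfolding computable_def by blast
  then show ?thesis
    unfolding computable_def
    by (intro exI[of _ "\<lambda>n. prod_encode (1, h n)"])
       (simp add: recursive1_prod_encode recursive1_const sum_rep_def)
qed

lemma computable_if:
  assumes "computable A bool_rep b" "computable A B f" "computable A B g"
  shows "computable A B (\<lambda>x. if b x then f x else g x)"
proof -
  obtain b' f' g' where
    b': "recursive1 b'" "\<And>n x. A n x \<Longrightarrow> b' n = of_bool (b x)" and
    f': "recursive1 f'" "\<And>n x. A n x \<Longrightarrow> B (f' n) (f x)" and
    g': "recursive1 g'" "\<And>n x. A n x \<Longrightarrow> B (g' n) (g x)"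
    using assms unfolding computable_def bool_rep_def by blast
  then show ?thesis
    unfolding computable_def
    by (intro exI[of _ "\<lambda>n. if b' n = 0 then g' n else f' n"])
       (auto intro: recursive1_if_zero)
qed

lemma computable_case_sum:
  assumes "computable A (sum_rep B C) s"
    "computable (pair_rep A B) D f" "computable (pair_rep A C) D g"
  shows "computable A D (\<lambda>x. case s x of Inl y \<Rightarrow> f (x, y) | Inr z \<Rightarrow> g (x, z))"
proof -
  obtain s' f' g' where
    s': "recursive1 s'" "\<And>n x. A n x \<Longrightarrow> sum_rep B C (s' n) (s x)" and
    f': "recursive1 f'" "\<And>n x. pair_rep A B n x \<Longrightarrow> D (f' n) (f x)" and
    g': "recursive1 g'" "\<And>n x. pair_rep A C n x \<Longrightarrow> D (g' n) (g x)"
    using assms unfolding computable_def by blast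
  let ?p = "\<lambda>n. prod_encode (n, snd (prod_decode (s' n)))"
  have p: "recursive1 ?p"
    by (intro recursive1_prod_encode recursive1_id recursive1_snd s')
  have "recursive1 (\<lambda>n. if fst (prod_decode (s' n)) = 0 then f' (?p n) else g' (?p n))"
    by (intro recursive1_if_zero recursive1_fst s' recursive1_comp[OF f'(1) p]
          recursive1_comp[OF g'(1) p])
  moreover have "D (if fst (prod_decode (s' n)) = 0 then f' (?p n) else g' (?p n))
      (case s x of Inl y \<Rightarrow> f (x, y) | Inr z \<Rightarrow> g (x, z))" if "A n x" for n x
    using s'(2)[OF that] that f'(2)[of "?p n"] g'(2)[of "?p n"]
    by (cases "s x") (auto simp: sum_rep_def pair_rep_def)
  ultimately show ?thesis unfolding computable_def by blast
qed

text \<open>Each code stands for at most one element, so a value for \<open>f\<close> can be chosen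
  per code; finitely many choices form a recursive table.\<close>

lemma computable_finite:
  assumes "finite_rep A" "\<And>n x. A n x \<Longrightarrow> \<exists>m. B m (f x)"
  shows "computable A B f"
proof -
  obtain m where m: "\<And>n x. A n x \<Longrightarrow> n < m"
    using assms(1) finite_nat_set_iff_bounded[of "{n. \<exists>x. A n x}"] unfolding finite_rep_def
    by blast
  have "\<exists>k. \<forall>x. A n x \<longrightarrow> B k (f x)" for n
    using assms unfolding finite_rep_def by metis
  then obtain h where h: "\<And>n x. A n x \<Longrightarrow> B (h n) (f x)" by metis
  obtain g where "recursive1 g" "\<And>n. n < m \<Longrightarrow> g n = h n"
    using recursive1_finite[of m h] by blast
  then show ?thesis using h m unfolding computable_def by metis
qed

lemma finite_rep_bool: "finite_rep bool_rep"
  unfolding finite_rep_def bool_rep_def by (auto intro: finite_subset[of _ "{..1}"])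

lemma finite_rep_pair:
  assumes "finite_rep A" "finite_rep B"
  shows "finite_rep (pair_rep A B)"
proof -
  have "{n. \<exists>x. pair_rep A B n x} \<subseteq> prod_encode ` ({n. \<exists>x. A n x} \<times> {n. \<exists>y. B n y})"
  proof safe
    fix n p assume "pair_rep A B n p"
    then show "n \<in> prod_encode ` ({n. \<exists>x. A n x} \<times> {n. \<exists>y. B n y})"
      by (intro image_eqI[of _ _ "prod_decode n"]) (auto simp: pair_rep_def mem_Times_iff)
  qed
  moreover have "finite (prod_encode ` ({n. \<exists>x. A n x} \<times> {n. \<exists>y. B n y}))"
    using assms unfolding finite_rep_def by blast
  moreover have "p = q" if "pair_rep A B n p" "pair_rep A B n q" for n p q
    using assms that unfolding finite_rep_def pair_rep_def prod_eq_iff by blast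
  ultimately show ?thesis
    unfolding finite_rep_def by (blast intro: finite_subset)
qed

lemma computable_bool_finite: "finite_rep A \<Longrightarrow> computable A bool_rep P"
  by (rule computable_finite) (auto simp: bool_rep_def)

lemma computable_Not:
  "computable A bool_rep b \<Longrightarrow> computable A bool_rep (\<lambda>x. \<not> b x)"
  by (rule computable_comp[of bool_rep _ Not])
     (auto intro!: computable_finite finite_rep_bool simp: bool_rep_def)

lemma computable_conj:
  assumes "computable A bool_rep b" "computable A bool_rep c"
  shows "computable A bool_rep (\<lambda>x. b x \<and> c x)"
  using computable_if[OF assms(1,2) computable_const[of bool_rep 0 False]]
  by (rule computable_cong) (auto simp: bool_rep_def)

lemma computable_disj:
  assumes "computable A bool_rep b" "computable A bool_rep c"
  shows "computable A bool_rep (\<lambda>x. b x \<or> c x)"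
  using computable_if[OF assms(1) computable_const[of bool_rep 1 True] assms(2)]
  by (rule computable_cong) (auto simp: bool_rep_def)

section \<open>Lists and bounded quantifiers\<close>

lemma computable_Nil: "computable A (list_rep B) (\<lambda>_. [])"
  by (rule computable_const[of _ 0]) (simp add: list_rep_def)

lemma list_decode_pos:
  "0 < n \<Longrightarrow> list_decode n = fst (prod_decode (n - 1)) # list_decode (snd (prod_decode (n - 1)))"
  by (cases n) (auto split: prod.split)

lemma computable_Cons:
  assumes "computable A B f" "computable A (list_rep B) g"
  shows "computable A (list_rep B) (\<lambda>x. f x # g x)"
proof -
  obtain f' g' where "recursive1 f'" "\<And>n x. A n x \<Longrightarrow> B (f' n) (f x)"
    "recursive1 g'" "\<And>n x. A n x \<Longrightarrow> list_rep B (g' n) (g x)"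
    using assms unfolding computable_def by blast
  then show ?thesis
    unfolding computable_def list_rep_def
    by (intro exI[of _ "\<lambda>n. Suc (prod_encode (f' n, g' n))"])
       (auto intro: recursive1_prod_encode recursive1_comp[OF recursive1_Suc])
qed

lemma computable_case_list:
  assumes "computable A (list_rep B) l" "computable A C f"
    "computable (pair_rep A (pair_rep B (list_rep B))) C g"
  shows "computable A C (\<lambda>x. case l x of [] \<Rightarrow> f x | y # ys \<Rightarrow> g (x, y, ys))"
proof -
  obtain l' f' g' where
    l': "recursive1 l'" "\<And>n x. A n x \<Longrightarrow> list_rep B (l' n) (l x)" and
    f': "recursive1 f'" "\<And>n x. A n x \<Longrightarrow> C (f' n) (f x)" and
    g': "recursive1 g'" "\<And>n x. pair_rep A (pair_rep B (list_rep B)) n x \<Longrightarrow> C (g' n) (g x)"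
    using assms unfolding computable_def by blast
  \<comment> \<open>The code of a nonempty list is the successor of the pair code of its head and
    tail; subtracting 1 leaves that pair.\<close>
  let ?p = "\<lambda>n. prod_encode (n, l' n - 1)"
  have p: "recursive1 ?p"
    by (intro recursive1_prod_encode recursive1_id recursive1_pred l')
  have "recursive1 (\<lambda>n. if l' n = 0 then f' n else g' (?p n))"
    by (intro recursive1_if_zero l' f' recursive1_comp[OF g'(1) p])
  moreover have "C (if l' n = 0 then f' n else g' (?p n))
      (case l x of [] \<Rightarrow> f x | y # ys \<Rightarrow> g (x, y, ys))" if "A n x" for n x
    using l'(2)[OF that] that f'(2)[OF that] g'(2)[of "?p n"] list_decode_pos[of "l' n"]
    by (cases "l' n = 0"; cases "l x") (auto simp: list_rep_def pair_rep_def)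
  ultimately show ?thesis unfolding computable_def by blast
qed

text \<open>This lets the code of a list serve as the number of iterations when folding over
  it.\<close>

lemma length_list_decode: "length (list_decode n) \<le> n"
proof (induction n rule: list_decode.induct)
  case (2 n)
  then show ?case
    using le_prod_encode_2[of "snd (prod_decode n)" "fst (prod_decode n)"]
    by (fastforce split: prod.split simp: prod_decode_inverse)
qed simp

text \<open>The fold is run as an iteration whose state codes the parameter, the remaining list and
  the accumulator. The state is stationary once the list is exhausted, so surplus iterations do no
  harm and the list code can be taken as their number.\<close>

lemma computable_fold:
  assumes "computable A (list_rep B) l" "computable A C i"
    "computable (pair_rep A (pair_rep B C)) C s"
  shows "computable A C (\<lambda>x. fold (\<lambda>y c. s (x, y, c)) (l x) (i x))"
proof -
  obtain l' i' s' where
    l': "recursive1 l'" "\<And>n x. A n x \<Longrightarrow> list_rep B (l' n) (l x)" and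
    i': "recursive1 i'" "\<And>n x. A n x \<Longrightarrow> C (i' n) (i x)" and
    s': "recursive1 s'" "\<And>n x. pair_rep A (pair_rep B C) n x \<Longrightarrow> C (s' n) (s x)"
    using assms unfolding computable_def by blast
  define enc where "enc = (\<lambda>a k c. prod_encode (a, prod_encode (k, c)))"
  define rest where "rest = (\<lambda>z. fst (prod_decode (snd (prod_decode z))))"
  define acc where "acc = (\<lambda>z. snd (prod_decode (snd (prod_decode z))))"
  define step where "step = (\<lambda>z. if rest z = 0 then z else
    enc (fst (prod_decode z)) (snd (prod_decode (rest z - 1)))
      (s' (enc (fst (prod_decode z)) (fst (prod_decode (rest z - 1))) (acc z))))"
  have rest: "recursive1 rest" and acc: "recursive1 acc"
    unfolding rest_def acc_def
    by (intro recursive1_fst recursive1_snd recursive1_id)+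
  have step: "recursive1 step"
    unfolding step_def enc_def
    by (intro recursive1_if_zero recursive1_prod_encode rest acc recursive1_id
        recursive1_fst recursive1_snd recursive1_pred recursive1_comp[OF s'(1)])
  have fin: "(step ^^ m) (enc a 0 c) = enc a 0 c" for m a c
    by (induction m) (auto simp: step_def rest_def enc_def)
  have run: "\<exists>c'. (step ^^ m) (enc a k c) = enc a 0 c' \<and> C c' (fold (\<lambda>y c. s (x, y, c)) ys z)"
    if "A a x" "C c z" "list_all2 B (list_decode k) ys" "length ys \<le> m" for a x c z k ys m
    using that
  proof (induction ys arbitrary: m k c z)
    case Nil
    then have "k = 0" using list_decode_pos[of k] by (cases "k = 0") auto
    then show ?case using fin Nil by auto
  next
    case (Cons y ys)
    then have "0 < k" by (cases "k = 0") auto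
    note k = list_decode_pos[OF this]
    obtain m' where m: "m = Suc m'" using Cons.prems(4) by (cases m) auto
    let ?c = "s' (enc a (fst (prod_decode (k - 1))) c)"
    have "C ?c (s (x, y, z))"
      using Cons.prems k by (intro s'(2)) (auto simp: pair_rep_def enc_def)
    then obtain c' where "(step ^^ m') (enc a (snd (prod_decode (k - 1))) ?c) = enc a 0 c'"
      "C c' (fold (\<lambda>y c. s (x, y, c)) ys (s (x, y, z)))"
      using Cons.IH[OF Cons.prems(1), of ?c "s (x, y, z)" "snd (prod_decode (k - 1))" m']
        Cons.prems k m by auto
    moreover have "step (enc a k c) = enc a (snd (prod_decode (k - 1))) ?c"
      using \<open>0 < k\<close> by (simp add: step_def enc_def rest_def acc_def)
    ultimately show ?case
      unfolding m funpow_Suc_right by auto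
  qed
  let ?h = "\<lambda>n. acc ((step ^^ l' n) (enc n (l' n) (i' n)))"
  have "recursive1 ?h"
    unfolding enc_def
    by (intro recursive1_comp[OF acc] recursive1_funpow step l' recursive1_prod_encode
        recursive1_id i')
  moreover have "C (?h n) (fold (\<lambda>y c. s (x, y, c)) (l x) (i x))" if nx: "A n x" for n x
  proof -
    have "list_all2 B (list_decode (l' n)) (l x)"
      using l'(2)[OF nx] by (simp add: list_rep_def)
    moreover from this have "length (l x) \<le> l' n"
      using length_list_decode[of "l' n"] by (simp add: list_all2_lengthD)
    ultimately obtain c' where "(step ^^ l' n) (enc n (l' n) (i' n)) = enc n 0 c'"
      "C c' (fold (\<lambda>y c. s (x, y, c)) (l x) (i x))"
      using run[OF nx i'(2)[OF nx]] by blast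
    then show ?thesis by (simp add: acc_def enc_def)
  qed
  ultimately show ?thesis unfolding computable_def by blast
qed

lemmas computable_proj1 = computable_fst[OF computable_id] computable_snd[OF computable_id]
lemmas computable_proj2 = computable_proj1[THEN computable_fst] computable_proj1[THEN computable_snd]
lemmas computable_proj3 = computable_proj2[THEN computable_fst] computable_proj2[THEN computable_snd]
lemmas computable_proj4 = computable_proj3[THEN computable_fst] computable_proj3[THEN computable_snd]
lemmas computable_proj = computable_id computable_proj1 computable_proj2 computable_proj3 computable_proj4

lemma computable_rev:
  assumes "computable A (list_rep B) l"
  shows "computable A (list_rep B) (\<lambda>x. rev (l x))"
  using computable_fold[OF assms computable_Nil[of A B],
      of "\<lambda>z. fst (snd z) # snd (snd z)"]
  by (simp add: computable_Cons computable_proj rev_conv_fold)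

lemma computable_append:
  assumes "computable A (list_rep B) f" "computable A (list_rep B) g"
  shows "computable A (list_rep B) (\<lambda>x. f x @ g x)"
  using computable_fold[OF computable_rev[OF assms(1)] assms(2),
      of "\<lambda>z. fst (snd z) # snd (snd z)"]
  by (simp add: computable_Cons computable_proj fold_Cons_rev)

lemma computable_concat_map:
  assumes "computable A (list_rep B) l" "computable (pair_rep A B) (list_rep C) f"
  shows "computable A (list_rep C) (\<lambda>x. concat (map (\<lambda>y. f (x, y)) (l x)))"
proof -
  have "fold (\<lambda>y c. c @ f (x, y)) ys c = c @ concat (map (\<lambda>y. f (x, y)) ys)" for x ys c
    by (induction ys arbitrary: c) auto
  then show ?thesis
    using computable_fold[OF assms(1) computable_Nil[of A C],
        of "\<lambda>z. snd (snd z) @ f (fst z, fst (snd z))"]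
    by (simp add: computable_append computable_pair computable_proj
        computable_comp[OF assms(2)])
qed

lemma computable_map:
  assumes "computable A (list_rep B) l" "computable (pair_rep A B) C f"
  shows "computable A (list_rep C) (\<lambda>x. map (\<lambda>y. f (x, y)) (l x))"
proof -
  have "concat (map (\<lambda>y. [f (x, y)]) ys) = map (\<lambda>y. f (x, y)) ys" for x ys
    by (induction ys) auto
  then show ?thesis
    using computable_concat_map[OF assms(1), of C "\<lambda>z. [f z]"]
    by (simp add: computable_Cons computable_Nil assms(2))
qed

lemma computable_Ball:
  assumes "computable A (list_rep B) l" "computable (pair_rep A B) bool_rep P"
  shows "computable A bool_rep (\<lambda>x. \<forall>y\<in>set (l x). P (x, y))"
proof -
  have "fold (\<lambda>y c. c \<and> P (x, y)) ys c \<longleftrightarrow> c \<and> (\<forall>y\<in>set ys. P (x, y))" for x ys c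
    by (induction ys arbitrary: c) auto
  then show ?thesis
    using computable_fold[OF assms(1) computable_const[of bool_rep 1 True],
        of "\<lambda>z. snd (snd z) \<and> P (fst z, fst (snd z))"]
    by (simp add: computable_conj computable_pair computable_proj bool_rep_def
        computable_comp[OF assms(2)])
qed

lemma computable_Bex:
  assumes "computable A (list_rep B) l" "computable (pair_rep A B) bool_rep P"
  shows "computable A bool_rep (\<lambda>x. \<exists>y\<in>set (l x). P (x, y))"
  using computable_Not[OF computable_Ball[OF assms(1) computable_Not[OF assms(2)]]] by simp

lemma list_rep_ex: "(\<And>x. x \<in> set xs \<Longrightarrow> \<exists>n. A n x) \<Longrightarrow> \<exists>n. list_rep A n xs"
proof (induction xs)
  case Nil
  show ?case by (rule exI[of _ 0]) (simp add: list_rep_def)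
next
  case (Cons x xs)
  moreover from this obtain n where "list_rep A n xs" by auto
  ultimately obtain m n where "A m x" "list_rep A n xs" by (meson list.set_intros(1))
  then show ?case
    by (intro exI[of _ "Suc (prod_encode (m, n))"]) (simp add: list_rep_def)
qed

lemma pair_rep_ex: "\<exists>n. A n x \<Longrightarrow> \<exists>n. B n y \<Longrightarrow> \<exists>n. pair_rep A B n (x, y)"
  unfolding pair_rep_def by (metis fst_conv prod_encode_inverse snd_conv)

lemma sum_rep_ex: "\<exists>n. A n x \<Longrightarrow> \<exists>n. sum_rep A B n (Inl x)" "\<exists>n. B n y \<Longrightarrow> \<exists>n. sum_rep A B n (Inr y)"
proof -
  show "\<exists>n. sum_rep A B n (Inl x)" if "\<exists>n. A n x"
    using that by (auto simp: sum_rep_def intro: exI[of _ "prod_encode (0, _)"])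
  show "\<exists>n. sum_rep A B n (Inr y)" if "\<exists>n. B n y"
    using that by (auto simp: sum_rep_def intro: exI[of _ "prod_encode (1, _)"])
qed

text \<open>Written as a fold so that \<open>computable_fold\<close> applies; quantifiers over the
  factorisations of a word then become bounded quantifiers over this list.\<close>

definition splits :: "'a list \<Rightarrow> ('a list \<times> 'a) list" where
  "splits w = snd (fold (\<lambda>y pl. (fst pl @ [y], (fst pl, y) # snd pl)) w ([], []))"

lemma set_splits: "(p, y) \<in> set (splits w) \<longleftrightarrow> (\<exists>s. w = p @ y # s)"
proof -
  have snoc_eq: "splits (w @ [x]) = (w, x) # splits w" for w :: "'a list" and x
  proof -
    have "fst (fold (\<lambda>y pl. (fst pl @ [y], (fst pl, y) # snd pl)) w ([], [])) = w"
      by (induction w rule: rev_induct) auto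
    then show ?thesis by (simp add: splits_def)
  qed
  show ?thesis
  proof (induction w rule: rev_induct)
    case Nil
    show ?case by (simp add: splits_def)
  next
    case (snoc x w)
    show ?case
      unfolding snoc_eq using snoc
      by (auto simp: append_eq_append_conv2 Cons_eq_append_conv append_eq_Cons_conv)
  qed
qed

lemma computable_splits:
  assumes "computable A (list_rep B) l"
  shows "computable A (list_rep (pair_rep (list_rep B) B)) (\<lambda>x. splits (l x))"
proof -
  let ?P = "pair_rep (list_rep B) (list_rep (pair_rep (list_rep B) B))"
  have "computable (pair_rep A (pair_rep B ?P)) ?P
      (\<lambda>z. (fst (snd (snd z)) @ [fst (snd z)],
        (fst (snd (snd z)), fst (snd z)) # snd (snd (snd z))))"
    by (intro computable_pair computable_append computable_Cons computable_Nil computable_proj)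
  moreover have "computable A ?P (\<lambda>_. ([], []))"
    by (intro computable_pair computable_Nil)
  ultimately have "computable A ?P
      (\<lambda>x. fold (\<lambda>y c. (fst c @ [y], (fst c, y) # snd c)) (l x) ([], []))"
    using computable_fold[OF assms] by fastforce
  from computable_snd[OF this] show ?thesis by (simp add: splits_def)
qed


section \<open>Decidable relations between words\<close>

definition letter_rep :: "('b \<Rightarrow> nat) \<Rightarrow> 'b set \<Rightarrow> ('b \<times> bool) rep" where
  "letter_rep c A n a \<longleftrightarrow> fst a \<in> A \<and> n = 2 * c (fst a) + of_bool (snd a)"

abbreviation word_rep :: "('b \<Rightarrow> nat) \<Rightarrow> 'b set \<Rightarrow> 'b word rep" where
  "word_rep c A \<equiv> list_rep (letter_rep c A)"

lemma finite_rep_letter: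
  assumes "finite A" "inj_on c A"
  shows "finite_rep (letter_rep c A)"
proof -
  have "{n. \<exists>a. letter_rep c A n a} = (\<lambda>a. 2 * c (fst a) + of_bool (snd a)) ` (A \<times> UNIV)"
    by (simp only: letter_rep_def image_def mem_Times_iff Bex_def UNIV_I simp_thms)
  then have "finite {n. \<exists>a. letter_rep c A n a}"
    using assms(1) by (simp del: of_bool_eq_iff)
  moreover have "a = b" if "letter_rep c A n a" "letter_rep c A n b" for n a b
  proof -
    have eq: "2 * c (fst a) + of_bool (snd a) = 2 * c (fst b) + (of_bool (snd b) :: nat)"
      using that by (simp add: letter_rep_def)
    then have "c (fst a) = c (fst b)" "snd a = snd b"
      by (cases "snd a"; cases "snd b"; simp; presburger)+
    then show ?thesis using that assms(2) by (auto simp: letter_rep_def prod_eq_iff inj_on_def)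
  qed
  ultimately show ?thesis
    unfolding finite_rep_def by blast
qed

lemma word_rep_iff: "word_rep c A n w \<longleftrightarrow> w \<in> words A \<and> n = encode_word c w"
proof -
  have "list_all2 (letter_rep c A) ns w \<longleftrightarrow>
      w \<in> words A \<and> ns = map (\<lambda>(x, b). 2 * c x + of_bool b) w" for ns
    by (induction w arbitrary: ns) (auto simp: list_all2_Cons2 letter_rep_def)
  then show ?thesis
    unfolding list_rep_def encode_word_def by (metis list_decode_inverse list_encode_inverse)
qed

lemma letter_rep_ex: "fst a \<in> A \<Longrightarrow> \<exists>n. letter_rep c A n a"
  by (simp add: letter_rep_def)

lemma word_rep_ex: "w \<in> words A \<Longrightarrow> \<exists>n. word_rep c A n w"
  by (simp add: word_rep_iff)

lemma decidable_word_relI: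
  assumes "bij_betw c A {..<card A}"
    "computable (pair_rep (word_rep c A) (word_rep c A)) bool_rep (\<lambda>p. P (fst p) (snd p))"
  shows "decidable_word_rel A P"
proof -
  obtain g where g: "recursive1 g"
    "\<And>n p. pair_rep (word_rep c A) (word_rep c A) n p \<Longrightarrow> g n = of_bool (P (fst p) (snd p))"
    using assms(2) unfolding computable_def bool_rep_def by blast
  have "recursive_fun 2 (\<lambda>xs. g ([prod_encode (xs ! 0, xs ! 1)] ! 0))"
    by (rule recursive_fun_comp1[OF g(1)[unfolded recursive1_def] recursive_fun_prod_encode])
  moreover have "g (prod_encode (encode_word c v, encode_word c w)) = (if P v w then 1 else 0)"
    if "v \<in> words A" "w \<in> words A" for v w
    using g(2)[of _ "(v, w)"] that by (simp add: pair_rep_def word_rep_iff)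
  ultimately show ?thesis
    unfolding decidable_word_rel_def using assms(1) by fastforce
qed

lemma decidable_word_relE:
  assumes "decidable_word_rel A P"
  obtains c where "bij_betw c A {..<card A}"
    "computable (pair_rep (word_rep c A) (word_rep c A)) bool_rep (\<lambda>p. P (fst p) (snd p))"
proof -
  obtain c f where c: "bij_betw c A {..<card A}" and f: "recursive_fun 2 f"
    "\<And>v w. v \<in> words A \<Longrightarrow> w \<in> words A \<Longrightarrow>
       f [encode_word c v, encode_word c w] = (if P v w then 1 else 0)"
    using assms unfolding decidable_word_rel_def by blast
  have "recursive1 (\<lambda>n. f [fst (prod_decode n), snd (prod_decode n)])"
    by (intro recursive1_comp2[OF f(1)] recursive1_fst recursive1_snd recursive1_id)
  then have "computable (pair_rep (word_rep c A) (word_rep c A)) bool_rep (\<lambda>p. P (fst p) (snd p))"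
    using f(2) unfolding computable_def
    by (auto simp: pair_rep_def word_rep_iff bool_rep_def intro!: exI)
  then show ?thesis using that c by blast
qed

lemma decidable_word_rel_cong:
  assumes "\<And>v w. v \<in> words A \<Longrightarrow> w \<in> words A \<Longrightarrow> P v w \<longleftrightarrow> Q v w"
  shows "decidable_word_rel A P \<longleftrightarrow> decidable_word_rel A Q"
  unfolding decidable_word_rel_def using assms by auto

lemma ex_numbering:
  assumes "finite A"
  obtains c where "bij_betw c A {..<card A}"
  using ex_bij_betw_finite_nat[OF assms] by (auto simp: atLeast0LessThan)


section \<open>Special inverse monoids over invertible pieces\<close>

definition flip :: "'a \<times> bool \<Rightarrow> 'a \<times> bool" where
  "flip y = (fst y, \<not> snd y)"

lemma flip_simps [simp]: "flip (x, b) = (x, \<not> b)" "flip (flip y) = y" "fst (flip y) = fst y"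
  by (auto simp: flip_def)

lemma inv_word_Cons: "inv_word (y # w) = inv_word w @ [flip y]"
  by (simp add: inv_word_def flip_def split_beta)

lemma inv_word_single [simp]: "inv_word [y] = [flip y]"
  by (simp add: inv_word_Cons)

definition piece :: "('b \<Rightarrow> 'a word) \<Rightarrow> 'b \<times> bool \<Rightarrow> 'a word" where
  "piece u e = (if snd e then u (fst e) else inv_word (u (fst e)))"

lemma piece_flip: "piece u (flip e) = inv_word (piece u e)"
  by (simp add: piece_def flip_def)

lemma subst_word_simps [simp]:
  "subst_word u [] = []"
  "subst_word u (e # w) = piece u e @ subst_word u w"
  "subst_word u (v @ w) = subst_word u v @ subst_word u w"
  by (auto simp: subst_word_def piece_def split_beta)

lemma subst_word_inv_word: "subst_word u (inv_word w) = inv_word (subst_word u w)"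
  by (induction w) (auto simp: inv_word_Cons piece_flip)

lemma piece_in_words:
  "(\<And>j. j \<in> J \<Longrightarrow> u j \<in> words X) \<Longrightarrow> fst e \<in> J \<Longrightarrow> piece u e \<in> words X"
  by (simp add: piece_def)

lemma subst_word_in_words:
  "(\<And>j. j \<in> J \<Longrightarrow> u j \<in> words X) \<Longrightarrow> w \<in> words J \<Longrightarrow> subst_word u w \<in> words X"
  using piece_in_words[of J u X] by (induction w) auto

text \<open>A word outside \<open>words X\<close> has the empty set as its class, and a product with
  an empty factor is empty, so the equation holds for all words.\<close>

lemma quotient_monoid_append:
  "congr X S `` {v @ w} = congr X S `` {v} \<otimes>\<^bsub>quotient_monoid X (congr X S)\<^esub> congr X S `` {w}"
proof (cases "v \<in> words X \<and> w \<in> words X")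
  case True
  then show ?thesis by (simp add: quotient_monoid_mult)
next
  case False
  then have "congr X S `` {v @ w} = {}" "congr X S `` {v} = {} \<or> congr X S `` {w} = {}"
    by (auto dest: congr_words)
  then show ?thesis by (auto simp: quotient_monoid_def)
qed

lemma inv_class_append: "inv_class X R (v @ w) = inv_class X R v \<otimes>\<^bsub>Inv X R\<^esub> inv_class X R w"
  unfolding inv_class_def Inv_def inv_congr_def by (rule quotient_monoid_append)

lemma gp_class_append: "gp_class X R (v @ w) = gp_class X R v \<otimes>\<^bsub>Gp X R\<^esub> gp_class X R w"
  unfolding gp_class_def Gp_def gp_congr_def by (rule quotient_monoid_append)

text \<open>A vertex of a Cayley graph is given by a word \<open>g\<close> leading to it, and
  \<open>E g y\<close> says that the edge with label \<open>y\<close> at this vertex belongs to the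
  chosen subgraph.\<close>

fun reads :: "('a word \<Rightarrow> 'a \<times> bool \<Rightarrow> bool) \<Rightarrow> 'a word \<Rightarrow> 'a word \<Rightarrow> bool" where
  "reads E g [] \<longleftrightarrow> True"
| "reads E g (y # w) \<longleftrightarrow> E g y \<and> reads E (g @ [y]) w"

lemma reads_append: "reads E g (v @ w) \<longleftrightarrow> reads E g v \<and> reads E (g @ v) w"
  by (induction v arbitrary: g) auto

lemma reads_iff: "reads E g w \<longleftrightarrow> (\<forall>p y s. w = p @ y # s \<longrightarrow> E (g @ p) y)"
  by (induction w arbitrary: g) (auto simp: Cons_eq_append_conv)

section \<open>The action of the inverse monoid on subgraphs of the Cayley graph\<close>

locale presentation =
  fixes X :: "'a set" and R :: "('a word \<times> 'a word) set"
begin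

abbreviation \<gamma> :: "'a word \<Rightarrow> 'a word set" where "\<gamma> \<equiv> gp_class X R"
abbreviation \<mu> :: "'a word \<Rightarrow> 'a word set" where "\<mu> \<equiv> inv_class X R"

sublocale G: group "Gp X R" by (rule group_Gp)
sublocale M: monoid "Inv X R" by (rule monoid_Inv)

lemma \<gamma>_closed [simp]: "w \<in> words X \<Longrightarrow> \<gamma> w \<in> carrier (Gp X R)"
  by (simp add: gp_class_carrier)

lemma \<mu>_closed [simp]: "w \<in> words X \<Longrightarrow> \<mu> w \<in> carrier (Inv X R)"
  by (simp add: inv_class_carrier)

lemma \<gamma>_Nil: "\<gamma> [] = \<one>\<^bsub>Gp X R\<^esub>" and \<mu>_Nil: "\<mu> [] = \<one>\<^bsub>Inv X R\<^esub>"
  by (simp_all add: gp_class_one inv_class_one)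

lemma \<gamma>_inv_word: "w \<in> words X \<Longrightarrow> \<gamma> (inv_word w) = inv\<^bsub>Gp X R\<^esub> (\<gamma> w)"
  using im_inv_gp_class[of w X R] group_im_inv(2)[OF group_Gp, of "\<gamma> w" X R] by simp

lemma \<gamma>_cancel: "w \<in> words X \<Longrightarrow> \<gamma> (w @ inv_word w) = \<one>\<^bsub>Gp X R\<^esub>"
  by (simp add: gp_class_append \<gamma>_inv_word)

lemma \<gamma>_cancel_right: "g \<in> words X \<Longrightarrow> w \<in> words X \<Longrightarrow> \<gamma> (g @ w @ inv_word w) = \<gamma> g"
  using \<gamma>_cancel[of w] by (subst gp_class_append) simp

lemma \<gamma>_context: "\<gamma> a = \<gamma> b \<Longrightarrow> \<gamma> (p @ a @ q) = \<gamma> (p @ b @ q)"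
  by (simp add: gp_class_append)

lemma \<gamma>_cancel_left:
  "w \<in> words X \<Longrightarrow> g \<in> words X \<Longrightarrow> \<gamma> (w @ inv_word w @ g) = \<gamma> g"
  using \<gamma>_context[of "w @ inv_word w" "[]" "[]" g] \<gamma>_cancel[of w] by (simp add: \<gamma>_Nil)

lemma \<gamma>_eq_if_inv_congr: "(v, w) \<in> inv_congr X R \<Longrightarrow> \<gamma> v = \<gamma> w"
  using inv_congr_subset_gp_congr[of X R] congr_words[of v w X] gp_class_eq[of v X w R]
  by (auto simp: inv_congr_def)

lemma \<gamma>_eq_if_\<mu>_eq: "v \<in> words X \<Longrightarrow> w \<in> words X \<Longrightarrow> \<mu> v = \<mu> w \<Longrightarrow> \<gamma> v = \<gamma> w"
  using \<gamma>_eq_if_inv_congr inv_class_eq by blast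

text \<open>A set of edges of the Cayley graph of the maximal group image on which the relators act as
  loops carries an action of the inverse monoid by partial injections.\<close>

lemma reads_inv_congr:
  assumes resp: "\<And>g h y. \<gamma> g = \<gamma> h \<Longrightarrow> E g y \<Longrightarrow> E h y"
    and sym: "\<And>g y. g \<in> words X \<Longrightarrow> fst y \<in> X \<Longrightarrow> E g y \<Longrightarrow> E (g @ [y]) (flip y)"
    and V: "\<And>g y. g \<in> words X \<Longrightarrow> fst y \<in> X \<Longrightarrow> E g y \<Longrightarrow> V (g @ [y])"
    and rel: "\<And>v w g. (v, w) \<in> R \<Longrightarrow> g \<in> words X \<Longrightarrow> V g \<Longrightarrow> reads E g v \<and> reads E g w"
    and "(v, w) \<in> inv_congr X R" "g \<in> words X" "V g"
  shows "reads E g v \<longleftrightarrow> reads E g w"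
proof -
  have resp': "reads E g w \<longleftrightarrow> reads E h w" if "\<gamma> g = \<gamma> h" for g h w
    using that
  proof (induction w arbitrary: g h)
    case (Cons y w)
    have "E g y \<longleftrightarrow> E h y" using resp Cons.prems by metis
    moreover have "\<gamma> (g @ [y]) = \<gamma> (h @ [y])" using Cons.prems by (simp add: gp_class_append)
    ultimately show ?case using Cons.IH[of "g @ [y]" "h @ [y]"] by simp
  qed simp
  have inv: "reads E (g @ w) (inv_word w)" if "reads E g w" "g \<in> words X" "w \<in> words X" for g w
    using that
  proof (induction w rule: rev_induct)
    case (snoc y w)
    have "reads E (g @ w) (inv_word w)" using snoc by (simp add: reads_append)
    moreover have "\<gamma> (g @ w @ [y] @ [flip y]) = \<gamma> (g @ w)"
      using \<gamma>_cancel_right[of "g @ w" "[y]"] snoc.prems by simp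
    ultimately have "reads E (g @ w @ [y] @ [flip y]) (inv_word w)"
      using resp'[of "g @ w @ [y] @ [flip y]" "g @ w"] by blast
    moreover have "E (g @ w @ [y]) (flip y)"
      using sym[of "g @ w" y] snoc.prems by (simp add: reads_append)
    ultimately show ?case by simp
  qed simp
  have V': "V (g @ w)" if "reads E g w" "g \<in> words X" "w \<in> words X" "V g" for g w
    using that
  proof (induction w rule: rev_induct)
    case (snoc y w)
    then show ?case using V[of "g @ w" y] by (simp add: reads_append)
  qed simp
  have idem: "reads E g (w @ inv_word w) \<longleftrightarrow> reads E g w" if "g \<in> words X" "w \<in> words X" for g w
    using inv that by (auto simp: reads_append)
  \<comment> \<open>Reading \<open>w @ inv_word w\<close> returns to the same group element, so it
    acts as a restriction of the identity. Such restrictions commute, which settles the Vagner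
    relations.\<close>
  have idem2: "reads E g (w @ inv_word w @ z) \<longleftrightarrow> reads E g w \<and> reads E g z"
    if "g \<in> words X" "w \<in> words X" for g w z
    using idem[OF that] resp'[OF \<gamma>_cancel_right[OF that]] by (auto simp: reads_append)
  have "reads E g v \<longleftrightarrow> reads E g w"
    if "(v, w) \<in> congr X (vagner_rels X \<union> R)" "g \<in> words X" "V g" for v w g
    using that
  proof (induction rule: congr.induct)
    case (step v w p q)
    have "(v, w) \<in> inv_congr X R"
      unfolding inv_congr_def using step.hyps by (intro congr_rel) auto
    \<comment> \<open>Both sides of a relation end at the same vertex, so the remaining word
      \<open>q\<close> is read from there in either case.\<close>
    from \<gamma>_eq_if_inv_congr[OF this] have "\<gamma> (g @ p @ v) = \<gamma> (g @ p @ w)"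
      by (simp add: gp_class_append)
    note q = resp'[OF this, of q]
    have "reads E (g @ p) v \<longleftrightarrow> reads E (g @ p) w" if "reads E g p"
    proof -
      have gp: "g @ p \<in> words X" "V (g @ p)" using V' that step.prems step.hyps by auto
      consider "(v, w) \<in> R" | z where "v = z @ inv_word z @ z" "w = z" "z \<in> words X"
        | y z where "v = y @ inv_word y @ z @ inv_word z" "w = z @ inv_word z @ y @ inv_word y"
          "y \<in> words X" "z \<in> words X"
        using step.hyps(1) unfolding vagner_rels_def by blast
      then show ?thesis
      proof cases
        case 1
        then show ?thesis using rel gp by blast
      next
        case 2
        then show ?thesis using idem2 gp by blast
      next
        case 3
        then show ?thesis using idem2[OF gp(1)] idem[OF gp(1)] by blast
      qed
    qed
    then show ?case using q by (auto simp: reads_append)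
  qed auto
  then show ?thesis using assms(5-7) by (simp add: inv_congr_def)
qed

section \<open>E-unitarity, right units and readable words\<close>

lemma \<mu>_regular: "w \<in> words X \<Longrightarrow> \<mu> w \<otimes>\<^bsub>Inv X R\<^esub> \<mu> (inv_word w) \<otimes>\<^bsub>Inv X R\<^esub> \<mu> w = \<mu> w"
  using inv_class_regular[of w X R] by (simp add: inv_class_append M.m_assoc)

lemma \<mu>_inv_word_cong:
  "v \<in> words X \<Longrightarrow> w \<in> words X \<Longrightarrow> \<mu> v = \<mu> w \<Longrightarrow> \<mu> (inv_word v) = \<mu> (inv_word w)"
  using im_inv_inv_class by metis

text \<open>With \<open>s = \<mu> v\<close>, \<open>t = \<mu> w\<close> and inverses
  \<open>s'\<close>, \<open>t'\<close>, the product \<open>e = s' t\<close> maps to 1 in the group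
  and is therefore idempotent. An idempotent is its own inverse, so \<open>t' s = e\<close> too. The
  common domain idempotent then gives \<open>t = s e\<close> and \<open>s = t e\<close>, whence
  \<open>s = t\<close>.\<close>

lemma \<mu>_eqI:
  assumes "E_unitary X R" and vw: "v \<in> words X" "w \<in> words X"
    and dom: "\<mu> (v @ inv_word v) = \<mu> (w @ inv_word w)" and "\<gamma> v = \<gamma> w"
  shows "\<mu> v = \<mu> w"
proof -
  define s s' t t' where st: "s = \<mu> v" "s' = \<mu> (inv_word v)" "t = \<mu> w" "t' = \<mu> (inv_word w)"
  let ?m = "mult (Inv X R)"
  have c [simp]: "s \<in> carrier (Inv X R)" "s' \<in> carrier (Inv X R)" "t \<in> carrier (Inv X R)"
    "t' \<in> carrier (Inv X R)" using vw by (simp_all add: st)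
  define f where "f = ?m s s'"
  have f: "?m t t' = f" "?m s s' = f" using dom by (simp_all add: f_def st inv_class_append)
  have fc [simp]: "f \<in> carrier (Inv X R)" by (simp add: f_def)
  have fs: "?m f s = s" "?m f t = t" using \<mu>_regular[OF vw(1)] \<mu>_regular[OF vw(2)]
    unfolding f[symmetric] by (metis f st)+
  have sf: "?m s' f = s'" "?m t' f = t'"
    using \<mu>_regular[of "inv_word v"] \<mu>_regular[of "inv_word w"] vw f
    by (simp_all add: st M.m_assoc)
  define e where "e = ?m s' t"
  have ec [simp]: "e \<in> carrier (Inv X R)" by (simp add: e_def)
  have "e = \<mu> (inv_word v @ w)" by (simp add: e_def st inv_class_append)
  moreover have "\<gamma> (inv_word v @ w) = \<one>\<^bsub>Gp X R\<^esub>"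
    using assms by (simp add: gp_class_append \<gamma>_inv_word)
  ultimately have ee: "?m e e = e"
    using assms(1) vw max_group_map_class[of "inv_word v @ w" X R] unfolding E_unitary_def by simp
  have "?m (?m e (?m t' s)) e = ?m s' (?m (?m t t') (?m (?m s s') t))"
    "?m (?m (?m t' s) e) (?m t' s) = ?m t' (?m (?m s s') (?m (?m t t') s))"
    by (simp_all add: e_def M.m_assoc)
  then have "?m (?m e (?m t' s)) e = e" "?m (?m (?m t' s) e) (?m t' s) = ?m t' s"
    by (simp_all add: f fs e_def)
  then have "im_inv (Inv X R) e = ?m t' s" by (intro im_inv_eqI[OF inverse_monoid_Inv]) simp_all
  moreover have "im_inv (Inv X R) e = e"
    by (intro im_inv_eqI[OF inverse_monoid_Inv]) (simp_all add: ee)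
  ultimately have e: "?m t' s = e" by simp
  have t: "t = ?m s e" using fs(2) by (simp add: e_def f(2)[symmetric] M.m_assoc)
  have "s = ?m t e" using fs(1) by (simp add: e[symmetric] f(1)[symmetric] M.m_assoc)
  also have "\<dots> = t" unfolding t using ee by (simp add: M.m_assoc)
  finally show ?thesis by (simp add: st)
qed

lemma \<mu>_context: "\<mu> a = \<mu> b \<Longrightarrow> \<mu> (p @ a @ q) = \<mu> (p @ b @ q)"
  by (simp add: inv_class_append)

definition right_unit :: "'a word \<Rightarrow> bool" where
  "right_unit p \<longleftrightarrow> p \<in> words X \<and> \<mu> (p @ inv_word p) = \<one>\<^bsub>Inv X R\<^esub>"

lemma right_unit_append: "right_unit p \<Longrightarrow> right_unit q \<Longrightarrow> right_unit (p @ q)"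
  using \<mu>_context[of "q @ inv_word q" "[]" p "inv_word p"]
  by (simp add: right_unit_def \<mu>_Nil)

text \<open>Multiply the equation for \<open>p @ q\<close> on the left by the idempotent of
  \<open>p\<close>: regularity lets one side absorb it, and the other side becomes that
  idempotent.\<close>

lemma right_unit_prefix:
  assumes "right_unit (p @ q)"
  shows "right_unit p"
proof -
  have w: "p \<in> words X" "q \<in> words X" and pq: "\<mu> (p @ q @ inv_word (p @ q)) = \<mu> []"
    using assms by (auto simp: right_unit_def \<mu>_Nil)
  have "\<mu> (p @ inv_word p) = \<mu> ((p @ inv_word p @ p) @ q @ inv_word (p @ q))"
    using \<mu>_context[OF pq, of "p @ inv_word p" "[]"] by simp
  also have "\<dots> = \<mu> (p @ q @ inv_word (p @ q))"
    using \<mu>_context[OF inv_class_regular[OF w(1)], of "[]" "q @ inv_word (p @ q)"] by simp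
  finally show ?thesis using w pq by (simp add: right_unit_def \<mu>_Nil)
qed

lemma right_unit_if_unit: "w \<in> words X \<Longrightarrow> \<mu> w \<in> Units (Inv X R) \<Longrightarrow> right_unit w"
proof -
  assume w: "w \<in> words X" and U: "\<mu> w \<in> Units (Inv X R)"
  have "im_inv (Inv X R) (\<mu> w) = inv\<^bsub>Inv X R\<^esub> (\<mu> w)"
    using U by (intro im_inv_eqI[OF inverse_monoid_Inv]) auto
  then show ?thesis
    using w U by (simp add: right_unit_def inv_class_append im_inv_inv_class)
qed

lemma inv_word_unit: "w \<in> words X \<Longrightarrow> \<mu> w \<in> Units (Inv X R) \<Longrightarrow> \<mu> (inv_word w) \<in> Units (Inv X R)"
proof -
  assume w: "w \<in> words X" and U: "\<mu> w \<in> Units (Inv X R)"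
  have "im_inv (Inv X R) (\<mu> w) = inv\<^bsub>Inv X R\<^esub> (\<mu> w)"
    using U by (intro im_inv_eqI[OF inverse_monoid_Inv]) auto
  then show ?thesis using w U by (simp add: im_inv_inv_class)
qed

text \<open>In the Schuetzenberger graph of \<open>v\<close> the word \<open>g\<close> can be read from the base vertex; the
  equation says that \<open>v v\<inverse> g g\<inverse> v v\<inverse> = v v\<inverse>\<close>.\<close>

definition below :: "'a word \<Rightarrow> 'a word \<Rightarrow> bool" where
  "below v g \<longleftrightarrow> \<mu> ((v @ inv_word v @ g) @ inv_word (v @ inv_word v @ g)) = \<mu> (v @ inv_word v)"

text \<open>Regularity of \<open>q\<inverse>\<close> reduces the word to
  \<open>v v\<inverse> v v\<inverse>\<close>, and regularity of \<open>v\<close> finishes the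
  reduction.\<close>

lemma below_prefix:
  assumes "q @ s \<in> words X"
  shows "below (q @ s) q"
proof -
  have w: "q \<in> words X" "s \<in> words X" using assms by auto
  let ?v = "q @ s"
  have "\<mu> ((?v @ inv_word ?v @ q) @ inv_word (?v @ inv_word ?v @ q))
      = \<mu> ((?v @ inv_word s) @ (inv_word q @ q @ inv_word q) @ (q @ s @ inv_word ?v))"
    by simp
  also have "\<dots> = \<mu> ((?v @ inv_word s) @ inv_word q @ (q @ s @ inv_word ?v))"
    by (rule \<mu>_context) (use inv_class_regular[of "inv_word q" X R] w in simp)
  also have "\<dots> = \<mu> ([] @ (?v @ inv_word ?v @ ?v) @ inv_word ?v)" by simp
  also have "\<dots> = \<mu> ([] @ ?v @ inv_word ?v)"
    by (rule \<mu>_context) (use inv_class_regular[of ?v X R] w in simp)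
  finally show ?thesis by (simp add: below_def)
qed

lemma below_right_unit:
  assumes "below v g" "right_unit p"
  shows "below v (g @ p)"
proof -
  have "\<mu> ((v @ inv_word v @ g) @ (p @ inv_word p) @ inv_word (v @ inv_word v @ g))
      = \<mu> ((v @ inv_word v @ g) @ [] @ inv_word (v @ inv_word v @ g))"
    using assms by (intro \<mu>_context) (simp add: right_unit_def \<mu>_Nil)
  then show ?thesis using assms(1) by (simp add: below_def)
qed

lemma below_turn:
  assumes "below v (g @ s)" "s \<in> words X"
  shows "below v (g @ s @ inv_word s)"
proof -
  have "\<mu> ((v @ inv_word v @ g) @ ((s @ inv_word s @ s) @ inv_word s) @ inv_word (v @ inv_word v @ g))
      = \<mu> ((v @ inv_word v @ g) @ (s @ inv_word s) @ inv_word (v @ inv_word v @ g))"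
    using assms \<mu>_context[OF inv_class_regular[of s X R], of "[]"] by (intro \<mu>_context) simp
  then show ?thesis using assms(1) by (simp add: below_def)
qed

text \<open>The words \<open>v v\<inverse> g\<close> and \<open>v v\<inverse> h\<close> have the
  same domain idempotent and the same image in the group, so E-unitarity makes them equal in the
  monoid. Hence what can be read after \<open>g\<close> depends only on its vertex in the Cayley
  graph.\<close>

lemma below_transfer:
  assumes "E_unitary X R" "v \<in> words X" "g \<in> words X" "h \<in> words X" "s \<in> words X"
    and "below v g" "below v h" "\<gamma> g = \<gamma> h" "below v (g @ s)"
  shows "below v (h @ s)"
proof -
  let ?x = "\<lambda>g. v @ inv_word v @ g"
  have "\<mu> (?x g) = \<mu> (?x h)"
  proof (rule \<mu>_eqI[OF assms(1)])
    show "\<mu> (?x g @ inv_word (?x g)) = \<mu> (?x h @ inv_word (?x h))"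
      by (rule HOL.trans[OF assms(6)[unfolded below_def] assms(7)[unfolded below_def, symmetric]])
    show "\<gamma> (?x g) = \<gamma> (?x h)"
      using \<gamma>_context[OF assms(8), of "v @ inv_word v" "[]"] by simp
  qed (use assms in auto)
  from \<mu>_context[OF this, of "[]" s] have "\<mu> (?x (g @ s)) = \<mu> (?x (h @ s))" by simp
  with \<mu>_inv_word_cong[OF _ _ this] show ?thesis
    using assms unfolding below_def inv_class_append[of _ _ "v @ inv_word v @ _"] by simp
qed

end

section \<open>Equality in the monoid by reading in finite unions of piece paths\<close>

locale special_presentation = presentation X R
  for X :: "'a set" and R :: "('a word \<times> 'a word) set" +
  fixes J :: "'j set" and u :: "'j \<Rightarrow> 'a word"
  assumes E_unitary: "E_unitary X R"
    and u_words: "j \<in> J \<Longrightarrow> u j \<in> words X"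
    and u_unit: "j \<in> J \<Longrightarrow> represents_unit X R (u j)"
    and R_pieces: "(v, w) \<in> R \<Longrightarrow> w = [] \<and> (\<exists>\<rho>\<in>words J. v = subst_word u \<rho>)"
begin

lemma piece_words [simp]: "fst e \<in> J \<Longrightarrow> piece u e \<in> words X"
  using piece_in_words[of J u X] u_words by blast

lemma subst_words [simp]: "\<rho> \<in> words J \<Longrightarrow> subst_word u \<rho> \<in> words X"
  using subst_word_in_words[of J u X] u_words by blast

lemma piece_unit: "fst e \<in> J \<Longrightarrow> \<mu> (piece u e) \<in> Units (Inv X R)"
  using u_unit[of "fst e"] u_words inv_word_unit by (auto simp: piece_def represents_unit_def)

text \<open>Words representing the submonoid \<open>P\<close> of the opening explanation. They are
  kept as words because each of them is a right unit of the monoid.\<close>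

definition prefix_words :: "'a word set" where
  "prefix_words = concat ` lists {p. \<exists>e. fst e \<in> J \<and> prefix p (piece u e)}"

lemma prefix_words_Nil: "[] \<in> prefix_words"
  unfolding prefix_words_def by (rule image_eqI[of _ _ "[]"]) auto

lemma prefix_words_append: "p \<in> prefix_words \<Longrightarrow> q \<in> prefix_words \<Longrightarrow> p @ q \<in> prefix_words"
proof -
  assume "p \<in> prefix_words" "q \<in> prefix_words"
  then obtain ps qs where "p = concat ps" "q = concat qs"
    "ps @ qs \<in> lists {p. \<exists>e. fst e \<in> J \<and> prefix p (piece u e)}"
    unfolding prefix_words_def by auto
  then show ?thesis unfolding prefix_words_def by (intro image_eqI[of _ _ "ps @ qs"]) auto
qed

lemma prefix_words_prefix: "fst e \<in> J \<Longrightarrow> prefix p (piece u e) \<Longrightarrow> p \<in> prefix_words"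
  unfolding prefix_words_def by (rule image_eqI[of _ _ "[p]"]) (auto intro!: exI[of _ "fst e"] exI[of _ "snd e"])

lemma right_unit_piece_prefix: "fst e \<in> J \<Longrightarrow> prefix p (piece u e) \<Longrightarrow> right_unit p"
  using right_unit_if_unit[OF piece_words piece_unit, of e] right_unit_prefix
  by (metis prefix_def)

lemma right_unit_prefix_words: "p \<in> prefix_words \<Longrightarrow> right_unit p"
proof -
  have "ps \<in> lists {p. \<exists>e. fst e \<in> J \<and> prefix p (piece u e)} \<Longrightarrow> right_unit (concat ps)" for ps
  proof (induction ps)
    case Nil
    then show ?case by (simp add: right_unit_def \<mu>_Nil)
  next
    case (Cons p ps)
    then show ?case using right_unit_append right_unit_piece_prefix by auto
  qed
  then show "p \<in> prefix_words \<Longrightarrow> right_unit p" unfolding prefix_words_def by auto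
qed

lemma prefix_words_in_words: "p \<in> prefix_words \<Longrightarrow> p \<in> words X"
  using right_unit_prefix_words by (simp add: right_unit_def)

definition path_edge :: "'a word \<Rightarrow> 'a word \<Rightarrow> 'a \<times> bool \<Rightarrow> bool" where
  "path_edge v g y \<longleftrightarrow> (\<exists>q z s. v = q @ z # s \<and>
     (y = z \<and> \<gamma> g = \<gamma> q \<or> y = flip z \<and> \<gamma> g = \<gamma> (q @ [z])))"

text \<open>Closed under reversal because \<open>e\<close> runs over the pieces and their
  inverses.\<close>

definition piece_edge :: "'a word \<Rightarrow> 'a word \<Rightarrow> 'a \<times> bool \<Rightarrow> bool" where
  "piece_edge v g y \<longleftrightarrow> (\<exists>q s p a e. v = q @ s \<and> p \<in> prefix_words \<and> fst e \<in> J \<and>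
     prefix (a @ [y]) (piece u e) \<and> \<gamma> g = \<gamma> (q @ p @ a))"

text \<open>The edges of the Schuetzenberger graph of \<open>v\<close>, as a subgraph of the Cayley graph of the
  maximal group image.\<close>

definition edge :: "'a word \<Rightarrow> 'a word \<Rightarrow> 'a \<times> bool \<Rightarrow> bool" where
  "edge v g y \<longleftrightarrow> path_edge v g y \<or> piece_edge v g y"

definition vertex :: "'a word \<Rightarrow> 'a word \<Rightarrow> bool" where
  "vertex v g \<longleftrightarrow> (\<exists>q s p. v = q @ s \<and> p \<in> prefix_words \<and> \<gamma> g = \<gamma> (q @ p))"

lemma edge_flip:
  assumes "edge v g y" "g \<in> words X" "fst y \<in> X" "v \<in> words X"
  shows "edge v (g @ [y]) (flip y)"
  using assms(1) unfolding edge_def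
proof
  assume "path_edge v g y"
  then obtain q z s where *: "v = q @ z # s"
    "y = z \<and> \<gamma> g = \<gamma> q \<or> y = flip z \<and> \<gamma> g = \<gamma> (q @ [z])"
    unfolding path_edge_def by blast
  have "\<gamma> (q @ [z] @ [flip z]) = \<gamma> q"
    using \<gamma>_cancel_right[of q "[z]"] *(1) assms(4) by simp
  with *(2) have "flip y = z \<and> \<gamma> (g @ [y]) = \<gamma> q \<or> flip y = flip z \<and> \<gamma> (g @ [y]) = \<gamma> (q @ [z])"
    using \<gamma>_context[of g q "[]" "[y]"] \<gamma>_context[of g "q @ [z]" "[]" "[y]"] by auto
  then have "path_edge v (g @ [y]) (flip y)"
    unfolding path_edge_def using *(1) by blast
  then show "path_edge v (g @ [y]) (flip y) \<or> piece_edge v (g @ [y]) (flip y)" ..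
next
  assume "piece_edge v g y"
  then obtain q s p a e b where *: "v = q @ s" "p \<in> prefix_words" "fst e \<in> J"
     "piece u e = a @ y # b" "\<gamma> g = \<gamma> (q @ p @ a)"
    unfolding piece_edge_def by (auto simp: prefix_def)
  have w: "q \<in> words X" "p \<in> words X" "a \<in> words X" "b \<in> words X" "piece u e \<in> words X"
    using * assms piece_words[of e] prefix_words_in_words by auto
  \<comment> \<open>The reversed edge is found on the inverse piece, started at the far end of the
    piece. That end is again a vertex, since whole pieces can be appended to
    \<open>p\<close>.\<close>
  have "p @ piece u e \<in> prefix_words"
    using prefix_words_append[OF *(2) prefix_words_prefix[OF *(3)]] by simp
  moreover have "prefix (inv_word b @ [flip y]) (piece u (flip e))"
    unfolding piece_flip *(4) by (simp add: inv_word_Cons)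
  moreover have "\<gamma> (g @ [y]) = \<gamma> (q @ (p @ piece u e) @ inv_word b)"
    using \<gamma>_cancel_right[of "q @ p @ a @ [y]" b] w assms(3) \<gamma>_context[OF *(5), of "[]" "[y]"]
    unfolding *(4) by simp
  ultimately have "piece_edge v (g @ [y]) (flip y)"
    unfolding piece_edge_def using *(1,3)
    by (intro exI[of _ q] exI[of _ s] exI[of _ "p @ piece u e"] exI[of _ "inv_word b"]
        exI[of _ "flip e"]) simp
  then show "path_edge v (g @ [y]) (flip y) \<or> piece_edge v (g @ [y]) (flip y)" ..
qed

text \<open>A piece read from \<open>q p\<close> runs along piece edges and ends at a vertex of the
  same kind, so pieces can be chained. This is the condition on relators in
  \<open>reads_inv_congr\<close>.\<close>

lemma reads_pieces:
  assumes "vertex v g" "\<rho> \<in> words J"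
  shows "reads (edge v) g (subst_word u \<rho>)"
  using assms
proof (induction \<rho> arbitrary: g)
  case (Cons e \<rho>)
  obtain q s p where *: "v = q @ s" "p \<in> prefix_words" "\<gamma> g = \<gamma> (q @ p)"
    using Cons.prems unfolding vertex_def by blast
  have e: "fst e \<in> J" using Cons.prems by simp
  have "piece_edge v (g @ a) y" if "piece u e = a @ y # b" for a y b
  proof -
    have "prefix (a @ [y]) (piece u e)" by (simp add: that)
    moreover have "\<gamma> (g @ a) = \<gamma> (q @ p @ a)" using \<gamma>_context[OF *(3), of "[]" a] by simp
    ultimately show ?thesis unfolding piece_edge_def using *(1,2) e by blast
  qed
  then have "reads (edge v) g (piece u e)"
    unfolding reads_iff edge_def by blast
  moreover have "p @ piece u e \<in> prefix_words"
    using prefix_words_append[OF *(2) prefix_words_prefix[OF e]] by simp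
  then have "vertex v (g @ piece u e)"
    unfolding vertex_def using *(1) \<gamma>_context[OF *(3), of "[]" "piece u e"] by fastforce
  ultimately show ?case using Cons by (simp add: reads_append)
qed simp

lemma vertex_edge:
  assumes "edge v g y" "v \<in> words X"
  shows "vertex v (g @ [y])"
  using assms(1) unfolding edge_def
proof
  assume "path_edge v g y"
  then obtain q z s where *: "v = q @ z # s"
    "y = z \<and> \<gamma> g = \<gamma> q \<or> y = flip z \<and> \<gamma> g = \<gamma> (q @ [z])"
    unfolding path_edge_def by blast
  have "\<gamma> (q @ [z] @ [flip z]) = \<gamma> q"
    using \<gamma>_cancel_right[of q "[z]"] *(1) assms(2) by simp
  then have "\<gamma> (g @ [y]) = \<gamma> ((q @ [z]) @ []) \<or> \<gamma> (g @ [y]) = \<gamma> (q @ [])"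
    using *(2) \<gamma>_context[of g q "[]" "[y]"] \<gamma>_context[of g "q @ [z]" "[]" "[y]"] by auto
  then show ?thesis
    unfolding vertex_def
    using *(1) prefix_words_Nil by (metis append.assoc append_Cons append_Nil)
next
  assume "piece_edge v g y"
  then obtain q s p a e where *: "v = q @ s" "p \<in> prefix_words" "fst e \<in> J"
     "prefix (a @ [y]) (piece u e)" "\<gamma> g = \<gamma> (q @ p @ a)"
    unfolding piece_edge_def by blast
  have "p @ a @ [y] \<in> prefix_words"
    using prefix_words_append[OF *(2) prefix_words_prefix[OF *(3,4)]] .
  moreover have "\<gamma> (g @ [y]) = \<gamma> (q @ p @ a @ [y])"
    using \<gamma>_context[OF *(5), of "[]" "[y]"] by simp
  ultimately show ?thesis unfolding vertex_def using *(1) by blast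
qed

lemma vertex_Nil: "vertex v []"
  unfolding vertex_def using prefix_words_Nil by fastforce

lemma vertex_reads:
  assumes "reads (edge v) g w" "vertex v g" "v \<in> words X"
  shows "vertex v (g @ w)"
  using assms vertex_edge
  by (induction w arbitrary: g) fastforce+

lemma reads_edge_cong:
  assumes "v \<in> words X" "\<mu> w = \<mu> z" "w \<in> words X" "z \<in> words X"
  shows "reads (edge v) [] w \<longleftrightarrow> reads (edge v) [] z"
proof (rule reads_inv_congr[where V = "vertex v"])
  show "edge v h y" if "\<gamma> g = \<gamma> h" "edge v g y" for g h y
    using that unfolding edge_def path_edge_def piece_edge_def by metis
  show "reads (edge v) g x \<and> reads (edge v) g y" if "(x, y) \<in> R" "vertex v g" for x y g
    using R_pieces[OF that(1)] reads_pieces[OF that(2)] by auto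
  show "(w, z) \<in> inv_congr X R" using assms inv_class_eq by blast
qed (use assms edge_flip vertex_edge vertex_Nil in auto)

lemma reads_edge_self: "reads (edge v) [] v"
  unfolding reads_iff edge_def path_edge_def by auto

text \<open>A path edge follows \<open>v\<close> or turns back along it, and a piece edge prolongs
  \<open>q\<close> by right units. \<open>below_transfer\<close> carries the claim from these
  particular words to any word \<open>g\<close> for the same vertex.\<close>

lemma below_edge:
  assumes "v \<in> words X" "g \<in> words X" "fst y \<in> X" "below v g" "edge v g y"
  shows "below v (g @ [y])"
  using assms(5) unfolding edge_def
proof
  assume "path_edge v g y"
  then obtain q z s where *: "v = q @ z # s"
    "y = z \<and> \<gamma> g = \<gamma> q \<or> y = flip z \<and> \<gamma> g = \<gamma> (q @ [z])"
    unfolding path_edge_def by blast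
  have q: "q \<in> words X" "[z] \<in> words X" using * assms(1) by auto
  have b: "below v q" "below v (q @ [z])"
    using below_prefix[of q "z # s"] below_prefix[of "q @ [z]" s] *(1) assms(1) by auto
  have "below v ((q @ [z]) @ [flip z])"
    using below_turn[OF b(2)] q by simp
  then show ?thesis
    using *(2) b q assms(1-4) below_transfer[OF E_unitary assms(1) q(1) assms(2), of "[y]"]
      below_transfer[OF E_unitary assms(1) _ assms(2), of "q @ [z]" "[y]"]
    by auto
next
  assume "piece_edge v g y"
  then obtain q s p a e where *: "v = q @ s" "p \<in> prefix_words" "fst e \<in> J"
     "prefix (a @ [y]) (piece u e)" "\<gamma> g = \<gamma> (q @ p @ a)"
    unfolding piece_edge_def by blast
  have "right_unit (a @ [y])" "right_unit a" "right_unit p"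
    using *(2-4) right_unit_piece_prefix right_unit_prefix_words right_unit_prefix by blast+
  moreover have "below v q" using below_prefix *(1) assms(1) by blast
  ultimately have "below v (q @ p @ a)" "below v ((q @ p @ a) @ [y])"
    using below_right_unit[of v q "p @ a"] below_right_unit[of v q "p @ a @ [y]"]
      right_unit_append by auto
  then show ?thesis
    using below_transfer[OF E_unitary assms(1) _ assms(2), of "q @ p @ a" "[y]"] assms *
      \<open>right_unit a\<close> \<open>right_unit p\<close> by (auto simp: right_unit_def)
qed

lemma below_if_reads:
  assumes "v \<in> words X" "w \<in> words X" "reads (edge v) [] w"
  shows "below v w"
  using assms(2,3)
proof (induction w rule: rev_induct)
  case Nil
  show ?case using below_prefix[of "[]" v] assms(1) by simp
next
  case (snoc y w)
  then show ?case using below_edge[OF assms(1), of w y] by (simp add: reads_append)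
qed

text \<open>Every word can be read in its own graph, and reading is invariant under equality in the
  monoid. Conversely, mutual readability makes the domain idempotents of the two words equal, and
  \<open>\<mu>_eqI\<close> applies.\<close>

theorem \<mu>_eq_iff:
  assumes "v \<in> words X" "w \<in> words X"
  shows "\<mu> v = \<mu> w \<longleftrightarrow> \<gamma> v = \<gamma> w \<and> reads (edge v) [] w \<and> reads (edge w) [] v"
proof (intro iffI conjI)
  assume "\<mu> v = \<mu> w"
  then show "\<gamma> v = \<gamma> w" "reads (edge v) [] w" "reads (edge w) [] v"
    using \<gamma>_eq_if_\<mu>_eq reads_edge_cong reads_edge_self assms by metis+
next
  assume *: "\<gamma> v = \<gamma> w \<and> reads (edge v) [] w \<and> reads (edge w) [] v"
  have idem: "\<mu> (x @ inv_word x) \<otimes>\<^bsub>Inv X R\<^esub> \<mu> (x @ inv_word x) = \<mu> (x @ inv_word x)"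
    if "x \<in> words X" for x
    using \<mu>_regular[OF that] that by (simp add: inv_class_append flip: M.m_assoc)
  \<comment> \<open>Idempotents commute, so \<open>below v w\<close> says that the idempotent of
    \<open>v\<close> lies under that of \<open>w\<close> in the natural order.\<close>
  have "\<mu> (v @ inv_word v @ w @ inv_word w) = \<mu> (v @ inv_word v)"
    if "below v w" "v \<in> words X" "w \<in> words X" for v w
  proof -
    let ?e = "\<mu> (v @ inv_word v)" and ?f = "\<mu> (w @ inv_word w)"
    have "?e = ?e \<otimes>\<^bsub>Inv X R\<^esub> ?f \<otimes>\<^bsub>Inv X R\<^esub> ?e"
      using that by (simp add: below_def inv_class_append M.m_assoc)
    also have "\<dots> = ?e \<otimes>\<^bsub>Inv X R\<^esub> (?f \<otimes>\<^bsub>Inv X R\<^esub> ?e)"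
      using that by (intro M.m_assoc) auto
    also have "?f \<otimes>\<^bsub>Inv X R\<^esub> ?e = ?e \<otimes>\<^bsub>Inv X R\<^esub> ?f"
      using inv_class_commute[of w X v R] that by (simp add: inv_class_append M.m_assoc)
    also have "?e \<otimes>\<^bsub>Inv X R\<^esub> (?e \<otimes>\<^bsub>Inv X R\<^esub> ?f) = ?e \<otimes>\<^bsub>Inv X R\<^esub> ?f"
      using that idem[of v] by (subst M.m_assoc[symmetric]) auto
    finally show ?thesis by (simp flip: inv_class_append)
  qed
  from this[of v w] this[of w v] have "\<mu> (v @ inv_word v) = \<mu> (w @ inv_word w)"
    using * assms below_if_reads inv_class_commute[of v X w R] by simp
  then show "\<mu> v = \<mu> w" using * assms E_unitary \<mu>_eqI by blast
qed

section \<open>The group of units\<close>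

lemma right_unit_eq_prefix_word:
  assumes "right_unit w"
  shows "\<exists>p\<in>prefix_words. \<mu> w = \<mu> p"
proof -
  have w: "w \<in> words X" "\<mu> (w @ inv_word w) = \<mu> []"
    using assms by (auto simp: right_unit_def \<mu>_Nil)
  \<comment> \<open>The empty word can be read in its own graph, hence so can any word equal to it.
    The vertices of this graph are exactly the images of \<open>prefix_words\<close>, so the end of
    \<open>w\<close> supplies \<open>p\<close>.\<close>
  have "reads (edge []) [] (w @ inv_word w)"
    using reads_edge_cong[of "[]", OF _ w(2)] w(1) by simp
  then have "vertex [] w"
    using vertex_reads[of "[]" "[]" w] vertex_Nil by (simp add: reads_append)
  then obtain p where p: "p \<in> prefix_words" "\<gamma> w = \<gamma> p"
    unfolding vertex_def by auto
  have "\<mu> (w @ inv_word w) = \<mu> (p @ inv_word p)" "p \<in> words X"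
    using w(2) right_unit_prefix_words[OF p(1)] by (simp_all add: right_unit_def \<mu>_Nil)
  then have "\<mu> w = \<mu> p" using w(1) p(2) E_unitary \<mu>_eqI by blast
  with p show ?thesis by blast
qed

text \<open>Factors are split off from the right. If \<open>c\<close> inverts the unit
  \<open>a t\<close> and \<open>t\<close> is a right unit, then \<open>c a\<close> is a left inverse
  of \<open>t\<close>; so \<open>t\<close> is a unit, and with it \<open>a\<close>.\<close>

lemma unit_factors:
  assumes "\<mu> (concat ps) \<in> Units (Inv X R)" "\<And>p. p \<in> set ps \<Longrightarrow> right_unit p" "p \<in> set ps"
  shows "\<mu> p \<in> Units (Inv X R)"
  using assms
proof (induction ps rule: rev_induct)
  case (snoc t ps)
  let ?m = "mult (Inv X R)" and ?a = "\<mu> (concat ps)" and ?t = "\<mu> t"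
  have ps: "concat ps \<in> words X"
    using snoc.prems(2) by (induction ps) (auto simp: right_unit_def)
  have t: "t \<in> words X" "?m ?t (\<mu> (inv_word t)) = \<one>\<^bsub>Inv X R\<^esub>"
    using snoc.prems(2)[of t] by (auto simp: right_unit_def inv_class_append)
  have at: "?m ?a ?t \<in> Units (Inv X R)" using snoc.prems(1) by (simp add: inv_class_append)
  define c where "c = inv\<^bsub>Inv X R\<^esub> (?m ?a ?t)"
  have c: "c \<in> carrier (Inv X R)" "?m (?m c ?a) ?t = \<one>\<^bsub>Inv X R\<^esub>"
    using at ps t M.Units_l_inv[OF at] by (auto simp: c_def M.m_assoc)
  have "?m c ?a = \<mu> (inv_word t)"
    using M.inv_unique[OF c(2) t(2)] c ps t by auto
  then have tU: "?t \<in> Units (Inv X R)"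
    using t c unfolding Units_def by auto
  moreover have "?a \<in> Units (Inv X R)"
  proof -
    have "?a = ?m (?m ?a ?t) (inv\<^bsub>Inv X R\<^esub> ?t)"
      using ps t tU by (simp add: M.m_assoc)
    then show ?thesis using at tU by (metis M.Units_inv_Units M.Units_m_closed)
  qed
  ultimately show ?case using snoc by auto
qed simp

text \<open>A unit is a product of prefixes of pieces and inverse pieces, all of them right units.
  Each factor is then a unit, and minimality leaves only empty words and whole pieces.\<close>

lemma units_generated:
  assumes "minimal_invertible_pieces X R J u"
  shows "Units (Inv X R) = (\<lambda>\<rho>. \<mu> (subst_word u \<rho>)) ` words J"
proof safe
  fix m assume "m \<in> Units (Inv X R)"
  moreover from this obtain w where "w \<in> words X" "m = \<mu> w"
    by (metis M.Units_closed imageE inv_class_carrier)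
  ultimately obtain p where "p \<in> prefix_words" and m: "m = \<mu> p" "m \<in> Units (Inv X R)"
    using right_unit_eq_prefix_word right_unit_if_unit by metis
  then obtain ps where ps: "p = concat ps"
    "\<And>p. p \<in> set ps \<Longrightarrow> \<exists>e. fst e \<in> J \<and> prefix p (piece u e)"
    unfolding prefix_words_def by auto
  have U: "\<mu> p \<in> Units (Inv X R)" if "p \<in> set ps" for p
    using unit_factors[of ps p] m ps that right_unit_piece_prefix by blast
  have min: "q = [] \<or> q = u j" if "prefix q (u j)" "j \<in> J" "\<mu> q \<in> Units (Inv X R)" for q j
    using assms that unfolding minimal_invertible_pieces_def represents_unit_def
    by (auto simp: strict_prefix_def)
  have "q = [] \<or> (\<exists>e. fst e \<in> J \<and> q = piece u e)"
    if "fst e \<in> J" "prefix q (piece u e)" "\<mu> q \<in> Units (Inv X R)" for q e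
  proof (cases "snd e")
    case True
    then show ?thesis using min[of q "fst e"] that by (auto simp: piece_def)
  next
    case False
    \<comment> \<open>Minimality speaks of prefixes of the piece itself, so for an inverse piece it
      is applied to the complement: \<open>inv_word a\<close> is a prefix of the piece, and it is a
      unit because \<open>q\<close> is one.\<close>
    with that(2) obtain a where a: "inv_word (u (fst e)) = q @ a"
      by (auto simp: piece_def prefix_def)
    then have a': "u (fst e) = inv_word a @ inv_word q"
      by (metis inv_word_append inv_word_inv_word)
    have w: "a \<in> words X" "q \<in> words X" using u_words[OF that(1)] a' by auto
    have "\<mu> (inv_word a @ inv_word q) \<in> Units (Inv X R)"
      using u_unit[OF that(1)] by (simp add: represents_unit_def a')
    moreover have "\<mu> (inv_word a) = \<mu> (inv_word a @ inv_word q) \<otimes>\<^bsub>Inv X R\<^esub> \<mu> q"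
      using w right_unit_if_unit[OF _ inv_word_unit[OF w(2) that(3)]]
      by (simp add: inv_class_append M.m_assoc right_unit_def)
    ultimately have "\<mu> (inv_word a) \<in> Units (Inv X R)"
      using that(3) by (metis M.Units_m_closed)
    then have "inv_word a = [] \<or> inv_word a = u (fst e)"
      using min[of "inv_word a" "fst e"] a' that(1) by auto
    then have "q = [] \<or> q = piece u e"
      using a a' False by (auto simp: piece_def inv_word_def)
    then show ?thesis using that(1) by blast
  qed
  then have *: "q = [] \<or> (\<exists>e. fst e \<in> J \<and> q = piece u e)" if "q \<in> set ps" for q
    using ps(2)[OF that] U[OF that] by blast
  have "\<exists>\<rho>\<in>words J. concat ps = subst_word u \<rho>"
    using *
  proof (induction ps)
    case (Cons q ps)
    then obtain \<rho> where \<rho>: "\<rho> \<in> words J" "concat ps = subst_word u \<rho>" by auto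
    consider "q = []" | e where "fst e \<in> J" "q = piece u e" using Cons.prems[of q] by auto
    then show ?case
    proof cases
      case 2
      then show ?thesis using \<rho> by (intro bexI[of _ "e # \<rho>"]) auto
    qed (use \<rho> in auto)
  qed (auto intro: bexI[of _ "[]"])
  then show "m \<in> (\<lambda>\<rho>. \<mu> (subst_word u \<rho>)) ` words J"
    using m(1) ps(1) by auto
next
  fix \<rho> assume "\<rho> \<in> words J"
  then show "\<mu> (subst_word u \<rho>) \<in> Units (Inv X R)"
    using piece_unit by (induction \<rho>) (auto simp: \<mu>_Nil inv_class_append)
qed

text \<open>All units have domain idempotent 1, so E-unitarity embeds the group of units into the
  maximal group image, where it becomes the subgroup generated by the pieces.\<close>

lemma units_eq_iff:
  assumes "\<rho> \<in> words J" "\<sigma> \<in> words J"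
  shows "word_value (units_of (Inv X R)) (\<lambda>j. \<mu> (u j)) \<rho> = word_value (units_of (Inv X R)) (\<lambda>j. \<mu> (u j)) \<sigma>
      \<longleftrightarrow> \<mu> (subst_word u \<rho>) = \<mu> (subst_word u \<sigma>)" (is ?A)
    and "\<mu> (subst_word u \<rho>) = \<mu> (subst_word u \<sigma>) \<longleftrightarrow> \<gamma> (subst_word u \<rho>) = \<gamma> (subst_word u \<sigma>)" (is ?B)
proof -
  show ?A using word_value_units[of J u X R, OF u_words u_unit] assms by simp
  have unit: "right_unit (subst_word u \<rho>)" if "\<rho> \<in> words J" for \<rho>
  proof -
    have "\<mu> (subst_word u \<rho>) \<in> Units (Inv X R)"
      using that piece_unit by (induction \<rho>) (auto simp: \<mu>_Nil inv_class_append)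
    then show ?thesis using that by (intro right_unit_if_unit) auto
  qed
  show ?B
  proof
    show "\<gamma> (subst_word u \<rho>) = \<gamma> (subst_word u \<sigma>)" if "\<mu> (subst_word u \<rho>) = \<mu> (subst_word u \<sigma>)"
      using \<gamma>_eq_if_\<mu>_eq[OF _ _ that] assms by simp
    show "\<mu> (subst_word u \<rho>) = \<mu> (subst_word u \<sigma>)" if "\<gamma> (subst_word u \<rho>) = \<gamma> (subst_word u \<sigma>)"
    proof (rule \<mu>_eqI[OF E_unitary])
      show "\<mu> (subst_word u \<rho> @ inv_word (subst_word u \<rho>)) = \<mu> (subst_word u \<sigma> @ inv_word (subst_word u \<sigma>))"
        using unit[OF assms(1)] unit[OF assms(2)] unfolding right_unit_def by metis
    qed (use assms that in simp_all)
  qed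
qed

end


section \<open>The free factor and its complement\<close>

text \<open>A token list is a normal form in the free product of the free group and a subgroup of the
  maximal group image, with the last syllable at the head. The free syllables are kept as single
  letters.\<close>

type_synonym ('x, 'g) tokens = "('x \<times> bool + 'g) list"

section \<open>Multiplication of normal forms in a free product\<close>

context presentation
begin

text \<open>Van der Waerden's method: the factors act on normal forms by right multiplication, and
  uniqueness of normal forms comes from this action instead of from a confluence argument.\<close>

fun mul_group :: "'a word set \<Rightarrow> ('a, 'a word set) tokens \<Rightarrow> ('a, 'a word set) tokens" where
  "mul_group g (Inr h # N) = (if h \<otimes>\<^bsub>Gp X R\<^esub> g = \<one>\<^bsub>Gp X R\<^esub> then N else Inr (h \<otimes>\<^bsub>Gp X R\<^esub> g) # N)"
| "mul_group g N = (if g = \<one>\<^bsub>Gp X R\<^esub> then N else Inr g # N)"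

fun mul_letter :: "'a \<times> bool \<Rightarrow> ('a, 'a word set) tokens \<Rightarrow> ('a, 'a word set) tokens" where
  "mul_letter y (Inl z # N) = (if z = flip y then N else Inl y # Inl z # N)"
| "mul_letter y N = Inl y # N"

fun normal :: "('a, 'a word set) tokens \<Rightarrow> bool" where
  "normal [] \<longleftrightarrow> True"
| "normal (Inl y # N) \<longleftrightarrow> normal N \<and> fst y \<in> X \<and> (\<forall>N'. N \<noteq> Inl (flip y) # N')"
| "normal (Inr h # N) \<longleftrightarrow> normal N \<and> h \<in> carrier (Gp X R) \<and> h \<noteq> \<one>\<^bsub>Gp X R\<^esub> \<and> (\<forall>h' N'. N \<noteq> Inr h' # N')"

fun tokens_value :: "('a, 'a word set) tokens \<Rightarrow> 'a word set" where
  "tokens_value [] = \<one>\<^bsub>Gp X R\<^esub>"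
| "tokens_value (Inl y # N) = tokens_value N \<otimes>\<^bsub>Gp X R\<^esub> \<gamma> [y]"
| "tokens_value (Inr h # N) = tokens_value N \<otimes>\<^bsub>Gp X R\<^esub> h"

lemma normal_tl: "normal (t # N) \<Longrightarrow> normal N"
  by (cases t) auto

lemma normal_mul_group: "normal N \<Longrightarrow> g \<in> carrier (Gp X R) \<Longrightarrow> normal (mul_group g N)"
  by (cases "(g, N)" rule: mul_group.cases) auto

lemma normal_mul_letter: "normal N \<Longrightarrow> fst y \<in> X \<Longrightarrow> normal (mul_letter y N)"
  by (cases "(y, N)" rule: mul_letter.cases) auto

lemma mul_letter_flip:
  assumes "normal N"
  shows "mul_letter (flip y) (mul_letter y N) = N"
proof (cases "\<exists>N'. N = Inl (flip y) # N'")
  case True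
  then obtain N' where N: "N = Inl (flip y) # N'" by blast
  then have "\<forall>N''. N' \<noteq> Inl y # N''" using assms by simp
  then have "mul_letter (flip y) N' = Inl (flip y) # N'"
    by (cases "(flip y, N')" rule: mul_letter.cases) auto
  then show ?thesis by (simp add: N)
next
  case False
  then have "mul_letter y N = Inl y # N"
    by (cases "(y, N)" rule: mul_letter.cases) auto
  then show ?thesis by simp
qed

lemma mul_group_mul_group:
  assumes "normal N" "g \<in> carrier (Gp X R)" "h \<in> carrier (Gp X R)"
  shows "mul_group g (mul_group h N) = mul_group (h \<otimes>\<^bsub>Gp X R\<^esub> g) N"
proof (cases "\<exists>k N'. N = Inr k # N'")
  case True
  then obtain k N' where N: "N = Inr k # N'" by blast
  have N': "mul_group f N' = (if f = \<one>\<^bsub>Gp X R\<^esub> then N' else Inr f # N')" for f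
    using assms(1) N by (cases "(f, N')" rule: mul_group.cases) auto
  have "k \<otimes>\<^bsub>Gp X R\<^esub> (h \<otimes>\<^bsub>Gp X R\<^esub> g) = (k \<otimes>\<^bsub>Gp X R\<^esub> h) \<otimes>\<^bsub>Gp X R\<^esub> g"
    using assms N by (simp add: G.m_assoc)
  then show ?thesis using assms by (auto simp: N N')
next
  case False
  then have N: "mul_group f N = (if f = \<one>\<^bsub>Gp X R\<^esub> then N else Inr f # N)" for f
    by (cases "(f, N)" rule: mul_group.cases) auto
  show ?thesis using assms by (auto simp: N)
qed

lemma mul_group_one: "normal N \<Longrightarrow> mul_group \<one>\<^bsub>Gp X R\<^esub> N = N"
  by (cases "(\<one>\<^bsub>Gp X R\<^esub>, N)" rule: mul_group.cases) auto

lemma tokens_value_closed: "normal N \<Longrightarrow> tokens_value N \<in> carrier (Gp X R)"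
  by (induction N rule: tokens_value.induct) auto

lemma tokens_value_mul_group:
  assumes "normal N" "g \<in> carrier (Gp X R)"
  shows "tokens_value (mul_group g N) = tokens_value N \<otimes>\<^bsub>Gp X R\<^esub> g"
  using assms tokens_value_closed
  by (cases "(g, N)" rule: mul_group.cases) (auto simp: G.m_assoc dest: normal_tl)

lemma tokens_value_mul_letter:
  assumes "normal N" "fst y \<in> X"
  shows "tokens_value (mul_letter y N) = tokens_value N \<otimes>\<^bsub>Gp X R\<^esub> \<gamma> [y]"
proof (cases "\<exists>N'. N = Inl (flip y) # N'")
  case True
  then obtain N' where N: "N = Inl (flip y) # N'" by blast
  have "\<gamma> [flip y] \<otimes>\<^bsub>Gp X R\<^esub> \<gamma> [y] = \<one>\<^bsub>Gp X R\<^esub>"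
    using \<gamma>_cancel[of "[flip y]"] assms(2) by (simp add: gp_class_append[symmetric])
  then show ?thesis
    using assms tokens_value_closed[of N'] by (simp add: N G.m_assoc)
next
  case False
  then have "mul_letter y N = Inl y # N"
    by (cases "(y, N)" rule: mul_letter.cases) auto
  then show ?thesis by simp
qed

end

section \<open>Replacing the markers by the pieces as generators\<close>

locale marked_presentation = special_presentation X R J u
  for X :: "'a set" and R :: "('a word \<times> 'a word) set" and J :: "'j set" and u :: "'j \<Rightarrow> 'a word" +
  fixes marker :: "'j \<Rightarrow> 'a" and sgn :: "'j \<Rightarrow> bool" and left right :: "'j \<Rightarrow> 'a word"
  assumes finite_X: "finite X" and finite_J: "finite J"
    and u_eq: "j \<in> J \<Longrightarrow> u j = left j @ (marker j, sgn j) # right j"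
    and marker_inj: "inj_on marker J"
    and unmarked: "j \<in> J \<Longrightarrow> left j \<in> words (X - marker ` J)" "j \<in> J \<Longrightarrow> right j \<in> words (X - marker ` J)"
begin

lemma unmarked_words: "w \<in> words (X - marker ` J) \<Longrightarrow> w \<in> words X"
  by (induction w) auto

text \<open>The generators \<open>Inl x\<close>, for unmarked letters \<open>x\<close>, and \<open>Inr j\<close>, for the pieces, also
  generate the maximal group image; \<open>old\<close> and \<open>new\<close> translate between the two generating sets.\<close>

definition Y :: "('a + 'j) set" where
  "Y = Inl ` (X - marker ` J) \<union> Inr ` J"

definition old :: "('a + 'j) word \<Rightarrow> 'a word" where
  "old = subst_word (case_sum (\<lambda>x. [(x, True)]) u)"

definition relabel :: "'a word \<Rightarrow> ('a + 'j) word" where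
  "relabel = map (apfst Inl)"

text \<open>The equation for \<open>u j\<close> solved for its marked letter, taken with the sign
  \<open>sgn j\<close>.\<close>

definition new_marker :: "'j \<Rightarrow> ('a + 'j) word" where
  "new_marker j = inv_word (relabel (left j)) @ [(Inr j, True)] @ inv_word (relabel (right j))"

definition new_letter :: "'a \<Rightarrow> ('a + 'j) word" where
  "new_letter x = (if x \<in> marker ` J
     then let j = inv_into J marker x in if sgn j then new_marker j else inv_word (new_marker j)
     else [(Inl x, True)])"

definition new :: "'a word \<Rightarrow> ('a + 'j) word" where
  "new = subst_word new_letter"

lemma old_simps [simp]:
  "old [] = []"
  "old (v @ w) = old v @ old w"
  "old ((Inl x, b) # w) = (x, b) # old w"
  "old ((Inr j, b) # w) = piece u (j, b) @ old w"
  "old (inv_word w) = inv_word (old w)"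
  by (auto simp: old_def piece_def subst_word_inv_word)

lemma new_simps [simp]:
  "new [] = []"
  "new (v @ w) = new v @ new w"
  "new (y # w) = piece new_letter y @ new w"
  "new (inv_word w) = inv_word (new w)"
  by (auto simp: new_def subst_word_inv_word)

lemma relabel_simps [simp]:
  "relabel [] = []"
  "relabel (v @ w) = relabel v @ relabel w"
  "relabel (y # w) = (Inl (fst y), snd y) # relabel w"
  by (auto simp: relabel_def apfst_def map_prod_def split_beta)

lemma old_relabel [simp]: "old (relabel w) = w"
  by (induction w) auto

lemma Y_simps [simp]: "Inl x \<in> Y \<longleftrightarrow> x \<in> X - marker ` J" "Inr j \<in> Y \<longleftrightarrow> j \<in> J"
  by (auto simp: Y_def)

lemma relabel_words [simp]: "relabel w \<in> words Y \<longleftrightarrow> w \<in> words (X - marker ` J)"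
  by (induction w) auto

lemma old_words: "w \<in> words Y \<Longrightarrow> old w \<in> words X"
proof (induction w)
  case (Cons y w)
  obtain z b where y: "y = (z, b)" by (cases y)
  show ?case using Cons by (cases z) (auto simp: y)
qed simp

lemma new_marker_words: "j \<in> J \<Longrightarrow> new_marker j \<in> words Y"
  using unmarked by (simp add: new_marker_def)

lemma new_letter_marker:
  "j \<in> J \<Longrightarrow> new_letter (marker j) = (if sgn j then new_marker j else inv_word (new_marker j))"
  using marker_inj by (simp add: new_letter_def Let_def)

lemma piece_new_marker: "j \<in> J \<Longrightarrow> piece new_letter (marker j, sgn j) = new_marker j"
  by (simp add: new_letter_marker piece_def)

lemma new_letter_words: "x \<in> X \<Longrightarrow> new_letter x \<in> words Y"
  using new_marker_words new_letter_marker
  by (cases "x \<in> marker ` J") (auto simp: new_letter_def)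

lemma new_words [simp]: "w \<in> words X \<Longrightarrow> new w \<in> words Y"
  unfolding new_def using new_letter_words by (rule subst_word_in_words)

lemma new_unmarked: "w \<in> words (X - marker ` J) \<Longrightarrow> new w = relabel w"
proof (induction w)
  case (Cons y w)
  then have "fst y \<notin> marker ` J" by auto
  with Cons show ?case by (auto simp: piece_def new_letter_def)
qed simp

lemma new_u:
  "j \<in> J \<Longrightarrow> new (u j) = (relabel (left j) @ inv_word (relabel (left j))) @ [(Inr j, True)] @
     (inv_word (relabel (right j)) @ relabel (right j))"
  using u_eq unmarked new_unmarked by (simp add: piece_new_marker) (simp add: new_marker_def)

lemma \<gamma>_old_new_marker:
  assumes "j \<in> J"
  shows "\<gamma> (old (new_marker j)) = \<gamma> [(marker j, sgn j)]"
proof -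
  have w: "left j \<in> words X" "right j \<in> words X" "marker j \<in> X"
    using unmarked[OF assms] unmarked_words u_words[OF assms] u_eq[OF assms] by auto
  have "\<gamma> (old (new_marker j))
      = \<gamma> ((inv_word (left j) @ left j) @ [(marker j, sgn j)] @ right j @ inv_word (right j))"
    using assms by (simp add: new_marker_def piece_def u_eq)
  also have "\<dots> = \<gamma> [(marker j, sgn j)]"
    using \<gamma>_cancel[of "inv_word (left j)"] \<gamma>_cancel[of "right j"] w
    by (simp only: gp_class_append[of _ _ "inv_word (left j) @ left j"]
        gp_class_append[of _ _ "[(marker j, sgn j)]"]) simp
  finally show ?thesis .
qed

lemma \<gamma>_old_new: "w \<in> words X \<Longrightarrow> \<gamma> (old (new w)) = \<gamma> w"
proof (induction w)
  case (Cons y w)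
  have inv: "\<gamma> (old (inv_word z)) = inv\<^bsub>Gp X R\<^esub> (\<gamma> (old z))" if "z \<in> words Y" for z
    using that old_words \<gamma>_inv_word by simp
  have inv': "\<gamma> [flip y] = inv\<^bsub>Gp X R\<^esub> (\<gamma> [y])" if "fst y \<in> X" for y
    using \<gamma>_inv_word[of "[y]"] that by simp
  have "\<gamma> (old (new_letter x)) = \<gamma> [(x, True)]" if "x \<in> X" for x
  proof (cases "x \<in> marker ` J")
    case True
    then obtain j where j: "j \<in> J" "x = marker j" by blast
    then show ?thesis
      using \<gamma>_old_new_marker[OF j(1)] inv[OF new_marker_words[OF j(1)]] inv'[of "(x, False)"] that
      by (auto simp: new_letter_marker)
  qed (simp add: new_letter_def)
  then have "\<gamma> (old (piece new_letter y)) = \<gamma> [y]"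
    using inv[OF new_letter_words[of "fst y"]] inv'[of "(fst y, True)"] Cons.prems
    by (cases y) (auto simp: piece_def)
  then show ?case
    using Cons gp_class_append[of X R "[y]" w] by (simp add: gp_class_append[of _ _ "old _"])
qed simp

text \<open>The second free factor is taken inside \<open>Gp X R\<close> itself, so its
  multiplication is at hand and no presentation of it has to be found.\<close>

fun act :: "('a + 'j) \<times> bool \<Rightarrow> ('a, 'a word set) tokens \<Rightarrow> ('a, 'a word set) tokens" where
  "act (Inl x, b) N = mul_letter (x, b) N"
| "act (Inr j, b) N = mul_group (\<gamma> (piece u (j, b))) N"

lemma normal_act: "normal N \<Longrightarrow> fst y \<in> Y \<Longrightarrow> normal (act y N)"
  by (cases "(y, N)" rule: act.cases) (auto intro: normal_mul_group normal_mul_letter)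

lemma normal_run: "normal N \<Longrightarrow> z \<in> words Y \<Longrightarrow> normal (fold act z N)"
  by (induction z arbitrary: N) (auto simp: normal_act)

lemma act_flip:
  assumes "normal N" "fst y \<in> Y"
  shows "act (flip y) (act y N) = N"
proof (cases "fst y")
  case (Inl x)
  then show ?thesis
    using mul_letter_flip[of N "(x, snd y)"] assms by (cases y) simp
next
  case (Inr j)
  let ?w = "piece u (j, snd y)"
  have "?w \<in> words X" using assms(2) Inr by simp
  then have "\<gamma> ?w \<otimes>\<^bsub>Gp X R\<^esub> \<gamma> (inv_word ?w) = \<one>\<^bsub>Gp X R\<^esub>"
    using \<gamma>_cancel gp_class_append by metis
  then show ?thesis
    using assms Inr piece_flip[of u "(j, snd y)"]
    by (cases y) (simp add: mul_group_mul_group mul_group_one)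
qed

lemma run_cancel:
  assumes "normal N" "z \<in> words Y"
  shows "fold act (inv_word z) (fold act z N) = N"
  using assms
  by (induction z arbitrary: N) (auto simp: inv_word_Cons normal_act act_flip)

lemma run_cancel':
  assumes "normal N" "z \<in> words Y"
  shows "fold act z (fold act (inv_word z) N) = N"
  using run_cancel[of N "inv_word z"] assms by simp

text \<open>In the translation of a piece the unmarked words around \<open>Inr j\<close> are met by
  their own inverses, and inverse words act inversely. What remains is the action of the one
  generator \<open>Inr j\<close>.\<close>

lemma run_piece:
  assumes "normal N" "fst e \<in> J"
  shows "fold act (new (piece u e)) N = mul_group (\<gamma> (piece u e)) N"
proof -
  obtain j b where e: "e = (j, b)" by (cases e)
  have j: "j \<in> J" using assms e by simp
  have w: "relabel (left j) \<in> words Y" "relabel (right j) \<in> words Y" using unmarked[OF j] by auto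
  have n: "normal (mul_group (\<gamma> (piece u e)) N)"
    using assms by (intro normal_mul_group) auto
  show ?thesis
  proof (cases b)
    case True
    then have "fold act (new (piece u e)) N = fold act (new (u j)) N" by (simp add: e piece_def)
    also have "\<dots> = act (Inr j, True) N"
      using run_cancel[OF assms(1) w(1)] run_cancel'[OF n w(2)] True by (simp add: e new_u[OF j])
    finally show ?thesis using True by (simp add: e)
  next
    case False
    then have "fold act (new (piece u e)) N = fold act (inv_word (new (u j))) N"
      by (simp add: e piece_def)
    also have "\<dots> = fold act ((inv_word (relabel (right j)) @ relabel (right j)) @ [(Inr j, False)] @
        (relabel (left j) @ inv_word (relabel (left j)))) N"
      by (simp add: new_u[OF j] inv_word_Cons)
    also have "\<dots> = act (Inr j, False) N"
      using run_cancel'[OF assms(1) w(2)] run_cancel[OF n w(1)] False by (simp add: e)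
    finally show ?thesis using False by (simp add: e)
  qed
qed

lemma run_pieces:
  assumes "normal N" "\<rho> \<in> words J"
  shows "fold act (new (subst_word u \<rho>)) N = mul_group (\<gamma> (subst_word u \<rho>)) N"
  using assms
proof (induction \<rho> arbitrary: N)
  case Nil
  then show ?case by (simp add: \<gamma>_Nil mul_group_one)
next
  case (Cons e \<rho>)
  then have "normal (mul_group (\<gamma> (piece u e)) N)" by (intro normal_mul_group) auto
  with Cons show ?case
    by (simp add: run_piece mul_group_mul_group gp_class_append)
qed

text \<open>Inverse letters undo each other. A relator is a product of pieces and hence acts as
  multiplication by its image in the group, which is 1. The action is thus one of
  \<open>Gp X R\<close>.\<close>

lemma run_new_cong:
  assumes "(v, w) \<in> gp_congr X R" "normal N"
  shows "fold act (new v) N = fold act (new w) N"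
  using assms unfolding gp_congr_def
proof (induction arbitrary: N rule: congr.induct)
  case (step v w p q)
  have N: "normal (fold act (new p) N)" using step by (intro normal_run) auto
  have "fold act (new v) N = fold act (new w) N" if "normal N" for N
    using step(1)
  proof
    assume "(v, w) \<in> free_group_rels X"
    then obtain x b where "v = [(x, b)] @ inv_word [(x, b)]" "w = []" "x \<in> X"
      by (auto simp: free_group_rels_def)
    moreover from this have "new [(x, b)] \<in> words Y" by (intro new_words) simp
    ultimately show ?thesis
      using run_cancel[OF that, of "new [(x, b)]"]
      by (simp only: new_simps(1,2,4) fold_append comp_apply fold_simps id_apply)
  next
    assume vw: "(v, w) \<in> R"
    then obtain \<rho> where \<rho>: "\<rho> \<in> words J" "v = subst_word u \<rho>" "w = []" using R_pieces by blast
    have "(v, w) \<in> gp_congr X R"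
      unfolding gp_congr_def using vw \<rho> by (intro congr_rel) auto
    then have "\<gamma> v = \<one>\<^bsub>Gp X R\<^esub>"
      using gp_class_eq[of v X w R] \<rho> by (simp add: \<gamma>_Nil)
    then show ?thesis using run_pieces[OF that \<rho>(1)] mul_group_one[OF that] by (simp add: \<rho>)
  qed
  from this[OF N] show ?case by simp
qed auto

lemma run_new_\<gamma>:
  "v \<in> words X \<Longrightarrow> w \<in> words X \<Longrightarrow> \<gamma> v = \<gamma> w \<Longrightarrow> normal N \<Longrightarrow> fold act (new v) N = fold act (new w) N"
  using run_new_cong gp_class_eq by blast

lemma run_new_old:
  "z \<in> words Y \<Longrightarrow> normal N \<Longrightarrow> fold act (new (old z)) N = fold act z N"
proof (induction z arbitrary: N)
  case (Cons y z)
  obtain s b where y: "y = (s, b)" by (cases y)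
  have n: "normal (act y N)" using Cons.prems normal_act by simp
  show ?case
  proof (cases s)
    case (Inl x)
    then have "piece new_letter (x, b) = [y]"
      using Cons.prems by (auto simp: y piece_def new_letter_def)
    then show ?thesis using Cons n Inl by (simp add: y)
  next
    case (Inr j)
    then show ?thesis using Cons n run_piece[of N "(j, b)"] by (simp add: y)
  qed
qed simp

lemma tokens_value_run:
  "normal N \<Longrightarrow> z \<in> words Y \<Longrightarrow> tokens_value (fold act z N) = tokens_value N \<otimes>\<^bsub>Gp X R\<^esub> \<gamma> (old z)"
proof (induction z arbitrary: N)
  case Nil
  then show ?case by (simp add: \<gamma>_Nil tokens_value_closed)
next
  case (Cons y z)
  obtain s b where y: "y = (s, b)" by (cases y)
  have n: "normal (act y N)" using Cons.prems normal_act by simp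
  have z: "old z \<in> words X" using Cons.prems old_words by simp
  have c: "tokens_value N \<in> carrier (Gp X R)" using Cons.prems tokens_value_closed by simp
  show ?case
  proof (cases s)
    case (Inl x)
    then show ?thesis
      using Cons n z c gp_class_append[of X R "[(x, b)]" "old z"]
      by (simp add: y tokens_value_mul_letter G.m_assoc)
  next
    case (Inr j)
    then show ?thesis
      using Cons n z c by (simp add: y tokens_value_mul_group G.m_assoc gp_class_append)
  qed
qed

definition normal_form :: "'a word \<Rightarrow> ('a, 'a word set) tokens" where
  "normal_form w = fold act (new w) []"

lemma normal_form_value: "w \<in> words X \<Longrightarrow> tokens_value (normal_form w) = \<gamma> w"
  using tokens_value_run[of "[]" "new w"] \<gamma>_old_new[of w] by (simp add: normal_form_def)

text \<open>The action depends only on the group element, so a trivial word has the normal form of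
  the empty word; conversely the value of the normal form recovers the element.\<close>

theorem \<gamma>_eq_one_iff:
  assumes "w \<in> words X"
  shows "\<gamma> w = \<one>\<^bsub>Gp X R\<^esub> \<longleftrightarrow> normal_form w = []"
proof
  assume "\<gamma> w = \<one>\<^bsub>Gp X R\<^esub>"
  then have "\<gamma> w = \<gamma> []" by (simp only: \<gamma>_Nil)
  from run_new_\<gamma>[OF assms _ this, of "[]"] show "normal_form w = []"
    by (simp add: normal_form_def)
next
  assume "normal_form w = []"
  then show "\<gamma> w = \<one>\<^bsub>Gp X R\<^esub>" using normal_form_value[OF assms] by simp
qed


section \<open>Prefixes of pieces\<close>

text \<open>The parts of the pieces, and of their inverses, that precede the marker.\<close>

definition syllables :: "'a word set" where
  "syllables = left ` J \<union> inv_word ` right ` J"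

text \<open>Following Benois, an automaton with states the suffixes of syllables (the part still to be
  read), which accepts products of pieces and prefixes of syllables.\<close>

inductive reach :: "'a word \<Rightarrow> ('a + 'j) word \<Rightarrow> 'a word \<Rightarrow> bool" where
  refl: "reach p [] p"
| trans: "reach p z q \<Longrightarrow> reach q z' r \<Longrightarrow> reach p (z @ z') r"
| letter: "reach (y # s) [(Inl (fst y), snd y)] s"
| stop: "reach s [] []"
| start: "w \<in> syllables \<Longrightarrow> reach [] [] w"
| piece: "j \<in> J \<Longrightarrow> reach [] [(Inr j, b)] []"

text \<open>The shortcuts of Benois' saturation: transitions along words that are trivial in the
  group. They let the automaton skip what has been cancelled in a normal form.\<close>

definition reach_one :: "'a word \<Rightarrow> 'a word \<Rightarrow> bool" where
  "reach_one p q \<longleftrightarrow> (\<exists>z. reach p z q \<and> \<gamma> (old z) = \<one>\<^bsub>Gp X R\<^esub>)"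

lemma reach_one_trans: "reach_one p q \<Longrightarrow> reach_one q r \<Longrightarrow> reach_one p r"
  unfolding reach_one_def
  by (metis G.l_one G.one_closed gp_class_append old_simps(2) reach.trans)

lemma reach_one_Nil: "reach p [] q \<Longrightarrow> reach_one p q"
  unfolding reach_one_def by (rule exI[of _ "[]"]) (simp add: \<gamma>_Nil)

text \<open>Pieces are loops at the state \<open>[]\<close>, so a token of the group factor is read
  there and its value does not matter.\<close>

fun token_step :: "'a \<times> bool + 'g \<Rightarrow> 'a word set \<Rightarrow> 'a word set" where
  "token_step (Inl y) C = {q. \<exists>s. y # s \<in> C \<and> reach_one s q}"
| "token_step (Inr h) C = (if [] \<in> C then {q. reach_one [] q} else {})"

text \<open>The first syllable stands at the end of the list, which is where \<open>foldr\<close>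
  begins.\<close>

definition states :: "('a, 'g) tokens \<Rightarrow> 'a word set" where
  "states N = foldr token_step N {q. reach_one [] q}"

lemma states_simps [simp]:
  "states [] = {q. reach_one [] q}"
  "states (t # N) = token_step t (states N)"
  by (simp_all add: states_def)

lemma states_reach_one:
  assumes "p \<in> states N" "reach_one p q"
  shows "q \<in> states N"
proof (cases N)
  case Nil
  then show ?thesis using assms reach_one_trans[of "[]" p q] by simp
next
  case (Cons t N')
  then show ?thesis
    using assms reach_one_trans[OF _ assms(2)] by (cases t) (auto split: if_splits)
qed

lemma states_mul_group:
  assumes "[] \<in> states N"
  shows "[] \<in> states (mul_group h N)"
proof -
  have "reach_one [] []" using reach.refl reach_one_Nil by blast
  then show ?thesis using assms
    by (cases "(h, N)" rule: mul_group.cases) (auto split: if_splits)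
qed

text \<open>If \<open>y\<close> cancels the head, the automaton has read \<open>flip y\<close>, then
  a trivial word, and now \<open>y\<close>. The whole of this is trivial in the group, hence a
  shortcut that is available already before the head was read.\<close>

lemma states_mul_letter:
  assumes "normal N" "y # s \<in> states N"
  shows "s \<in> states (mul_letter y N)"
proof (cases "\<exists>N'. N = Inl (flip y) # N'")
  case True
  then obtain N' where N: "N = Inl (flip y) # N'" by blast
  then obtain t z where t: "flip y # t \<in> states N'" "reach t z (y # s)" "\<gamma> (old z) = \<one>\<^bsub>Gp X R\<^esub>"
    using assms(2) by (auto simp: reach_one_def)
  have "reach (flip y # t) ([(Inl (fst y), \<not> snd y)] @ z @ [(Inl (fst y), snd y)]) s"
    using reach.trans[OF reach.letter[of "flip y" t] reach.trans[OF t(2) reach.letter]]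
    by (simp add: flip_def)
  moreover have "\<gamma> (old ([(Inl (fst y), \<not> snd y)] @ z @ [(Inl (fst y), snd y)])) = \<one>\<^bsub>Gp X R\<^esub>"
  proof -
    have "\<gamma> ([flip y] @ old z @ [y]) = \<gamma> ([flip y] @ [] @ [y])"
      using t(3) by (intro \<gamma>_context) (simp add: \<gamma>_Nil)
    also have "\<dots> = \<one>\<^bsub>Gp X R\<^esub>" using \<gamma>_cancel[of "[flip y]"] assms(1) N by simp
    finally show ?thesis by (simp add: flip_def)
  qed
  ultimately have "reach_one (flip y # t) s" unfolding reach_one_def by blast
  from states_reach_one[OF t(1) this] show ?thesis by (simp add: N)
next
  case False
  then have "mul_letter y N = Inl y # N"
    by (cases "(y, N)" rule: mul_letter.cases) auto
  then show ?thesis using assms(2) reach.refl reach_one_Nil by auto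
qed

text \<open>The normal form is updated along with each transition. The delicate case, a letter that
  cancels, is \<open>states_mul_letter\<close>.\<close>

lemma states_run:
  "reach p z q \<Longrightarrow> normal N \<Longrightarrow> z \<in> words Y \<Longrightarrow> p \<in> states N \<Longrightarrow> q \<in> states (fold act z N)"
proof (induction arbitrary: N rule: reach.induct)
  case (trans p z q z' r)
  then show ?case using normal_run by simp
next
  case (letter y s)
  then show ?case using states_mul_letter[of N y s] by (cases y) simp
next
  case (stop s)
  then show ?case using states_reach_one[OF _ reach_one_Nil[OF reach.stop]] by simp
next
  case (start w)
  then show ?case using states_reach_one[OF _ reach_one_Nil[OF reach.start]] by simp
next
  case (piece j b)
  then show ?case using states_mul_group by simp
qed simp

definition piece_group :: "'a word set set" where
  "piece_group = (\<lambda>\<rho>. \<gamma> (subst_word u \<rho>)) ` words J"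

lemma piece_group_closed:
  assumes "g \<in> piece_group" "h \<in> piece_group"
  shows "g \<otimes>\<^bsub>Gp X R\<^esub> h \<in> piece_group"
proof -
  obtain \<rho> \<sigma> where "g = \<gamma> (subst_word u \<rho>)" "h = \<gamma> (subst_word u \<sigma>)" "\<rho> @ \<sigma> \<in> words J"
    using assms unfolding piece_group_def by auto
  then show ?thesis
    unfolding piece_group_def by (intro image_eqI[of _ _ "\<rho> @ \<sigma>"]) (simp_all add: gp_class_append)
qed

lemma piece_in_piece_group: "fst e \<in> J \<Longrightarrow> \<gamma> (piece u e) \<in> piece_group"
  unfolding piece_group_def by (rule image_eqI[of _ _ "[e]"]) auto

text \<open>The group tokens remain products of pieces, which allows \<open>states_sound\<close> to
  expand each of them into a run over single pieces.\<close>

lemma piece_tokens_act: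
  assumes "Inr ` UNIV \<inter> set N \<subseteq> Inr ` piece_group" "fst y \<in> Y"
  shows "Inr ` UNIV \<inter> set (act y N) \<subseteq> Inr ` piece_group"
proof (cases "(y, N)" rule: act.cases)
  case (1 x b N')
  then show ?thesis using assms(1)
    by (cases "((x, b), N)" rule: mul_letter.cases) auto
next
  case (2 j b N')
  then have "\<gamma> (piece u (j, b)) \<in> piece_group" using assms(2) by (intro piece_in_piece_group) simp
  then show ?thesis using assms(1) 2 piece_group_closed
    by (cases "(\<gamma> (piece u (j, b)), N)" rule: mul_group.cases) (auto simp: image_iff)
qed

lemma piece_tokens_run:
  "z \<in> words Y \<Longrightarrow> Inr ` UNIV \<inter> set N \<subseteq> Inr ` piece_group \<Longrightarrow>
     Inr ` UNIV \<inter> set (fold act z N) \<subseteq> Inr ` piece_group"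
  by (induction z arbitrary: N) (use piece_tokens_act in auto)

lemma reach_pieces: "\<rho> \<in> words J \<Longrightarrow> \<exists>z. reach [] z [] \<and> old z = subst_word u \<rho>"
proof (induction \<rho>)
  case Nil
  show ?case using reach.refl by (intro exI[of _ "[]"]) simp
next
  case (Cons e \<rho>)
  then obtain z where z: "reach [] z []" "old z = subst_word u \<rho>" by auto
  have "reach [] [(Inr (fst e), snd e)] []" using Cons.prems by (intro reach.piece) simp
  from reach.trans[OF this z(1)] z(2) show ?case by fastforce
qed

text \<open>A run is rebuilt token by token: a letter is read as it stands, a group token becomes
  loops over pieces at \<open>[]\<close>, and shortcuts contribute the identity.\<close>

lemma states_sound:
  assumes "q \<in> states N" "Inr ` UNIV \<inter> set N \<subseteq> Inr ` piece_group"
  shows "\<exists>z. reach [] z q \<and> \<gamma> (old z) = tokens_value N"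
  using assms
proof (induction N arbitrary: q)
  case Nil
  then show ?case by (auto simp: reach_one_def)
next
  case (Cons t N)
  obtain s p z where z: "s \<in> states N" "reach s z p" "reach_one p q"
    "tokens_value (t # N) = tokens_value N \<otimes>\<^bsub>Gp X R\<^esub> \<gamma> (old z)"
  proof (cases t)
    case (Inl y)
    then obtain s where "y # s \<in> states N" "reach_one s q" using Cons.prems(1) by auto
    then show thesis using that[OF _ reach.letter, of y s] Inl by simp
  next
    case (Inr h)
    then obtain \<rho> where \<rho>: "\<rho> \<in> words J" "h = \<gamma> (subst_word u \<rho>)"
      using Cons.prems(2) by (auto simp: piece_group_def)
    obtain z where "reach [] z []" "old z = subst_word u \<rho>" using reach_pieces[OF \<rho>(1)] by blast
    then show thesis using that[of "[]" z "[]"] Inr \<rho>(2) Cons.prems(1) by (simp split: if_splits)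
  qed
  obtain z0 where z0: "reach [] z0 s" "\<gamma> (old z0) = tokens_value N"
    using Cons.IH[OF z(1)] Cons.prems(2) by auto
  obtain z1 where z1: "reach p z1 q" "\<gamma> (old z1) = \<one>\<^bsub>Gp X R\<^esub>"
    using z(3) unfolding reach_one_def by blast
  have "\<gamma> (old z0 @ old z @ old z1) = \<gamma> (old z0 @ old z @ [])"
    using \<gamma>_context[of "old z1" "[]" "old z0 @ old z" "[]"] z1(2) by (simp add: \<gamma>_Nil)
  then have "\<gamma> (old (z0 @ z @ z1)) = tokens_value (t # N)"
    using z(4) z0(2) by (simp add: gp_class_append)
  then show ?case using reach.trans[OF z0(1) reach.trans[OF z(2) z1(1)]] by blast
qed

lemma piece_split:
  assumes "fst e \<in> J"
  obtains c y d where "piece u e = c @ y # d" "c \<in> syllables" "inv_word d \<in> syllables"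
proof (cases "snd e")
  case True
  then show thesis using that[of "left (fst e)" _ "right (fst e)"] u_eq[OF assms] assms
    by (auto simp: piece_def syllables_def)
next
  case False
  then show thesis
    using that[of "inv_word (right (fst e))" "flip (marker (fst e), sgn (fst e))"
        "inv_word (left (fst e))"] u_eq[OF assms] assms
    by (auto simp: piece_def syllables_def inv_word_Cons)
qed

lemma syllable_prefix:
  assumes "w \<in> syllables" "prefix p w"
  shows "p \<in> prefix_words"
proof -
  consider j where "j \<in> J" "w = left j" | j where "j \<in> J" "w = inv_word (right j)"
    using assms(1) by (auto simp: syllables_def)
  then show ?thesis
  proof cases
    case 1
    then have "prefix p (piece u (j, True))" using assms(2) by (auto simp: piece_def u_eq)
    then show ?thesis using 1 prefix_words_prefix[of "(j, True)"] by simp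
  next
    case 2
    then have "prefix p (piece u (j, False))"
      using assms(2) by (auto simp: piece_def u_eq inv_word_Cons prefix_def)
    then show ?thesis using 2 prefix_words_prefix[of "(j, False)"] by simp
  qed
qed

text \<open>In the invariant \<open>p\<close> collects the finished prefixes, \<open>a\<close> is
  the part of the current syllable read so far, and the state is the part still to be read.
  Stopping, or starting anew, moves \<open>a\<close> into \<open>p\<close>.\<close>

lemma reach_sound:
  assumes "reach s z q" "p \<in> prefix_words" "a @ s \<in> insert [] syllables" "\<gamma> g = \<gamma> (p @ a)"
  shows "\<exists>p' a'. p' \<in> prefix_words \<and> a' @ q \<in> insert [] syllables \<and> \<gamma> (g @ old z) = \<gamma> (p' @ a')"
  using assms
proof (induction arbitrary: p a g rule: reach.induct)
  case (refl s)
  then show ?case by auto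
next
  case (trans s z q z' r)
  obtain p' a' where "p' \<in> prefix_words" "a' @ q \<in> insert [] syllables"
    "\<gamma> (g @ old z) = \<gamma> (p' @ a')"
    using trans.IH(1)[OF trans.prems] by blast
  from trans.IH(2)[OF this] show ?case by simp
next
  case (letter y s)
  then show ?case
    using \<gamma>_context[OF letter(3), of "[]" "[y]"]
    by (intro exI[of _ p] exI[of _ "a @ [y]"]) simp
next
  case (stop s)
  have "a \<in> prefix_words"
    using stop(2) syllable_prefix prefix_words_Nil by (auto simp: prefix_def)
  then show ?case
    using stop prefix_words_append by (intro exI[of _ "p @ a"] exI[of _ "[]"]) simp
next
  case (start w)
  have "a \<in> prefix_words"
    using start(3) syllable_prefix prefix_words_Nil by (auto simp: prefix_def)
  then show ?case
    using start prefix_words_append by (intro exI[of _ "p @ a"] exI[of _ "[]"]) simp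
next
  case (piece j b)
  have "a \<in> prefix_words"
    using piece(3) syllable_prefix prefix_words_Nil by (auto simp: prefix_def)
  moreover have "piece u (j, b) \<in> prefix_words"
    using prefix_words_prefix[of "(j, b)"] piece(1) by simp
  ultimately have "p @ a @ piece u (j, b) \<in> prefix_words"
    using piece(2) prefix_words_append by blast
  then show ?case
    using \<gamma>_context[OF piece(4), of "[]" "piece u (j, b)"]
    by (intro exI[of _ "p @ a @ piece u (j, b)"] exI[of _ "[]"]) simp
qed

lemma reach_relabel: "reach (v @ s) (relabel v) s"
proof (induction v)
  case Nil
  show ?case using reach.refl by simp
next
  case (Cons y v)
  from reach.trans[OF reach.letter this] show ?case by simp
qed

lemma reach_syllable_prefix:
  assumes "w \<in> syllables" "prefix v w"
  shows "reach [] (relabel v) []"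
proof -
  obtain s where w: "w = v @ s" using assms(2) by (auto simp: prefix_def)
  show ?thesis
    using reach.trans[OF reach.start[OF assms(1), unfolded w]
        reach.trans[OF reach_relabel[of v s] reach.stop]]
    by simp
qed

text \<open>A prefix that extends beyond the marker equals the whole piece followed by the inverse
  of the missing end, and this inverse is a prefix of a syllable.\<close>

lemma reach_piece_prefix:
  assumes "fst e \<in> J" "prefix p (piece u e)"
  shows "\<exists>z. reach [] z [] \<and> \<gamma> (old z) = \<gamma> p"
proof -
  obtain c y d where cyd: "piece u e = c @ y # d" "c \<in> syllables" "inv_word d \<in> syllables"
    using piece_split[OF assms(1)] .
  show ?thesis
  proof (cases "prefix p c")
    case True
    then show ?thesis using reach_syllable_prefix[OF cyd(2)] by (intro exI[of _ "relabel p"]) simp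
  next
    case False
    then obtain s where p: "p = c @ y # s" "prefix s d"
      using assms(2) unfolding cyd(1) by (auto simp: prefix_append prefix_Cons)
    then obtain t where d: "d = s @ t" by (auto simp: prefix_def)
    have "reach [] ([(Inr (fst e), snd e)] @ relabel (inv_word t)) []"
      using reach.trans[OF reach.piece reach_syllable_prefix[OF cyd(3)]] assms(1) d by simp
    moreover have "p \<in> words X" "t \<in> words X"
      using piece_words[OF assms(1)] unfolding cyd(1) by (auto simp: d p)
    then have "\<gamma> (piece u e @ inv_word t) = \<gamma> p"
      using \<gamma>_cancel_right[of p t] by (simp add: cyd(1) p(1) d)
    ultimately show ?thesis
      by (intro exI[of _ "[(Inr (fst e), snd e)] @ relabel (inv_word t)"]) simp
  qed
qed

lemma reach_prefix_words:
  assumes "p \<in> prefix_words"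
  shows "\<exists>z. reach [] z [] \<and> \<gamma> (old z) = \<gamma> p"
proof -
  have "\<exists>z. reach [] z [] \<and> \<gamma> (old z) = \<gamma> (concat ps)"
    if "ps \<in> lists {p. \<exists>e. fst e \<in> J \<and> prefix p (piece u e)}" for ps
    using that
  proof (induction ps)
    case Nil
    show ?case using reach.refl by (intro exI[of _ "[]"]) simp
  next
    case (Cons q ps)
    then obtain z z' where "reach [] z []" "\<gamma> (old z) = \<gamma> q" "reach [] z' []"
      "\<gamma> (old z') = \<gamma> (concat ps)"
      using reach_piece_prefix by blast
    then show ?case
      using reach.trans by (intro exI[of _ "z @ z'"]) (auto simp: gp_class_append)
  qed
  then show ?thesis using assms unfolding prefix_words_def by auto
qed

lemma reach_words:
  assumes "reach p z q" "p \<in> words (X - marker ` J)"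
  shows "z \<in> words Y \<and> q \<in> words (X - marker ` J)"
  using assms
proof (induction rule: reach.induct)
  case (start w)
  then show ?case using unmarked by (auto simp: syllables_def)
qed auto

text \<open>Forwards, an accepting run on an unreduced word survives its reduction to normal form.
  Backwards, the states are expanded to a run, and \<open>reach_sound\<close> reads off the
  factors.\<close>

theorem prefix_words_iff:
  assumes "w \<in> words X"
  shows "(\<exists>p\<in>prefix_words. \<gamma> w = \<gamma> p) \<longleftrightarrow> [] \<in> states (normal_form w)"
proof
  assume "\<exists>p\<in>prefix_words. \<gamma> w = \<gamma> p"
  then obtain z where z: "reach [] z []" "\<gamma> (old z) = \<gamma> w"
    using reach_prefix_words by metis
  have "z \<in> words Y" using reach_words[OF z(1)] by simp
  moreover have "reach_one [] []" using reach.refl reach_one_Nil by blast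
  ultimately have "[] \<in> states (fold act z [])"
    using states_run[OF z(1)] by simp
  moreover have "fold act z [] = normal_form w"
    using run_new_old[of z "[]"] \<open>z \<in> words Y\<close>
      run_new_\<gamma>[OF old_words[OF \<open>z \<in> words Y\<close>] assms z(2), of "[]"]
    by (simp add: normal_form_def)
  ultimately show "[] \<in> states (normal_form w)" by simp
next
  assume "[] \<in> states (normal_form w)"
  moreover have "Inr ` UNIV \<inter> set (normal_form w) \<subseteq> Inr ` piece_group"
    unfolding normal_form_def using assms by (intro piece_tokens_run) auto
  ultimately obtain z where z: "reach [] z []" "\<gamma> (old z) = \<gamma> w"
    using states_sound normal_form_value[OF assms] by metis
  then obtain p a where "p \<in> prefix_words" "a \<in> insert [] syllables" "\<gamma> w = \<gamma> (p @ a)"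
    using reach_sound[OF z(1) prefix_words_Nil, of "[]" "[]"] by auto
  moreover from this have "a \<in> prefix_words" using syllable_prefix[of a a] prefix_words_Nil by auto
  ultimately show "\<exists>p\<in>prefix_words. \<gamma> w = \<gamma> p" using prefix_words_append by blast
qed

lemma finite_syllable_suffixes: "finite {s. \<exists>w\<in>insert [] syllables. suffix s w}"
proof -
  have "{s. \<exists>w\<in>insert [] syllables. suffix s w} = (\<Union>w\<in>insert [] syllables. {s. suffix s w})"
    by auto
  moreover have "finite {s. suffix s w}" for w :: "'a word"
    by (simp flip: set_suffixes_eq)
  ultimately show ?thesis using finite_J by (simp add: syllables_def)
qed

lemma reach_suffixes:
  assumes "reach p z q" "\<exists>w\<in>insert [] syllables. suffix p w"
  shows "\<exists>w\<in>insert [] syllables. suffix q w"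
  using assms
proof (induction rule: reach.induct)
  case (letter y s)
  then show ?case by (auto dest: suffix_ConsD)
qed auto

lemma token_step_suffixes:
  assumes "C \<subseteq> {s. \<exists>w\<in>insert [] syllables. suffix s w}"
  shows "token_step t C \<subseteq> {s. \<exists>w\<in>insert [] syllables. suffix s w}"
proof (cases t)
  case (Inl y)
  have "\<exists>w\<in>insert [] syllables. suffix q w" if "y # s \<in> C" "reach s z q" for s z q
    using reach_suffixes[OF reach.trans[OF reach.letter that(2)]] that(1) assms by blast
  then show ?thesis by (auto simp: Inl reach_one_def)
next
  case (Inr h)
  have "\<exists>w\<in>insert [] syllables. suffix q w" if "reach [] z q" for z q
    using reach_suffixes[OF that] by blast
  then show ?thesis unfolding Inr token_step.simps reach_one_def by (simp split: if_split) blast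
qed

end


section \<open>Decision procedures\<close>

lemma computable_inv_word:
  assumes "finite A" "inj_on c A"
  shows "computable (word_rep c A) (word_rep c A) inv_word"
proof -
  have "computable (pair_rep (word_rep c A) (letter_rep c A)) (letter_rep c A) (\<lambda>p. flip (snd p))"
    by (rule computable_comp[OF computable_finite[OF finite_rep_letter[OF assms]] computable_proj1(2)])
      (auto simp: letter_rep_def)
  from computable_rev[OF computable_map[OF computable_id this]] show ?thesis
    by (rule computable_cong) (simp add: inv_word_def flip_def split_beta)
qed

lemma computable_subst_word:
  assumes "finite A" "inj_on c A" "\<And>x. x \<in> A \<Longrightarrow> u x \<in> words B"
  shows "computable (word_rep c A) (word_rep d B) (subst_word u)"
proof -
  have "computable (letter_rep c A) (word_rep d B) (piece u)"
    using piece_in_words[OF assms(3)]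
    by (intro computable_finite finite_rep_letter assms word_rep_ex) (auto simp: letter_rep_def)
  from computable_concat_map[OF computable_id computable_comp[OF this computable_proj1(2)]]
  show ?thesis
    by (rule computable_cong) (simp add: subst_word_def piece_def case_prod_unfold)
qed

context marked_presentation
begin

lemma finite_Y: "finite Y"
  using finite_X finite_J by (simp add: Y_def)

text \<open>Elements of the second factor are coded by words over \<open>J\<close>. Multiplication
  is then concatenation, and only the test for the identity draws on the word problem of the
  units.\<close>

definition group_rep :: "('j \<Rightarrow> nat) \<Rightarrow> 'a word set rep" where
  "group_rep d n g \<longleftrightarrow> (\<exists>\<rho>. word_rep d J n \<rho> \<and> g = \<gamma> (subst_word u \<rho>))"

abbreviation tokens_rep :: "('a \<Rightarrow> nat) \<Rightarrow> ('j \<Rightarrow> nat) \<Rightarrow> ('a, 'a word set) tokens rep" where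
  "tokens_rep c d \<equiv> list_rep (sum_rep (letter_rep c X) (group_rep d))"

lemma computable_group_mult:
  "computable (pair_rep (group_rep d) (group_rep d)) (group_rep d)
     (\<lambda>p. fst p \<otimes>\<^bsub>Gp X R\<^esub> snd p)"
proof -
  obtain f where f: "recursive1 f"
    "\<And>n p. pair_rep (word_rep d J) (word_rep d J) n p \<Longrightarrow> word_rep d J (f n) (fst p @ snd p)"
    using computable_append[OF computable_proj1(1,2)] unfolding computable_def by blast
  have "group_rep d (f n) (fst p \<otimes>\<^bsub>Gp X R\<^esub> snd p)"
    if "pair_rep (group_rep d) (group_rep d) n p" for n p
  proof -
    obtain \<rho> \<sigma> where *: "pair_rep (word_rep d J) (word_rep d J) n (\<rho>, \<sigma>)"
      "fst p = \<gamma> (subst_word u \<rho>)" "snd p = \<gamma> (subst_word u \<sigma>)"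
      using \<open>pair_rep (group_rep d) (group_rep d) n p\<close> unfolding pair_rep_def group_rep_def by auto
    show ?thesis
      unfolding group_rep_def using f(2)[OF *(1)] *(2,3)
      by (intro exI[of _ "\<rho> @ \<sigma>"]) (simp add: gp_class_append)
  qed
  then show ?thesis using f(1) unfolding computable_def by blast
qed

definition letter_group :: "('a + 'j) \<times> bool \<Rightarrow> 'a word set" where
  "letter_group y = (case fst y of Inl x \<Rightarrow> \<one>\<^bsub>Gp X R\<^esub> | Inr j \<Rightarrow> \<gamma> (piece u (j, snd y)))"

definition letter_tokens :: "('a + 'j) \<times> bool \<Rightarrow> ('a, 'a word set) tokens" where
  "letter_tokens y = act y []"

definition cancels :: "('a + 'j) \<times> bool \<Rightarrow> 'a \<times> bool \<Rightarrow> bool" where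
  "cancels y z \<longleftrightarrow> flip y = (Inl (fst z), snd z)"

text \<open>Puts the action into nested case distinctions covered by the closure lemmas; what
  depends on the letter alone is separated into functions on a finite set.\<close>

lemma act_eq:
  "act y N = (case N of [] \<Rightarrow> letter_tokens y | t # N' \<Rightarrow>
     (case t of
       Inl z \<Rightarrow> if cancels y z then N' else letter_tokens y @ N
     | Inr h \<Rightarrow> if isl (fst y) then letter_tokens y @ N
         else if h \<otimes>\<^bsub>Gp X R\<^esub> letter_group y = \<one>\<^bsub>Gp X R\<^esub> then N'
         else Inr (h \<otimes>\<^bsub>Gp X R\<^esub> letter_group y) # N'))"
proof -
  obtain s b where y: "y = (s, b)" by (cases y)
  show ?thesis
    by (cases s; cases N; cases "hd N")
       (auto simp: y letter_tokens_def letter_group_def cancels_def flip_def)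
qed

section \<open>Algorithms relative to a test for trivial products of pieces\<close>

context
  fixes c :: "'a \<Rightarrow> nat" and d :: "'j \<Rightarrow> nat" and e :: "'a + 'j \<Rightarrow> nat"
  assumes c: "inj_on c X" and d: "inj_on d J" and e: "inj_on e Y"
    and one: "computable (word_rep d J) bool_rep (\<lambda>\<rho>. \<gamma> (subst_word u \<rho>) = \<one>\<^bsub>Gp X R\<^esub>)"
begin

lemma computable_group_one: "computable (group_rep d) bool_rep (\<lambda>g. g = \<one>\<^bsub>Gp X R\<^esub>)"
  using one unfolding computable_def group_rep_def by blast

lemma group_rep_ex: "\<exists>n. group_rep d n \<one>\<^bsub>Gp X R\<^esub>" "fst a \<in> J \<Longrightarrow> \<exists>n. group_rep d n (\<gamma> (piece u a))"
proof -
  have *: "\<exists>n. group_rep d n (\<gamma> (subst_word u \<rho>))" if "\<rho> \<in> words J" for \<rho>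
    using word_rep_ex[OF that, of d] unfolding group_rep_def by blast
  show "\<exists>n. group_rep d n \<one>\<^bsub>Gp X R\<^esub>" using *[of "[]"] by (simp add: \<gamma>_Nil)
  show "fst a \<in> J \<Longrightarrow> \<exists>n. group_rep d n (\<gamma> (piece u a))" using *[of "[a]"] by simp
qed

lemma finite_rep_X: "finite_rep (letter_rep c X)"
  and finite_rep_Y: "finite_rep (letter_rep e Y)"
  using finite_rep_letter finite_X finite_Y c e by blast+

lemma computable_letter_tokens: "computable (letter_rep e Y) (tokens_rep c d) letter_tokens"
proof (rule computable_finite[OF finite_rep_Y])
  fix n y assume y: "letter_rep e Y n y"
  have "\<exists>n. sum_rep (letter_rep c X) (group_rep d) n t" if "t \<in> set (letter_tokens y)" for t
  proof (cases "fst y")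
    case (Inl x)
    then have "t = Inl (x, snd y)" "x \<in> X"
      using y that by (cases y; auto simp: letter_tokens_def letter_rep_def)+
    then show ?thesis by (simp add: sum_rep_ex(1) letter_rep_ex)
  next
    case (Inr j)
    then have "t = Inr (\<gamma> (piece u (j, snd y)))" "j \<in> J"
      using y that by (cases y; auto simp: letter_tokens_def letter_rep_def split: if_splits)+
    then show ?thesis by (simp add: sum_rep_ex(2) group_rep_ex)
  qed
  then show "\<exists>m. tokens_rep c d m (letter_tokens y)" by (rule list_rep_ex)
qed

lemma computable_letter_group: "computable (letter_rep e Y) (group_rep d) letter_group"
  by (rule computable_finite[OF finite_rep_Y])
     (auto simp: letter_group_def letter_rep_def group_rep_ex split: sum.split)

lemma computable_act:
  "computable (pair_rep (letter_rep e Y) (tokens_rep c d)) (tokens_rep c d)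
     (\<lambda>p. act (fst p) (snd p))"
proof -
  let ?L = "letter_rep e Y" and ?T = "sum_rep (letter_rep c X) (group_rep d)"
  let ?A = "pair_rep ?L (list_rep ?T)"
  let ?B = "pair_rep ?A (pair_rep ?T (list_rep ?T))"
  note letter_tokens = computable_comp[OF computable_letter_tokens]
  note letter_group = computable_comp[OF computable_letter_group]
  have "computable (pair_rep ?L (letter_rep c X)) bool_rep (\<lambda>p. cancels (fst p) (snd p))"
    by (intro computable_bool_finite finite_rep_pair finite_rep_X finite_rep_Y)
  note cancels = computable_comp_pair[OF this]
  have Inl: "computable (pair_rep ?B (letter_rep c X)) (list_rep ?T)
      (\<lambda>w. if cancels (fst (fst (fst w))) (snd w) then snd (snd (fst w))
        else letter_tokens (fst (fst (fst w))) @ snd (fst (fst w)))"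
    by (intro computable_if cancels computable_append letter_tokens computable_proj)
  have isl: "computable ?L bool_rep (\<lambda>y. isl (fst y))"
    by (intro computable_bool_finite finite_rep_Y)
  have mult: "computable (pair_rep ?B (group_rep d)) (group_rep d)
      (\<lambda>w. snd w \<otimes>\<^bsub>Gp X R\<^esub> letter_group (fst (fst (fst w))))"
    by (intro computable_comp_pair[OF computable_group_mult] letter_group computable_proj)
  have Inr: "computable (pair_rep ?B (group_rep d)) (list_rep ?T)
      (\<lambda>w. if isl (fst (fst (fst (fst w)))) then letter_tokens (fst (fst (fst w))) @ snd (fst (fst w))
        else if snd w \<otimes>\<^bsub>Gp X R\<^esub> letter_group (fst (fst (fst w))) = \<one>\<^bsub>Gp X R\<^esub> then snd (snd (fst w))
        else Inr (snd w \<otimes>\<^bsub>Gp X R\<^esub> letter_group (fst (fst (fst w)))) # snd (snd (fst w)))"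
    by (intro computable_if computable_append letter_tokens computable_proj computable_Cons
        computable_Inr mult computable_comp[OF computable_group_one mult]
        computable_comp[OF isl])
  have "computable ?B (list_rep ?T) (\<lambda>z. case fst (snd z) of
      Inl y \<Rightarrow> (\<lambda>w. if cancels (fst (fst (fst w))) (snd w) then snd (snd (fst w))
        else letter_tokens (fst (fst (fst w))) @ snd (fst (fst w))) (z, y)
    | Inr h \<Rightarrow> (\<lambda>w. if isl (fst (fst (fst (fst w)))) then letter_tokens (fst (fst (fst w))) @ snd (fst (fst w))
        else if snd w \<otimes>\<^bsub>Gp X R\<^esub> letter_group (fst (fst (fst w))) = \<one>\<^bsub>Gp X R\<^esub> then snd (snd (fst w))
        else Inr (snd w \<otimes>\<^bsub>Gp X R\<^esub> letter_group (fst (fst (fst w)))) # snd (snd (fst w))) (z, h))"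
    by (rule computable_case_sum[OF _ Inl Inr]) (rule computable_proj2)
  from computable_case_list[OF computable_proj1(2) letter_tokens[OF computable_proj1(1)] this]
  show ?thesis
    by (rule computable_cong) (simp add: act_eq split: list.split sum.split)
qed

lemma computable_normal_form: "computable (word_rep c X) (tokens_rep c d) normal_form"
proof -
  have "computable (word_rep c X) (word_rep e Y) new"
    unfolding new_def by (rule computable_subst_word[OF finite_X c new_letter_words])
  from computable_fold[OF this computable_Nil computable_comp[OF computable_act computable_proj1(2)]]
  show ?thesis by (rule computable_cong) (simp add: normal_form_def)
qed

lemma computable_\<gamma>_one: "computable (word_rep c X) bool_rep (\<lambda>w. \<gamma> w = \<one>\<^bsub>Gp X R\<^esub>)"
proof -
  have "computable (tokens_rep c d) bool_rep
      (\<lambda>N. case N of [] \<Rightarrow> True | t # N' \<Rightarrow> (\<lambda>_. False) (N, t, N'))"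
    by (intro computable_case_list[OF computable_id] computable_const[of bool_rep 1 True]
        computable_const[of bool_rep 0 False]) (simp_all add: bool_rep_def)
  from computable_comp[OF this computable_normal_form] show ?thesis
    by (rule computable_cong) (simp add: \<gamma>_eq_one_iff word_rep_iff split: list.split)
qed

lemma computable_\<gamma>_eq:
  "computable (pair_rep (word_rep c X) (word_rep c X)) bool_rep (\<lambda>p. \<gamma> (fst p) = \<gamma> (snd p))"
proof -
  have "computable (pair_rep (word_rep c X) (word_rep c X)) bool_rep
      (\<lambda>p. \<gamma> (fst p @ inv_word (snd p)) = \<one>\<^bsub>Gp X R\<^esub>)"
    by (intro computable_comp[OF computable_\<gamma>_one] computable_append computable_proj
        computable_comp[OF computable_inv_word[OF finite_X c]])
  then show ?thesis
    by (rule computable_cong)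
       (auto simp: pair_rep_def word_rep_iff gp_class_append \<gamma>_inv_word G.inv_solve_right')
qed

text \<open>There are finitely many state sets, so a step of the automaton is a finite table. In
  particular \<open>reach_one\<close> does not have to be computed.\<close>

lemma computable_prefix_words:
  "computable (word_rep c X) bool_rep (\<lambda>w. \<exists>p\<in>prefix_words. \<gamma> w = \<gamma> p)"
proof -
  let ?S = "Pow {s. \<exists>w\<in>insert [] syllables. suffix s w}"
  have fin: "finite ?S" using finite_syllable_suffixes by simp
  then obtain k :: "'a word set \<Rightarrow> nat" where k: "inj_on k ?S"
    using finite_imp_inj_to_nat_seg[OF fin] by blast
  define D where "D = (\<lambda>n C. C \<in> ?S \<and> n = k C)"
  have D: "finite_rep D"
    unfolding finite_rep_def
  proof
    have "{n. \<exists>C. D n C} = k ` ?S" by (auto simp: D_def)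
    then show "finite {n. \<exists>C. D n C}" using fin by simp
    show "\<forall>n C C'. D n C \<longrightarrow> D n C' \<longrightarrow> C = C'" using k by (auto simp: D_def dest: inj_onD)
  qed
  have ex: "\<exists>n. D n C" if "C \<subseteq> {s. \<exists>w\<in>insert [] syllables. suffix s w}" for C
    using that by (simp add: D_def)
  have init: "computable A D (\<lambda>_. {q. reach_one [] q})" for A :: "'b rep"
  proof -
    obtain m where "D m {q. reach_one [] q}"
      using ex[of "{q. reach_one [] q}"] reach_suffixes[of "[]"] unfolding reach_one_def by blast
    then show ?thesis by (rule computable_const)
  qed
  let ?T = "sum_rep (letter_rep c X) (group_rep d)"
  have "computable (pair_rep (letter_rep c X) D) D (\<lambda>p. token_step (Inl (fst p)) (snd p))"
  proof (intro computable_finite finite_rep_pair finite_rep_X D)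
    fix n p assume "pair_rep (letter_rep c X) D n p"
    then have "snd p \<subseteq> {s. \<exists>w\<in>insert [] syllables. suffix s w}"
      by (auto simp: pair_rep_def D_def)
    then show "\<exists>m. D m (token_step (Inl (fst p)) (snd p))"
      by (intro ex token_step_suffixes)
  qed
  note Inl = computable_comp_pair[OF this]
  \<comment> \<open>All group tokens act alike on state sets, so the identity stands for every
    \<open>h\<close>; the step becomes a function on a finite set although the tokens range over
    infinitely many codes.\<close>
  have "computable D D (token_step (Inr \<one>\<^bsub>Gp X R\<^esub>))"
  proof (intro computable_finite D)
    fix n C assume "D n C"
    then have "C \<subseteq> {s. \<exists>w\<in>insert [] syllables. suffix s w}" by (auto simp: D_def)
    then show "\<exists>m. D m (token_step (Inr \<one>\<^bsub>Gp X R\<^esub>) C)" by (intro ex token_step_suffixes)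
  qed
  note Inr = computable_comp[OF this]
  have "computable (pair_rep ?T D) D (\<lambda>p. case fst p of
      Inl y \<Rightarrow> (\<lambda>w. token_step (Inl (snd w)) (snd (fst w))) (p, y)
    | Inr h \<Rightarrow> (\<lambda>w. token_step (Inr \<one>\<^bsub>Gp X R\<^esub>) (snd (fst w))) (p, h))"
    by (intro computable_case_sum[OF computable_proj1(1)] Inl Inr computable_proj)
  then have step: "computable (pair_rep ?T D) D (\<lambda>p. token_step (fst p) (snd p))"
    by (rule computable_cong) (auto split: sum.split)
  have "computable (list_rep ?T) D states"
    using computable_fold[OF computable_rev[OF computable_id] init computable_comp[OF step computable_proj1(2)]]
    by (rule computable_cong) (simp add: states_def foldr_conv_fold)
  from computable_comp[OF computable_bool_finite[OF D] computable_comp[OF this computable_normal_form]]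
  have "computable (word_rep c X) bool_rep (\<lambda>w. [] \<in> states (normal_form w))" .
  then show ?thesis
    by (rule computable_cong) (simp add: prefix_words_iff word_rep_iff)
qed

text \<open>Path edges are found by searching the factorisations of \<open>v\<close>. For piece
  edges there are finitely many choices of \<open>q\<close> and of the prefix
  \<open>a @ [y]\<close>; the remaining search for \<open>p\<close> asks whether
  \<open>q\<inverse> g a\<inverse>\<close> lies in the submonoid of prefixes, which the automaton
  decides.\<close>

lemma computable_edge:
  "computable (pair_rep (word_rep c X) (pair_rep (word_rep c X) (letter_rep c X))) bool_rep
     (\<lambda>p. edge (fst p) (fst (snd p)) (snd (snd p)))"
proof -
  let ?W = "word_rep c X" and ?L = "letter_rep c X"
  let ?A = "pair_rep ?W (pair_rep ?W ?L)"
  note \<gamma>_eq = computable_comp_pair[OF computable_\<gamma>_eq]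
  have "computable (pair_rep ?L ?L) bool_rep (\<lambda>p. fst p = snd p)"
    by (intro computable_bool_finite finite_rep_pair finite_rep_X)
  note letter_eq = computable_comp_pair[OF this]
  have "computable ?L ?L flip"
    by (intro computable_finite finite_rep_X) (auto simp: letter_rep_def)
  note flip = computable_comp[OF this]
  have path: "computable ?A bool_rep (\<lambda>p. \<exists>qz\<in>set (splits (fst p)).
      (\<lambda>w. snd (snd (fst w)) = snd (snd w) \<and> \<gamma> (fst (snd (fst w))) = \<gamma> (fst (snd w)) \<or>
        snd (snd (fst w)) = flip (snd (snd w)) \<and>
          \<gamma> (fst (snd (fst w))) = \<gamma> (fst (snd w) @ [snd (snd w)])) (p, qz))"
    by (intro computable_Bex[OF computable_splits[OF computable_proj1(1)]] computable_disj computable_conj letter_eq \<gamma>_eq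
        flip computable_append computable_Cons computable_Nil computable_proj)
  let ?E = "{(a, z). \<exists>e. fst e \<in> J \<and> prefix (a @ [z]) (piece u e)}"
  have sub: "?E \<subseteq> (\<lambda>p. (butlast p, last p)) ` (\<Union>e\<in>J \<times> UNIV. {p. prefix p (piece u e)})"
  proof safe
    fix a z j b assume "fst (j, b) \<in> J" "prefix (a @ [z]) (piece u (j, b))"
    then show "(a, z) \<in> (\<lambda>p. (butlast p, last p)) ` (\<Union>e\<in>J \<times> UNIV. {p. prefix p (piece u e)})"
      by (intro image_eqI[of _ _ "a @ [z]"]) auto
  qed
  have "finite {p. prefix p w}" for w :: "'a word"
    by (simp flip: set_prefixes_eq)
  then have "finite (\<Union>e\<in>J \<times> UNIV. {p. prefix p (piece u e)})"
    using finite_J by simp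
  then have "finite ?E" by (intro finite_subset[OF sub] finite_imageI)
  from finite_list[OF this] obtain E where E: "set E = ?E" ..
  have "\<exists>n. pair_rep ?W ?L n az" if az: "az \<in> set E" for az
  proof -
    obtain a z e where "az = (a, z)" "fst e \<in> J" "prefix (a @ [z]) (piece u e)"
      using az unfolding E by blast
    moreover have "a @ [z] \<in> words X"
      using piece_words[OF calculation(2)] calculation(3) unfolding prefix_def by auto
    ultimately show ?thesis by (auto intro!: pair_rep_ex word_rep_ex letter_rep_ex)
  qed
  from list_rep_ex[of E "pair_rep ?W ?L", OF this] obtain m where m: "list_rep (pair_rep ?W ?L) m E" by blast
  have pw: "computable (pair_rep (pair_rep ?A ?W) (pair_rep ?W ?L)) bool_rep
    (\<lambda>w. snd (snd w) = snd (snd (fst (fst w))) \<and>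
      (\<exists>p\<in>prefix_words. \<gamma> (inv_word (snd (fst w)) @ fst (snd (fst (fst w))) @ inv_word (fst (snd w))) = \<gamma> p))"
    by (intro computable_conj letter_eq computable_comp[OF computable_prefix_words]
        computable_append computable_comp[OF computable_inv_word[OF finite_X c]] computable_proj)
  \<comment> \<open>\<open>splits\<close> yields the proper prefixes only, so the whole word is
    added as a further choice of \<open>q\<close>.\<close>
  have "computable ?A (list_rep ?W) (\<lambda>p. fst p # map (\<lambda>qz. (\<lambda>w. fst (snd w)) (p, qz)) (splits (fst p)))"
    by (intro computable_Cons computable_map[OF computable_splits[OF computable_proj1(1)]]
        computable_proj)
  from computable_Bex[OF this computable_Bex[OF computable_const[of "list_rep (pair_rep ?W ?L)", OF m] pw]]
  have piece: "computable ?A bool_rep (\<lambda>p. \<exists>q\<in>insert (fst p) (fst ` set (splits (fst p))).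
      \<exists>az\<in>set E. snd az = snd (snd p) \<and>
        (\<exists>p'\<in>prefix_words. \<gamma> (inv_word q @ fst (snd p) @ inv_word (fst az)) = \<gamma> p'))"
    by (simp add: image_image)
  from computable_disj[OF path piece] show ?thesis
  proof (rule computable_cong)
    fix n p assume "?A n p"
    then obtain v g y where p: "p = (v, g, y)" "v \<in> words X" "g \<in> words X" "fst y \<in> X"
      by (cases p) (auto simp: pair_rep_def word_rep_iff letter_rep_def)
    have "path_edge v g y \<longleftrightarrow> (\<exists>(q, z)\<in>set (splits v). y = z \<and> \<gamma> g = \<gamma> q \<or> y = flip z \<and> \<gamma> g = \<gamma> (q @ [z]))"
      unfolding path_edge_def by (auto simp: set_splits Bex_def)
    moreover have "piece_edge v g y \<longleftrightarrow> (\<exists>q\<in>insert v (fst ` set (splits v)). \<exists>az\<in>set E. snd az = y \<and>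
        (\<exists>p'\<in>prefix_words. \<gamma> (inv_word q @ g @ inv_word (fst az)) = \<gamma> p'))" (is "_ \<longleftrightarrow> ?rhs")
    proof -
      have pre: "q \<in> insert v (fst ` set (splits v)) \<longleftrightarrow> (\<exists>s. v = q @ s)" for q
      proof
        assume "\<exists>s. v = q @ s"
        then obtain s where s: "v = q @ s" by blast
        show "q \<in> insert v (fst ` set (splits v))"
        proof (cases s)
          case (Cons z s')
          then have "(q, z) \<in> set (splits v)" using s by (simp add: set_splits)
          then show ?thesis by force
        qed (use s in simp)
      qed (auto simp: set_splits)
      have eq: "\<gamma> (inv_word q @ g @ inv_word a) = \<gamma> p' \<longleftrightarrow> \<gamma> g = \<gamma> (q @ p' @ a)"
        if "q \<in> words X" "a \<in> words X" "p' \<in> words X" for q a p'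
      proof
        assume *: "\<gamma> (inv_word q @ g @ inv_word a) = \<gamma> p'"
        have "\<gamma> g = \<gamma> (q @ inv_word q @ g @ inv_word a @ a)"
          using \<gamma>_cancel_left[of q "g @ inv_word a @ a"] \<gamma>_cancel_right[of g "inv_word a"] that p(3)
          by simp
        also have "\<dots> = \<gamma> (q @ p' @ a)" using \<gamma>_context[OF *, of q a] by simp
        finally show "\<gamma> g = \<gamma> (q @ p' @ a)" .
      next
        assume "\<gamma> g = \<gamma> (q @ p' @ a)"
        from \<gamma>_context[OF this, of "inv_word q" "inv_word a"]
        show "\<gamma> (inv_word q @ g @ inv_word a) = \<gamma> p'"
          using \<gamma>_cancel_left[of "inv_word q" "p' @ a @ inv_word a"] \<gamma>_cancel_right[of p' a] that
          by simp
      qed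
      have words: "a \<in> words X" if "(a, z) \<in> set E" for a z
        using that piece_words unfolding E by (auto simp: prefix_def) (metis fst_conv words_simps(2) piece_words)
      show ?thesis
      proof
        assume "piece_edge v g y"
        then obtain q s p' a e where *: "v = q @ s" "p' \<in> prefix_words" "fst e \<in> J"
          "prefix (a @ [y]) (piece u e)" "\<gamma> g = \<gamma> (q @ p' @ a)"
          unfolding piece_edge_def by blast
        have "(a, y) \<in> set E" using *(3,4) unfolding E by blast
        then have "a \<in> words X" by (rule words)
        with *(1,2) p(2) have w: "q \<in> words X" "a \<in> words X" "p' \<in> words X"
          by (simp_all add: prefix_words_in_words)
        have "\<exists>p'\<in>prefix_words. \<gamma> (inv_word q @ g @ inv_word a) = \<gamma> p'"
          by (intro bexI[of _ p'] iffD2[OF eq[OF w] *(5)] *(2))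
        with \<open>(a, y) \<in> set E\<close> have "\<exists>az\<in>set E. snd az = y \<and>
            (\<exists>p'\<in>prefix_words. \<gamma> (inv_word q @ g @ inv_word (fst az)) = \<gamma> p')"
          by (intro bexI[of _ "(a, y)"] conjI) (simp_all only: fst_conv snd_conv)
        moreover have "q \<in> insert v (fst ` set (splits v))" using pre *(1) by blast
        ultimately show ?rhs by (rule bexI)
      next
        assume ?rhs
        then obtain q az p' where *: "q \<in> insert v (fst ` set (splits v))" "az \<in> set E" "snd az = y"
          "p' \<in> prefix_words" "\<gamma> (inv_word q @ g @ inv_word (fst az)) = \<gamma> p'"
          by (elim bexE conjE)
        obtain a where az: "az = (a, y)" using *(3) by (cases az) simp
        obtain s where s: "v = q @ s" using pre *(1) by blast
        have "a \<in> words X" using words *(2) az by blast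
        with *(4) p(2) s have w: "q \<in> words X" "a \<in> words X" "p' \<in> words X"
          by (simp_all add: prefix_words_in_words)
        have "\<gamma> g = \<gamma> (q @ p' @ a)"
          by (rule iffD1[OF eq[OF w]]) (use *(5) in \<open>simp only: az fst_conv\<close>)
        moreover obtain e where "fst e \<in> J" "prefix (a @ [y]) (piece u e)"
          using *(2) unfolding E az by blast
        ultimately show "piece_edge v g y"
          unfolding piece_edge_def using s *(4) by blast
      qed
    qed
    ultimately show "((\<exists>qz\<in>set (splits (fst p)).
      (\<lambda>w. snd (snd (fst w)) = snd (snd w) \<and> \<gamma> (fst (snd (fst w))) = \<gamma> (fst (snd w)) \<or>
        snd (snd (fst w)) = flip (snd (snd w)) \<and>
          \<gamma> (fst (snd (fst w))) = \<gamma> (fst (snd w) @ [snd (snd w)])) (p, qz)) \<or>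
      (\<exists>q\<in>insert (fst p) (fst ` set (splits (fst p))).
      \<exists>az\<in>set E. snd az = snd (snd p) \<and>
        (\<exists>p'\<in>prefix_words. \<gamma> (inv_word q @ fst (snd p) @ inv_word (fst az)) = \<gamma> p'))) \<longleftrightarrow>
      edge (fst p) (fst (snd p)) (snd (snd p))"
      by (simp add: p edge_def split_beta)
  qed
qed

text \<open>By \<open>\<mu>_eq_iff\<close>, where reading a word is a bounded quantifier over its
  positions.\<close>

lemma computable_\<mu>_eq:
  "computable (pair_rep (word_rep c X) (word_rep c X)) bool_rep (\<lambda>p. \<mu> (fst p) = \<mu> (snd p))"
proof -
  let ?W = "word_rep c X"
  have "computable (pair_rep ?W ?W) bool_rep
      (\<lambda>p. \<forall>gy\<in>set (splits (snd p)). (\<lambda>w. edge (fst (fst w)) (fst (snd w)) (snd (snd w))) (p, gy))"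
  proof (rule computable_Ball[OF computable_splits[OF computable_proj1(2)]])
    show "computable (pair_rep (pair_rep ?W ?W) (pair_rep ?W (letter_rep c X))) bool_rep
        (\<lambda>w. edge (fst (fst w)) (fst (snd w)) (snd (snd w)))"
      using computable_comp[OF computable_edge computable_pair[OF computable_proj2(1) computable_proj1(2)]]
      by simp
  qed
  then have reads: "computable (pair_rep ?W ?W) bool_rep (\<lambda>p. reads (edge (fst p)) [] (snd p))"
    by (rule computable_cong) (auto simp: reads_iff set_splits Ball_def)
  have "computable (pair_rep ?W ?W) bool_rep (\<lambda>p. \<gamma> (fst p) = \<gamma> (snd p) \<and>
      reads (edge (fst p)) [] (snd p) \<and> reads (edge (snd p)) [] (fst p))"
    by (intro computable_conj computable_\<gamma>_eq reads computable_comp_pair[OF reads] computable_proj)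
  then show ?thesis
    by (rule computable_cong) (simp add: \<mu>_eq_iff pair_rep_def word_rep_iff)
qed

end

text \<open>Pieces are substituted computably. This serves twice, with \<open>P\<close> equality in
  the group and with \<open>P\<close> equality in the monoid.\<close>

lemma decidable_units_if:
  assumes "decidable_word_rel X P"
    and "\<And>\<rho> \<sigma>. \<rho> \<in> words J \<Longrightarrow> \<sigma> \<in> words J \<Longrightarrow> Q \<rho> \<sigma> \<longleftrightarrow> P (subst_word u \<rho>) (subst_word u \<sigma>)"
  shows "decidable_word_rel J Q"
proof -
  obtain c where c: "computable (pair_rep (word_rep c X) (word_rep c X)) bool_rep (\<lambda>p. P (fst p) (snd p))"
    using decidable_word_relE[OF assms(1)] by blast
  obtain d where d: "bij_betw d J {..<card J}" using ex_numbering[OF finite_J] .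
  have "computable (word_rep d J) (word_rep c X) (subst_word u)"
    using d u_words by (intro computable_subst_word finite_J) (auto simp: bij_betw_def)
  note subst = computable_comp[OF this]
  have "computable (pair_rep (word_rep d J) (word_rep d J)) bool_rep
      (\<lambda>p. P (subst_word u (fst p)) (subst_word u (snd p)))"
    by (intro computable_comp_pair[OF c] subst computable_proj)
  then have "computable (pair_rep (word_rep d J) (word_rep d J)) bool_rep (\<lambda>p. Q (fst p) (snd p))"
    by (rule computable_cong) (simp add: assms(2) pair_rep_def word_rep_iff)
  then show ?thesis by (rule decidable_word_relI[OF d])
qed

lemma decidable_if_units:
  assumes "decidable_word_rel J (\<lambda>\<rho> \<sigma>. \<gamma> (subst_word u \<rho>) = \<gamma> (subst_word u \<sigma>))"
  shows "decidable_word_rel X (\<lambda>v w. \<gamma> v = \<gamma> w)" "decidable_word_rel X (\<lambda>v w. \<mu> v = \<mu> w)"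
proof -
  obtain d where d: "bij_betw d J {..<card J}" and
    dec: "computable (pair_rep (word_rep d J) (word_rep d J)) bool_rep
      (\<lambda>p. \<gamma> (subst_word u (fst p)) = \<gamma> (subst_word u (snd p)))"
    using decidable_word_relE[OF assms] by blast
  have one: "computable (word_rep d J) bool_rep (\<lambda>\<rho>. \<gamma> (subst_word u \<rho>) = \<one>\<^bsub>Gp X R\<^esub>)"
    using computable_comp[OF dec computable_pair[OF computable_id computable_Nil]]
    by (simp add: \<gamma>_Nil)
  obtain c where c: "bij_betw c X {..<card X}" using ex_numbering[OF finite_X] .
  obtain e where e: "bij_betw e Y {..<card Y}" using ex_numbering[OF finite_Y] .
  note inj = bij_betw_imp_inj_on[OF c] bij_betw_imp_inj_on[OF d] bij_betw_imp_inj_on[OF e]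
  show "decidable_word_rel X (\<lambda>v w. \<gamma> v = \<gamma> w)"
    by (rule decidable_word_relI[OF c computable_\<gamma>_eq[OF inj one]])
  show "decidable_word_rel X (\<lambda>v w. \<mu> v = \<mu> w)"
    by (rule decidable_word_relI[OF c computable_\<mu>_eq[OF inj one]])
qed

end

section \<open>Locating the markers and comparing the three word problems\<close>

lemma marked_split:
  assumes "count_list (map fst w) x = 1"
  obtains v b z where "w = v @ (x, b) # z" "x \<notin> fst ` set v" "x \<notin> fst ` set z"
proof -
  have "x \<in> fst ` set w" using assms count_list_0_iff[of "map fst w" x] by auto
  then obtain b where "(x, b) \<in> set w" by auto
  then obtain v z where w: "w = v @ (x, b) # z" by (meson split_list)
  have "count_list (map fst v) x = 0" "count_list (map fst z) x = 0"
    using assms unfolding w by simp_all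
  then show thesis using that[OF w] by (simp add: count_list_0_iff)
qed

theorem corollary5p7:
  fixes X :: "'a set" and I :: "'i set" and k :: nat
    and u :: "nat \<Rightarrow> 'a word" and r :: "'i \<Rightarrow> nat word"
    and R :: "('a word \<times> 'a word) set"
    and M G U :: "'a word set monoid"
  assumes "finite X" and "finite I"
    and "\<And>j. j \<in> {1..k} \<Longrightarrow> u j \<in> words X"
    and "\<And>i. i \<in> I \<Longrightarrow> r i \<in> words {1..k}"
    and "\<And>j. j \<in> {1..k} \<Longrightarrow> \<exists>i\<in>I. j \<in> fst ` set (r i)"
    and "R = (\<lambda>i. (subst_word u (r i), [])) ` I"
    and "M = Inv X R" and "G = Gp X R" and "U = units_of M"
    and "E_unitary X R"
    and "minimal_invertible_pieces X R {1..k} u"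
    and "uniquely_marked X {1..k} u"
  shows "(decidable_word_problem G X (\<lambda>x. gp_class X R [(x, True)])
            \<longleftrightarrow> decidable_word_problem M X (\<lambda>x. inv_class X R [(x, True)]))
       \<and> (decidable_word_problem M X (\<lambda>x. inv_class X R [(x, True)])
            \<longleftrightarrow> decidable_word_problem U {1..k} (\<lambda>j. inv_class X R (u j)))"
proof -
  let ?J = "{1..k}"
  define marked where "marked j x b v z \<longleftrightarrow> u j = v @ (x, b) # z \<and> x \<notin> fst ` set v \<and>
      x \<notin> fst ` set z \<and> (\<forall>j'\<in>?J. j' \<noteq> j \<longrightarrow> x \<notin> fst ` set (u j'))" for j x b v z
  have "\<exists>x b v z. marked j x b v z" if j: "j \<in> ?J" for j
  proof -
    obtain x where x: "count_list (map fst (u j)) x = 1"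
      "\<forall>j'\<in>?J. j' \<noteq> j \<longrightarrow> x \<notin> fst ` set (u j')"
      using assms(12) j unfolding uniquely_marked_def by blast
    obtain v b z where "u j = v @ (x, b) # z" "x \<notin> fst ` set v" "x \<notin> fst ` set z"
      using marked_split[OF x(1)] .
    then show ?thesis unfolding marked_def using x(2) by blast
  qed
  \<comment> \<open>Marker, sign and the two surrounding words are packed into one tuple, so that
    they are chosen together.\<close>
  then have "\<forall>j\<in>?J. \<exists>t. marked j (fst t) (fst (snd t)) (fst (snd (snd t))) (snd (snd (snd t)))"
    by simp
  from bchoice[OF this] obtain f where
    f: "\<forall>j\<in>?J. marked j (fst (f j)) (fst (snd (f j))) (fst (snd (snd (f j)))) (snd (snd (snd (f j))))" ..
  define marker sgn left right where "marker j = fst (f j)" and "sgn j = fst (snd (f j))"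
    and "left j = fst (snd (snd (f j)))" and "right j = snd (snd (snd (f j)))" for j
  have "marked j (marker j) (sgn j) (left j) (right j)" if "j \<in> ?J" for j
    using f that by (simp add: marker_def sgn_def left_def right_def)
  then have split: "u j = left j @ (marker j, sgn j) # right j"
    and once: "marker j \<notin> fst ` set (left j)" "marker j \<notin> fst ` set (right j)"
    and other: "j' \<in> ?J \<Longrightarrow> j' \<noteq> j \<Longrightarrow> marker j \<notin> fst ` set (u j')" if "j \<in> ?J" for j j'
    using that unfolding marked_def by blast+
  have words: "w \<in> words A \<longleftrightarrow> fst ` set w \<subseteq> A" for w :: "'b word" and A
    by (induction w) auto
  have unmarked: "fst ` set (left j) \<subseteq> X - marker ` ?J" "fst ` set (right j) \<subseteq> X - marker ` ?J"
    if j: "j \<in> ?J" for j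
  proof -
    have "fst ` set (left j) \<union> fst ` set (right j) \<subseteq> fst ` set (u j)" "fst ` set (u j) \<subseteq> X"
      using split[OF j] assms(3)[OF j] by (auto simp: words)
    moreover have "marker i \<notin> fst ` set (left j) \<union> fst ` set (right j)" if "i \<in> ?J" for i
      using once[OF j] other[OF that j] calculation(1) by (cases "i = j") auto
    ultimately show "fst ` set (left j) \<subseteq> X - marker ` ?J" "fst ` set (right j) \<subseteq> X - marker ` ?J"
      by blast+
  qed
  interpret marked_presentation X R ?J u marker sgn left right
  proof
    show "represents_unit X R (u j)" if "j \<in> ?J" for j
      using assms(11) that by (simp add: minimal_invertible_pieces_def)
    show "w = [] \<and> (\<exists>\<rho>\<in>words ?J. v = subst_word u \<rho>)" if "(v, w) \<in> R" for v w
      using that assms(4) unfolding assms(6) by blast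
    show "inj_on marker ?J"
    proof (rule inj_onI, rule ccontr)
      fix i j assume "i \<in> ?J" "j \<in> ?J" "marker i = marker j" "i \<noteq> j"
      then show False using other[of j i] split[of i] by auto
    qed
    show "left j \<in> words (X - marker ` ?J)" "right j \<in> words (X - marker ` ?J)" if "j \<in> ?J" for j
      using unmarked[OF that] by (simp_all add: words)
  qed (use assms split in auto)
  let ?g = "\<lambda>j. inv_class X R (u j)"
  have G: "decidable_word_problem G X (\<lambda>x. gp_class X R [(x, True)]) \<longleftrightarrow>
      decidable_word_rel X (\<lambda>v w. \<gamma> v = \<gamma> w)"
    unfolding decidable_word_problem_def assms(8)
    using finite_generating_family_X(2)[OF assms(1), of R] word_value_gp_class[of _ X R]
    by (simp cong: decidable_word_rel_cong)
  have M: "decidable_word_problem M X (\<lambda>x. inv_class X R [(x, True)]) \<longleftrightarrow>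
      decidable_word_rel X (\<lambda>v w. \<mu> v = \<mu> w)"
    unfolding decidable_word_problem_def assms(7)
    using finite_generating_family_X(1)[OF assms(1), of R] word_value_inv_class[of _ X R]
    by (simp cong: decidable_word_rel_cong)
  \<comment> \<open>Minimality of the pieces enters here: it makes them generate the group of units,
    as a word problem for this family of generators demands.\<close>
  have "carrier U = word_value U ?g ` words ?J"
    using units_generated[OF assms(11)] word_value_units[of ?J u X R, OF u_words u_unit]
    unfolding assms(7,9) by (simp add: units_of_carrier cong: image_cong)
  then have "finite_generating_family U ?J ?g"
    using u_unit unfolding finite_generating_family_def represents_unit_def assms(7,9)
    by (auto simp: units_of_carrier)
  moreover have "decidable_word_rel ?J (\<lambda>\<rho> \<sigma>. word_value U ?g \<rho> = word_value U ?g \<sigma>) \<longleftrightarrow>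
      decidable_word_rel ?J (\<lambda>\<rho> \<sigma>. \<gamma> (subst_word u \<rho>) = \<gamma> (subst_word u \<sigma>))"
    unfolding assms(7,9) by (rule decidable_word_rel_cong) (simp only: units_eq_iff)
  ultimately have U: "decidable_word_problem U ?J ?g \<longleftrightarrow>
      decidable_word_rel ?J (\<lambda>\<rho> \<sigma>. \<gamma> (subst_word u \<rho>) = \<gamma> (subst_word u \<sigma>))"
    unfolding decidable_word_problem_def by (simp only: simp_thms)
  let ?U = "decidable_word_rel ?J (\<lambda>\<rho> \<sigma>. \<gamma> (subst_word u \<rho>) = \<gamma> (subst_word u \<sigma>))"
  \<comment> \<open>All three problems are compared with one relation, equality in the group of
    products of pieces, which by \<open>U\<close> is the word problem of the units.\<close>
  have GU: ?U if "decidable_word_rel X (\<lambda>v w. \<gamma> v = \<gamma> w)"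
    using that by (rule decidable_units_if) (rule HOL.refl)
  have MU: ?U if "decidable_word_rel X (\<lambda>v w. \<mu> v = \<mu> w)"
    using that by (rule decidable_units_if) (simp only: units_eq_iff(2))
  show ?thesis
    unfolding G M U
    using decidable_if_units GU MU by (intro conjI iffI) (simp_all only:)
qed

end
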